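(* Let $0<\alpha<\beta<1$ be fixed. If $\sigma_g^2>0$, then for any underlying distribution function $H_F$ (no continuity of $H_F$ or of its quantile function is assumed), as $n\to\infty$, $$\frac{\sqrt{n}}{m}\bigl((\beta-\alpha)\,U_{\alpha\beta}-\theta\bigr)\ \stackrel{d}{\longrightarrow}\ \tau_g-\Delta\xi_\alpha\, I(\tau_\alpha>0)\,\tau_\alpha-\Delta\xi_\beta\, I(\tau_\beta<0)\,\tau_\beta ,$$ where $(\tau_\alpha,\tau_g,\tau_\beta)$ is a trivariate Gaussian random vector with mean vector zero and covariance matrix $$\begin{pmatrix}\sigma_{g_\alpha}^2 & c_{gg_\alpha} & c_{g_\alpha g_\beta}\\ c_{gg_\alpha} & \sigma_g^2 & c_{gg_\beta}\\ c_{g_\alpha g_\beta} & c_{gg_\beta} & \sigma_{g_\beta}^2\end{pmatrix}.$$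
   Context: Let $X,X_1,X_2,\ldots$ be i.i.d. random variables with values in a measurable space $(\mathsf X,\mathcal B(\mathsf X))$ with common distribution $F$. Let $m\ge 1$ be a fixed integer, let $h:\mathsf X^m\to\mathbb R$ be a symmetric (measurable) function, and let $H_F$ be the (right-continuous) distribution function of $h(X_1,\ldots,X_m)$. For $n\ge m$ let $N=\binom{n}{m}$, let $h_1,\ldots,h_N$ be an enumeration of the values $h(X_{i_1},\ldots,X_{i_m})$ over all $1\le i_1<\cdots<i_m\le n$, and let $h_{n1}\le\cdots\le h_{nN}$ be the ordered values of $h_1,\ldots,h_N$. $[a]$ denotes the largest integer $\le a$; $I\{A\}$ (or $I(A)$) denotes the indicator of $A$; $H(x-)$ denotes the left limit at $x$. For $0<\gamma<1$ put $N_\gamma=[\gamma N]$, and put $N_{\alpha\beta}=N_\beta-N_\alpha$. The trimmed $U$-statistic is $$U_{\alpha\beta}=N_{\alpha\beta}^{-1}\sum_{i=N_\alpha+1}^{N_\beta}h_{ni}.$$ For $\gamma\in\{\alpha,\beta\}$ let $$\xi_\gamma^-=\inf\{x\in\mathbb R: H_F(x)\ge\gamma\},\qquad \xi_\gamma^+=\sup\{x\in\mathbb R: H_F(x)\le\gamma\},\qquad \Delta\xi_\gamma=\xi_\gamma^+-\xi_\gamma^- .$$ Let $$\theta=\int_{\mathbb R}\Bigl[\bigl((x-\xi^-_\beta)I\{x\le\xi^-_\beta\}+\beta\xi^-_\beta\bigr)-\bigl((x-\xi^+_\alpha)I\{x<\xi^+_\alpha\}+\alpha\xi^+_\alpha\bigr)\Bigr]\,\mathrm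 dH_F(x),$$ and for $x\in\mathsf X$, writing $h(x,\cdot)=h(x,X_2,\ldots,X_m)$, $$g(x)=\bigl[E\,I\{h(x,\cdot)\le\xi^-_\beta\}(h(x,\cdot)-\xi^-_\beta)+\beta\xi^-_\beta\bigr]-\bigl[E\,I\{h(x,\cdot)<\xi^+_\alpha\}(h(x,\cdot)-\xi^+_\alpha)+\alpha\xi^+_\alpha\bigr]-\theta,$$ $$g_\alpha(x)=E\,I\{h(x,\cdot)<\xi^+_\alpha\}-H_F(\xi^+_\alpha-),\qquad g_\beta(x)=E\,I\{h(x,\cdot)\le\xi^-_\beta\}-H_F(\xi^-_\beta).$$ Finally $\sigma_g^2=Eg^2(X)$, $\sigma_{g_\alpha}^2=Eg_\alpha^2(X)$, $\sigma_{g_\beta}^2=Eg_\beta^2(X)$, $c_{gg_\alpha}=Eg(X)g_\alpha(X)$, $c_{gg_\beta}=Eg(X)g_\beta(X)$, $c_{g_\alpha g_\beta}=Eg_\alpha(X)g_\beta(X)$. *)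

theory Defs
  imports "HOL-Probability.Probability"
begin

text \<open>A point of the product of \<open>m\<close> copies of a space is a function on \<open>{1..m}\<close>. In a family
  \<open>X 0, X 1, X 2, \<dots>\<close> of i.i.d. variables the sample is \<open>X 1, X 2, \<dots>\<close>, and \<open>X 0\<close> is the
  generic copy, written \<open>X\<close> without an index in the usual notation.\<close>

definition symmetric_kernel :: "'a measure \<Rightarrow> nat \<Rightarrow> ((nat \<Rightarrow> 'a) \<Rightarrow> real) \<Rightarrow> bool" where
  "symmetric_kernel S m h \<longleftrightarrow>
     (\<forall>\<pi>. \<pi> permutes {1..m} \<longrightarrow> (\<forall>x \<in> {1..m} \<rightarrow>\<^sub>E space S. h (x \<circ> \<pi>) = h x))"

definition kernel_law ::
  "'w measure \<Rightarrow> (nat \<Rightarrow> 'w \<Rightarrow> 'a) \<Rightarrow> nat \<Rightarrow> ((nat \<Rightarrow> 'a) \<Rightarrow> real) \<Rightarrow> real measure" where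
  "kernel_law P X m h = distr P borel (\<lambda>\<omega>. h (\<lambda>j\<in>{1..m}. X j \<omega>))"

definition kernel_cdf ::
  "'w measure \<Rightarrow> (nat \<Rightarrow> 'w \<Rightarrow> 'a) \<Rightarrow> nat \<Rightarrow> ((nat \<Rightarrow> 'a) \<Rightarrow> real) \<Rightarrow> real \<Rightarrow> real" where
  "kernel_cdf P X m h = cdf (kernel_law P X m h)"

definition lower_quantile :: "(real \<Rightarrow> real) \<Rightarrow> real \<Rightarrow> real" where
  "lower_quantile H \<gamma> = Inf {x. H x \<ge> \<gamma>}"

definition upper_quantile :: "(real \<Rightarrow> real) \<Rightarrow> real \<Rightarrow> real" where
  "upper_quantile H \<gamma> = Sup {x. H x \<le> \<gamma>}"

definition quantile_jump :: "(real \<Rightarrow> real) \<Rightarrow> real \<Rightarrow> real" where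
  "quantile_jump H \<gamma> = upper_quantile H \<gamma> - lower_quantile H \<gamma>"


subsection \<open>The trimmed U-statistic\<close>

definition index_tuples :: "nat \<Rightarrow> nat \<Rightarrow> (nat \<Rightarrow> nat) set" where
  "index_tuples m n = {\<iota> \<in> {1..m} \<rightarrow>\<^sub>E {1..n}. strict_mono_on {1..m} \<iota>}"

definition ordered_kernel_values ::
  "(nat \<Rightarrow> 'w \<Rightarrow> 'a) \<Rightarrow> nat \<Rightarrow> ((nat \<Rightarrow> 'a) \<Rightarrow> real) \<Rightarrow> nat \<Rightarrow> 'w \<Rightarrow> real list" where
  "ordered_kernel_values X m h n \<omega> =
     sorted_list_of_multiset
       (image_mset (\<lambda>\<iota>. h (\<lambda>j\<in>{1..m}. X (\<iota> j) \<omega>)) (mset_set (index_tuples m n)))"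

definition trim_index :: "nat \<Rightarrow> real \<Rightarrow> nat \<Rightarrow> nat" where
  "trim_index m \<gamma> n = nat \<lfloor>\<gamma> * real (n choose m)\<rfloor>"

text \<open>List positions start at \<open>0\<close>, so \<open>h\<^sub>n\<^sub>i\<close> is at position \<open>i - 1\<close>. For the finitely many \<open>n\<close> with
  no term in the sum the value is \<open>0\<close>.\<close>

definition trimmed_U ::
  "(nat \<Rightarrow> 'w \<Rightarrow> 'a) \<Rightarrow> nat \<Rightarrow> ((nat \<Rightarrow> 'a) \<Rightarrow> real) \<Rightarrow> real \<Rightarrow> real \<Rightarrow> nat \<Rightarrow> 'w \<Rightarrow> real" where
  "trimmed_U X m h \<alpha> \<beta> n \<omega> =
     (\<Sum>i = trim_index m \<alpha> n + 1..trim_index m \<beta> n. ordered_kernel_values X m h n \<omega> ! (i - 1))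
       / (real (trim_index m \<beta> n) - real (trim_index m \<alpha> n))"


subsection \<open>The centering constant and the projections\<close>

definition trim_fun :: "(real \<Rightarrow> real) \<Rightarrow> real \<Rightarrow> real \<Rightarrow> real \<Rightarrow> real" where
  "trim_fun H \<alpha> \<beta> y =
     (let b = lower_quantile H \<beta>; a = upper_quantile H \<alpha> in
       ((y - b) * of_bool (y \<le> b) + \<beta> * b) - ((y - a) * of_bool (y < a) + \<alpha> * a))"

definition theta ::
  "'w measure \<Rightarrow> (nat \<Rightarrow> 'w \<Rightarrow> 'a) \<Rightarrow> nat \<Rightarrow> ((nat \<Rightarrow> 'a) \<Rightarrow> real) \<Rightarrow> real \<Rightarrow> real \<Rightarrow> real" where
  "theta P X m h \<alpha> \<beta> =
     (\<integral>y. trim_fun (kernel_cdf P X m h) \<alpha> \<beta> y \<partial>kernel_law P X m h)"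

text \<open>\<open>h(x, X\<^sub>2, \<dots>, X\<^sub>m)\<close>\<close>

definition kernel_section ::
  "(nat \<Rightarrow> 'w \<Rightarrow> 'a) \<Rightarrow> nat \<Rightarrow> ((nat \<Rightarrow> 'a) \<Rightarrow> real) \<Rightarrow> 'a \<Rightarrow> 'w \<Rightarrow> real" where
  "kernel_section X m h x \<omega> = h (\<lambda>j\<in>{1..m}. if j = 1 then x else X j \<omega>)"

text \<open>The two bracketed terms of \<open>g\<close> are taken under one expectation, as in \<open>\<theta>\<close>. Without a moment
  assumption on \<open>h\<close> their separate expectations can both be \<open>-\<infinity>\<close>, whereas their difference is a
  bounded random variable.\<close>

definition proj_g ::
  "'w measure \<Rightarrow> (nat \<Rightarrow> 'w \<Rightarrow> 'a) \<Rightarrow> nat \<Rightarrow> ((nat \<Rightarrow> 'a) \<Rightarrow> real) \<Rightarrow> real \<Rightarrow> real \<Rightarrow> 'a \<Rightarrow> real" where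
  "proj_g P X m h \<alpha> \<beta> x =
     (\<integral>\<omega>. trim_fun (kernel_cdf P X m h) \<alpha> \<beta> (kernel_section X m h x \<omega>) \<partial>P)
       - theta P X m h \<alpha> \<beta>"

definition proj_lower ::
  "'w measure \<Rightarrow> (nat \<Rightarrow> 'w \<Rightarrow> 'a) \<Rightarrow> nat \<Rightarrow> ((nat \<Rightarrow> 'a) \<Rightarrow> real) \<Rightarrow> real \<Rightarrow> 'a \<Rightarrow> real" where
  "proj_lower P X m h \<alpha> x =
     (let H = kernel_cdf P X m h; a = upper_quantile H \<alpha> in
       (\<integral>\<omega>. of_bool (kernel_section X m h x \<omega> < a) \<partial>P) - Lim (at_left a) H)"

definition proj_upper ::
  "'w measure \<Rightarrow> (nat \<Rightarrow> 'w \<Rightarrow> 'a) \<Rightarrow> nat \<Rightarrow> ((nat \<Rightarrow> 'a) \<Rightarrow> real) \<Rightarrow> real \<Rightarrow> 'a \<Rightarrow> real" where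
  "proj_upper P X m h \<beta> x =
     (let H = kernel_cdf P X m h; b = lower_quantile H \<beta> in
       (\<integral>\<omega>. of_bool (kernel_section X m h x \<omega> \<le> b) \<partial>P) - H b)"


subsection \<open>Gaussian random vectors\<close>

text \<open>Constants count as normal variables, so singular covariance matrices are allowed.\<close>

definition normal_variable :: "'q measure \<Rightarrow> ('q \<Rightarrow> real) \<Rightarrow> bool" where
  "normal_variable Q Y \<longleftrightarrow>
     Y \<in> borel_measurable Q \<and>
     ((\<exists>c. AE \<omega> in Q. Y \<omega> = c) \<or>
      (\<exists>\<mu> \<sigma>. \<sigma> > 0 \<and> distributed Q lborel Y (normal_density \<mu> \<sigma>)))"

definition gaussian_vector ::
  "'q measure \<Rightarrow> ('q \<Rightarrow> real ^ 'n) \<Rightarrow> real ^ 'n \<Rightarrow> real ^ 'n ^ 'n \<Rightarrow> bool" where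
  "gaussian_vector Q Z \<mu> \<Sigma> \<longleftrightarrow>
     Z \<in> borel_measurable Q \<and>
     (\<forall>t. normal_variable Q (\<lambda>\<omega>. t \<bullet> Z \<omega>)) \<and>
     (\<forall>i. (\<integral>\<omega>. Z \<omega> $ i \<partial>Q) = \<mu> $ i) \<and>
     (\<forall>i j. (\<integral>\<omega>. (Z \<omega> $ i - \<mu> $ i) * (Z \<omega> $ j - \<mu> $ j) \<partial>Q) = \<Sigma> $ i $ j)"

end

theory Submission
  imports Defs
begin

text \<open>The sum of the \<open>k\<close> smallest of \<open>N\<close> numbers \<open>y\<^sub>i\<close> is the maximum over \<open>c\<close> of the concave function
\<open>k c - (\<Sum>i. max 0 (c - y\<^sub>i))\<close>, whose right slope at \<open>c\<close> is \<open>k - card {i. y\<^sub>i \<le> c}\<close>. This removes the order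
statistics from the problem. Take \<open>k = \<lfloor>\<gamma> N\<rfloor>\<close> and let the \<open>y\<^sub>i\<close> be the \<open>N\<close> kernel values, with empirical
distribution function \<open>H\<^sub>N\<close>, and let \<open>l \<le> u\<close> be the lower and upper \<open>\<gamma>\<close>-quantiles of the law of the kernel.
The maximiser lies, with probability tending to one, in any neighbourhood of \<open>[l, u]\<close>. Between \<open>l\<close> and \<open>u\<close>
there are almost surely no values, so the function is linear there, with slope \<open>N (\<gamma> - H\<^sub>N(l))\<close> up to
rounding; just outside \<open>[l, u]\<close> its slope towards the outside is at most of order \<open>N / sqrt n\<close> and the
remaining distance is arbitrarily small. Hence the maximum exceeds the value at \<open>l\<close> by
\<open>N (u - l) max 0 (\<gamma> - H\<^sub>N(l)) + o(N / sqrt n)\<close> in probability. This is \<open>lower_sum_remainder\<close>, and it is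
the source of the non-linear terms of the limit: where the quantile function jumps, only
one sign of the fluctuation of \<open>H\<^sub>N\<close> moves the empirical quantile across the gap.

Subtracting the two levels \<open>\<alpha>\<close> and \<open>\<beta>\<close>, at the upper \<open>\<alpha>\<close>-quantile and the lower \<open>\<beta>\<close>-quantile, what remains is
a U-statistic with the bounded kernel \<open>trim_fun \<circ> h\<close> plus two piecewise linear functions of
U-statistics with indicator kernels (\<open>trimmed_U_linear_part\<close>). Each of these kernels is bounded, however
heavy the tails of \<open>h\<close> are.

For a bounded symmetric kernel, a centred U-statistic minus its Hajek projection has a kernel whose conditional
expectation given any one argument vanishes. Products over two index sets that share at most one
element then have expectation zero, and only a fraction of order \<open>1 / n\<^sup>2\<close> of the pairs of index sets
share at least two elements. So the scaled difference tends to zero in mean (\<open>hajek_projection_L1\<close>).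

The statistic is thereby, up to a term that vanishes in probability, a fixed continuous function
of a normalised sum of i.i.d. bounded vectors in three dimensions. The one-dimensional central limit theorem,
applied to every linear functional, gives the convergence of the characteristic functions of these sums to that
of the Gaussian vector. A Cramer-Wold argument
(\<open>expectation_tendsto_of_char_tendsto\<close>) upgrades it to expectations of bounded continuous functions, and
the one-dimensional continuity theorem of Levy concludes.\<close>

section \<open>Convergence of expectations from convergence of characteristic functions\<close>

text \<open>Complex span of the characters of the space. Expectations of its elements are finite combinations of values of the
characteristic function, and it is closed under products.\<close>

inductive trig_poly :: "('a::real_inner \<Rightarrow> complex) \<Rightarrow> bool" where
  exp: "trig_poly (\<lambda>x. iexp (t \<bullet> x))"
| scale: "trig_poly p \<Longrightarrow> trig_poly (\<lambda>x. c * p x)"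
| add: "trig_poly p \<Longrightarrow> trig_poly q \<Longrightarrow> trig_poly (\<lambda>x. p x + q x)"

lemma trig_poly_const: "trig_poly (\<lambda>x. c)"
  using trig_poly.scale[OF trig_poly.exp[of 0], of c] by simp

lemma trig_poly_mult:
  assumes "trig_poly p" "trig_poly q"
  shows "trig_poly (\<lambda>x. p x * q x)"
  using assms(1)
proof induction
  case (exp t)
  show ?case
    using assms(2)
  proof induction
    case (exp s)
    show ?case
      using trig_poly.exp[of "t + s"]
      by (simp add: inner_add_left distrib_left exp_add)
  next
    case (scale q c)
    then show ?case using trig_poly.scale[of _ c] by (simp add: ac_simps)
  next
    case (add q r)
    then show ?case using trig_poly.add by (simp add: distrib_left)
  qed
next
  case (scale p c)
  then show ?case using trig_poly.scale[of _ c] by (simp add: ac_simps)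
next
  case (add p r)
  then show ?case using trig_poly.add by (simp add: distrib_right)
qed

lemma trig_poly_sum: "finite A \<Longrightarrow> (\<And>i. i \<in> A \<Longrightarrow> trig_poly (p i)) \<Longrightarrow> trig_poly (\<lambda>x. \<Sum>i\<in>A. p i x)"
  by (induction A rule: finite_induct) (auto intro: trig_poly_const trig_poly.add)

lemma trig_poly_sin: "trig_poly (\<lambda>x. complex_of_real (sin (t \<bullet> x)))"
proof -
  have "trig_poly (\<lambda>x. 1 / (2 * \<i>) * (iexp (t \<bullet> x) + (-1) * iexp ((- t) \<bullet> x)))"
    by (intro trig_poly.intros)
  moreover have "complex_of_real (sin (t \<bullet> x)) = 1 / (2 * \<i>) * (iexp (t \<bullet> x) + (-1) * iexp ((- t) \<bullet> x))" for x
    by (simp add: sin_of_real[symmetric] sin_exp_eq field_simps)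
  ultimately show ?thesis by simp
qed

text \<open>A bounded substitute for the coordinates of \<open>x\<close>: polynomials in the values of this map are
trigonometric polynomials in \<open>x\<close>, and for \<open>c > 0\<close> the map is injective on the box \<open>\<bar>x \<bullet> i\<bar> \<le> pi / (2 c)\<close>.\<close>

definition sine_coords :: "real \<Rightarrow> 'a::euclidean_space \<Rightarrow> 'a" where
  "sine_coords c x = (\<Sum>i\<in>Basis. sin (c * (x \<bullet> i)) *\<^sub>R i)"

lemma trig_poly_of_sine_coords:
  assumes "real_polynomial_function p"
  shows "trig_poly (\<lambda>x. complex_of_real (p (sine_coords c x)))"
  using assms
proof induction
  case (linear f)
  interpret bounded_linear f by fact
  have "trig_poly (\<lambda>x. \<Sum>i\<in>Basis. complex_of_real (f i) * complex_of_real (sin ((c *\<^sub>R i) \<bullet> x)))"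
    by (intro trig_poly_sum trig_poly.scale trig_poly_sin) auto
  also have "(\<lambda>x. \<Sum>i\<in>Basis. complex_of_real (f i) * complex_of_real (sin ((c *\<^sub>R i) \<bullet> x)))
      = (\<lambda>x. complex_of_real (f (sine_coords c x)))"
    by (simp add: sine_coords_def sum scale inner_commute mult.commute fun_eq_iff)
  finally show ?case .
qed (auto intro: trig_poly_const trig_poly.add trig_poly_mult)

lemma trig_poly_bounded_continuous:
  assumes "trig_poly p"
  shows "(\<exists>B. \<forall>x. norm (p x) \<le> B) \<and> continuous_on UNIV p"
  using assms
proof induction
  case (exp t)
  have "norm (iexp (t \<bullet> x)) \<le> 1" for x by simp
  moreover have "continuous_on UNIV (\<lambda>x. iexp (t \<bullet> x))" by (intro continuous_intros)
  ultimately show ?case by blast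
next
  case (scale p c)
  then obtain B where "norm (p x) \<le> B" for x by auto
  then have "norm (c * p x) \<le> norm c * B" for x by (auto simp: norm_mult intro: mult_left_mono)
  moreover have "continuous_on UNIV (\<lambda>x. c * p x)" using scale by (intro continuous_intros) simp
  ultimately show ?case by blast
next
  case (add p q)
  then obtain B C where "norm (p x) \<le> B" "norm (q x) \<le> C" for x by auto
  then have "norm (p x + q x) \<le> B + C" for x by (meson add_mono norm_triangle_le)
  moreover have "continuous_on UNIV (\<lambda>x. p x + q x)" using add by (intro continuous_intros) simp_all
  ultimately show ?case by blast
qed

lemma trig_poly_integrable:
  fixes p :: "'a::euclidean_space \<Rightarrow> complex"
  assumes "prob_space P" "trig_poly p" and [measurable]: "Y \<in> borel_measurable P"
  shows "integrable P (\<lambda>\<omega>. p (Y \<omega>))"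
proof -
  interpret prob_space P by fact
  from trig_poly_bounded_continuous[OF assms(2)] obtain B
    where B: "norm (p x) \<le> B" and "continuous_on UNIV p" for x by auto
  then have [measurable]: "p \<in> borel_measurable borel"
    by (simp add: borel_measurable_continuous_onI)
  show ?thesis by (rule integrable_const_bound[where B = B]) (use B in auto)
qed

lemma trig_poly_integral_tendsto:
  fixes Y :: "nat \<Rightarrow> 'w \<Rightarrow> 'a::euclidean_space" and Z :: "'q \<Rightarrow> 'a"
  assumes P: "prob_space P" and Q: "prob_space Q"
    and Y: "\<And>n. Y n \<in> borel_measurable P" and Z: "Z \<in> borel_measurable Q"
    and char: "\<And>t. (\<lambda>n. CLINT \<omega>|P. iexp (t \<bullet> Y n \<omega>)) \<longlonglongrightarrow> (CLINT \<omega>|Q. iexp (t \<bullet> Z \<omega>))"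
    and "trig_poly p"
  shows "(\<lambda>n. CLINT \<omega>|P. p (Y n \<omega>)) \<longlonglongrightarrow> (CLINT \<omega>|Q. p (Z \<omega>))"
  using \<open>trig_poly p\<close>
proof induction
  case (exp t)
  show ?case by (rule char)
next
  case (scale p c)
  then show ?case by (simp add: tendsto_mult_left)
next
  case (add p q)
  then show ?case
    by (simp add: trig_poly_integrable[OF P _ Y] trig_poly_integrable[OF Q _ Z] tendsto_add)
qed

lemma sine_coords_arcsin:
  assumes "c > 0" and "\<And>i. i \<in> Basis \<Longrightarrow> \<bar>x \<bullet> i\<bar> \<le> pi / (2 * c)"
  shows "(\<Sum>i\<in>Basis. (arcsin (sine_coords c x \<bullet> i) / c) *\<^sub>R i) = x"
proof -
  have "arcsin (sine_coords c x \<bullet> i) / c = x \<bullet> i" if i: "i \<in> Basis" for i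
  proof -
    have "\<bar>c * (x \<bullet> i)\<bar> \<le> pi / 2"
      using assms(2)[OF i] assms(1) by (simp add: abs_mult field_simps)
    then have "arcsin (sin (c * (x \<bullet> i))) = c * (x \<bullet> i)"
      by (intro arcsin_sin) (auto simp: abs_le_iff)
    then show ?thesis
      using assms(1) i by (simp add: sine_coords_def)
  qed
  then show ?thesis by (simp add: euclidean_representation)
qed

text \<open>Undoing the sines by arcsines turns \<open>f\<close>, restricted to the box of half-width \<open>R\<close>, into a
continuous function on the unit cube, which Stone-Weierstrass approximates by a polynomial. The approximation is
a trigonometric polynomial of \<open>x\<close>; outside the box it is no longer close to \<open>f\<close>, but periodicity
keeps it bounded there.\<close>

lemma sine_polynomial_approximation:
  fixes f :: "'a::euclidean_space \<Rightarrow> real"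
  assumes cont: "continuous_on UNIV f" and bdd: "\<And>x. \<bar>f x\<bar> \<le> B" and "R > 0" and "e > 0"
  obtains p where "real_polynomial_function p"
    and "\<And>x. (\<forall>i\<in>Basis. \<bar>x \<bullet> i\<bar> \<le> R) \<Longrightarrow> \<bar>f x - p (sine_coords (pi / (2 * R)) x)\<bar> \<le> e"
    and "\<And>x. \<bar>f x - p (sine_coords (pi / (2 * R)) x)\<bar> \<le> 2 * B + e"
proof -
  define c where "c = pi / (2 * R)"
  have c: "c > 0" "pi / (2 * c) = R" using \<open>R > 0\<close> by (auto simp: c_def)
  let ?K = "cbox (- One) One :: 'a set"
  let ?inv = "\<lambda>u :: 'a. \<Sum>i\<in>Basis. (arcsin (u \<bullet> i) / c) *\<^sub>R i"
  have K: "u \<bullet> i \<in> {-1..1}" if "u \<in> ?K" "i \<in> Basis" for u i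
    using that by (auto simp: mem_box)
  have "continuous_on ?K ?inv"
    using c K by (auto intro!: continuous_intros)
  with cont have "continuous_on ?K (f \<circ> ?inv)"
    by (intro continuous_on_compose) (auto intro: continuous_on_subset)
  from Stone_Weierstrass_real_polynomial_function[OF compact_cbox this \<open>e > 0\<close>]
  obtain p where p: "real_polynomial_function p" and pe: "\<And>u. u \<in> ?K \<Longrightarrow> \<bar>(f \<circ> ?inv) u - p u\<bar> < e"
    by blast
  have inK: "sine_coords c x \<in> ?K" for x
    by (auto simp: mem_box sine_coords_def)
  show ?thesis
  proof
    show "real_polynomial_function p" by fact
    fix x :: 'a
    show "\<bar>f x - p (sine_coords (pi / (2 * R)) x)\<bar> \<le> e" if "\<forall>i\<in>Basis. \<bar>x \<bullet> i\<bar> \<le> R"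
      using pe[OF inK[of x]] sine_coords_arcsin[of c x] that c
      by (simp add: c_def[symmetric])
    show "\<bar>f x - p (sine_coords (pi / (2 * R)) x)\<bar> \<le> 2 * B + e"
      using pe[OF inK[of x]] bdd[of x] bdd[of "?inv (sine_coords c x)"]
      by (simp add: c_def[symmetric] abs_le_iff abs_less_iff)
  qed
qed

text \<open>A continuous function between the indicators of \<open>\<bar>s\<bar> \<ge> L + 1\<close> and of \<open>\<bar>s\<bar> > L\<close>, so that tightness
can be read off from weak convergence without regard to the atoms of the limit.\<close>

definition tail_ramp :: "real \<Rightarrow> real \<Rightarrow> real" where
  "tail_ramp L s = min 1 (max 0 (\<bar>s\<bar> - L))"

lemma tail_ramp_bounds: "0 \<le> tail_ramp L s" "tail_ramp L s \<le> 1"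
  by (auto simp: tail_ramp_def)

lemma continuous_tail_ramp: "isCont (tail_ramp L) s"
  unfolding tail_ramp_def[abs_def] by (intro continuous_intros)

lemma measurable_tail_ramp [measurable]: "tail_ramp L \<in> borel_measurable borel"
  unfolding tail_ramp_def[abs_def] by measurable

lemma integrable_tail_ramp:
  assumes "prob_space P" and [measurable]: "V \<in> borel_measurable P"
  shows "integrable P (\<lambda>\<omega>. tail_ramp L (V \<omega>))"
proof -
  interpret prob_space P by fact
  show ?thesis
    by (rule integrable_const_bound[where B = 1]) (auto simp: tail_ramp_bounds)
qed

lemma tail_ramp_integral_vanishes:
  assumes "prob_space Q" and [measurable]: "V \<in> borel_measurable Q"
  shows "(\<lambda>L::nat. LINT \<omega>|Q. tail_ramp (real L) (V \<omega>)) \<longlonglongrightarrow> 0"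
proof -
  interpret prob_space Q by fact
  have "(\<lambda>L::nat. LINT \<omega>|Q. tail_ramp (real L) (V \<omega>)) \<longlonglongrightarrow> (LINT \<omega>|Q. 0)"
  proof (rule integral_dominated_convergence[where w = "\<lambda>_. 1"])
    show "AE \<omega> in Q. (\<lambda>L::nat. tail_ramp (real L) (V \<omega>)) \<longlonglongrightarrow> 0"
    proof (intro AE_I2 tendsto_eventually)
      fix \<omega>
      obtain k :: nat where "\<bar>V \<omega>\<bar> \<le> real k" using real_arch_simple by blast
      then show "\<forall>\<^sub>F L in sequentially. tail_ramp (real L) (V \<omega>) = 0"
        by (intro eventually_sequentiallyI[of k]) (auto simp: tail_ramp_def)
    qed
  qed (auto simp: tail_ramp_bounds)
  then show ?thesis by simp
qed

lemma weak_conv_of_char_tendsto: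
  fixes Y :: "nat \<Rightarrow> 'w \<Rightarrow> real" and Z :: "'q \<Rightarrow> real"
  assumes P: "prob_space P" and Q: "prob_space Q"
    and [measurable]: "\<And>n. Y n \<in> borel_measurable P" "Z \<in> borel_measurable Q"
    and char: "\<And>t. (\<lambda>n. CLINT \<omega>|P. iexp (t * Y n \<omega>)) \<longlonglongrightarrow> (CLINT \<omega>|Q. iexp (t * Z \<omega>))"
  shows "weak_conv_m (\<lambda>n. distr P borel (Y n)) (distr Q borel Z)"
proof (rule levy_continuity)
  fix n show "real_distribution (distr P borel (Y n))"
    using P by (intro prob_space.real_distribution_distr) auto
next
  show "real_distribution (distr Q borel Z)"
    using Q by (intro prob_space.real_distribution_distr) auto
next
  fix t show "(\<lambda>n. char (distr P borel (Y n)) t) \<longlonglongrightarrow> char (distr Q borel Z) t"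
    using char[of t] by (simp add: char_def integral_distr)
qed

text \<open>Cramer-Wold: the characteristic functions determine the expectations of trigonometric polynomials, and these
approximate a bounded continuous function uniformly on boxes. The mass outside a box is controlled one
coordinate at a time by the continuity theorem on the line.\<close>

theorem expectation_tendsto_of_char_tendsto:
  fixes Y :: "nat \<Rightarrow> 'w \<Rightarrow> 'a::euclidean_space" and Z :: "'q \<Rightarrow> 'a" and f :: "'a \<Rightarrow> real"
  assumes P: "prob_space P" and Q: "prob_space Q"
    and Y [measurable]: "\<And>n. Y n \<in> borel_measurable P" and Z [measurable]: "Z \<in> borel_measurable Q"
    and char: "\<And>t. (\<lambda>n. CLINT \<omega>|P. iexp (t \<bullet> Y n \<omega>)) \<longlonglongrightarrow> (CLINT \<omega>|Q. iexp (t \<bullet> Z \<omega>))"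
    and cont: "continuous_on UNIV f" and bdd: "\<And>x. \<bar>f x\<bar> \<le> B"
  shows "(\<lambda>n. LINT \<omega>|P. f (Y n \<omega>)) \<longlonglongrightarrow> (LINT \<omega>|Q. f (Z \<omega>))"
proof (rule LIMSEQ_I)
  fix r :: real assume "r > 0"
  interpret P: prob_space P by fact
  interpret Q: prob_space Q by fact
  have "B \<ge> 0" using bdd[of 0] by linarith
  define D where "D = real DIM('a)"
  have "D \<ge> 0" by (simp add: D_def)
  define K where "K = 3 + 2 * ((2 * B + 1) * D)"
  have "K > 0" using \<open>B \<ge> 0\<close> \<open>D \<ge> 0\<close> by (simp add: K_def add_pos_nonneg)
  \<comment> \<open>\<open>K\<close> collects the coefficients of \<open>e\<close> in the final estimate; \<open>e \<le> 1\<close> lets \<open>2 * B + e\<close> be replaced by \<open>2 * B + 1\<close>.\<close>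
  define e where "e = min 1 (r / K)"
  have e: "e > 0" "e \<le> 1" using \<open>r > 0\<close> \<open>K > 0\<close> by (auto simp: e_def)
  have [measurable]: "f \<in> borel_measurable borel"
    using cont by (rule borel_measurable_continuous_onI)
  have "\<forall>\<^sub>F L::nat in sequentially. \<forall>i\<in>Basis. (LINT \<omega>|Q. tail_ramp (real L) (Z \<omega> \<bullet> i)) < e"
    by (intro eventually_ball_finite ballI order_tendstoD(2)[OF tail_ramp_integral_vanishes[OF Q]])
       (use e in auto)
  from eventually_happens'[OF sequentially_bot this] obtain L :: nat
    where L: "\<And>i. i \<in> Basis \<Longrightarrow> (LINT \<omega>|Q. tail_ramp (real L) (Z \<omega> \<bullet> i)) < e"
    by blast
  define R where "R = real L + 1"
  have "R > 0" by (simp add: R_def)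
  from sine_polynomial_approximation[OF cont bdd this e(1)] obtain p
    where p: "real_polynomial_function p"
      and near: "\<And>x. (\<forall>i\<in>Basis. \<bar>x \<bullet> i\<bar> \<le> R) \<Longrightarrow> \<bar>f x - p (sine_coords (pi / (2 * R)) x)\<bar> \<le> e"
      and far: "\<And>x. \<bar>f x - p (sine_coords (pi / (2 * R)) x)\<bar> \<le> 2 * B + e"
    by blast
  define q where "q x = p (sine_coords (pi / (2 * R)) x)" for x
  have trig: "trig_poly (\<lambda>x. complex_of_real (q x))"
    unfolding q_def by (rule trig_poly_of_sine_coords[OF p])
  have q_int: "integrable M (\<lambda>\<omega>. q (V \<omega>))" if "prob_space M" "V \<in> borel_measurable M" for M :: "'c measure" and V
    using trig_poly_integrable[OF that(1) trig that(2)] by (simp add: complex_of_real_integrable_eq)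
  have f_int: "integrable M (\<lambda>\<omega>. f (V \<omega>))" if "prob_space M" and [measurable]: "V \<in> borel_measurable M" for M :: "'c measure" and V
    by (rule finite_measure.integrable_const_bound[where B = B])
       (use that bdd in \<open>auto simp: prob_space_def\<close>)
  have pointwise: "\<bar>f x - q x\<bar> \<le> e + (2 * B + 1) * (\<Sum>i\<in>Basis. tail_ramp (real L) (x \<bullet> i))" for x
  proof (cases "\<forall>i\<in>Basis. \<bar>x \<bullet> i\<bar> \<le> R")
    case True
    have "0 \<le> (2 * B + 1) * (\<Sum>i\<in>Basis. tail_ramp (real L) (x \<bullet> i))"
      using \<open>B \<ge> 0\<close> by (intro mult_nonneg_nonneg sum_nonneg) (auto simp: tail_ramp_bounds)
    with near[OF True] show ?thesis by (simp add: q_def)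
  next
    case False
    then obtain i where i: "i \<in> Basis" "\<bar>x \<bullet> i\<bar> > R" by auto
    then have "tail_ramp (real L) (x \<bullet> i) = 1" by (simp add: tail_ramp_def R_def)
    then have "1 \<le> (\<Sum>i\<in>Basis. tail_ramp (real L) (x \<bullet> i))"
      using i member_le_sum[of i Basis "\<lambda>i. tail_ramp (real L) (x \<bullet> i)"]
      by (auto simp: tail_ramp_bounds)
    then have "(2 * B + 1) * 1 \<le> (2 * B + 1) * (\<Sum>i\<in>Basis. tail_ramp (real L) (x \<bullet> i))"
      using \<open>B \<ge> 0\<close> by (intro mult_left_mono) auto
    with far[of x] e show ?thesis by (simp add: q_def)
  qed
  have approx: "\<bar>(LINT \<omega>|M. f (V \<omega>)) - (LINT \<omega>|M. q (V \<omega>))\<bar> \<le> e + (2 * B + 1) * (D * e)"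
    if M: "prob_space M" and V [measurable]: "V \<in> borel_measurable M"
      and tail: "\<forall>i\<in>Basis. (LINT \<omega>|M. tail_ramp (real L) (V \<omega> \<bullet> i)) < e" for M :: "'c measure" and V
  proof -
    interpret M: prob_space M by fact
    have tail_int: "integrable M (\<lambda>\<omega>. tail_ramp (real L) (V \<omega> \<bullet> i))" for i
      by (rule integrable_tail_ramp[OF M]) measurable
    have "\<bar>(LINT \<omega>|M. f (V \<omega>)) - (LINT \<omega>|M. q (V \<omega>))\<bar> = \<bar>LINT \<omega>|M. f (V \<omega>) - q (V \<omega>)\<bar>"
      by (simp add: f_int[OF M V] q_int[OF M V])
    also have "\<dots> \<le> (LINT \<omega>|M. e + (2 * B + 1) * (\<Sum>i\<in>Basis. tail_ramp (real L) (V \<omega> \<bullet> i)))"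
      by (rule integral_abs_bound[THEN order_trans], rule integral_mono)
         (auto simp: pointwise f_int[OF M V] q_int[OF M V] tail_int)
    also have "\<dots> = e + (2 * B + 1) * (\<Sum>i\<in>Basis. LINT \<omega>|M. tail_ramp (real L) (V \<omega> \<bullet> i))"
      by (simp add: tail_int M.prob_space integral_sum)
    also have "\<dots> \<le> e + (2 * B + 1) * (D * e)"
      unfolding D_def using \<open>B \<ge> 0\<close> tail
      by (intro add_left_mono mult_left_mono sum_bounded_above) (auto intro: less_imp_le)
    finally show ?thesis .
  qed
  have ev_tail: "\<forall>\<^sub>F n in sequentially. \<forall>i\<in>Basis. (LINT \<omega>|P. tail_ramp (real L) (Y n \<omega> \<bullet> i)) < e"
  proof (intro eventually_ball_finite ballI)
    fix i :: 'a assume i: "i \<in> Basis"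
    have "weak_conv_m (\<lambda>n. distr P borel (\<lambda>\<omega>. Y n \<omega> \<bullet> i)) (distr Q borel (\<lambda>\<omega>. Z \<omega> \<bullet> i))"
      using char[of "_ *\<^sub>R i"]
      by (intro weak_conv_of_char_tendsto P Q) (auto simp: inner_commute)
    then have "(\<lambda>n. LINT x|distr P borel (\<lambda>\<omega>. Y n \<omega> \<bullet> i). tail_ramp (real L) x)
        \<longlonglongrightarrow> (LINT x|distr Q borel (\<lambda>\<omega>. Z \<omega> \<bullet> i). tail_ramp (real L) x)"
      by (intro weak_conv_imp_integral_bdd_continuous_conv[where B = 1]
            P.real_distribution_distr Q.real_distribution_distr continuous_tail_ramp)
         (auto simp: tail_ramp_bounds)
    then have "(\<lambda>n. LINT \<omega>|P. tail_ramp (real L) (Y n \<omega> \<bullet> i)) \<longlonglongrightarrow> (LINT \<omega>|Q. tail_ramp (real L) (Z \<omega> \<bullet> i))"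
      by (simp add: integral_distr)
    then show "\<forall>\<^sub>F n in sequentially. (LINT \<omega>|P. tail_ramp (real L) (Y n \<omega> \<bullet> i)) < e"
      by (rule order_tendstoD(2)) (rule L[OF i])
  qed simp
  have "(\<lambda>n. CLINT \<omega>|P. complex_of_real (q (Y n \<omega>))) \<longlonglongrightarrow> (CLINT \<omega>|Q. complex_of_real (q (Z \<omega>)))"
    by (rule trig_poly_integral_tendsto[OF P Q Y Z char trig])
  then have "(\<lambda>n. LINT \<omega>|P. q (Y n \<omega>)) \<longlonglongrightarrow> (LINT \<omega>|Q. q (Z \<omega>))"
    by (simp add: tendsto_of_real_iff)
  then have ev_q: "\<forall>\<^sub>F n in sequentially. \<bar>(LINT \<omega>|P. q (Y n \<omega>)) - (LINT \<omega>|Q. q (Z \<omega>))\<bar> < e"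
    using e(1) by (auto dest!: tendstoD[where e = e] simp: dist_real_def)
  have apprZ: "\<bar>(LINT \<omega>|Q. f (Z \<omega>)) - (LINT \<omega>|Q. q (Z \<omega>))\<bar> \<le> e + (2 * B + 1) * (D * e)"
    using L by (intro approx[OF Q Z]) auto
  have "\<forall>\<^sub>F n in sequentially. norm ((LINT \<omega>|P. f (Y n \<omega>)) - (LINT \<omega>|Q. f (Z \<omega>))) < r"
    using ev_tail ev_q
  proof eventually_elim
    case (elim n)
    have "\<bar>(LINT \<omega>|P. f (Y n \<omega>)) - (LINT \<omega>|P. q (Y n \<omega>))\<bar> \<le> e + (2 * B + 1) * (D * e)"
      using elim by (intro approx[OF P Y]) auto
    with apprZ elim(2) have "\<bar>(LINT \<omega>|P. f (Y n \<omega>)) - (LINT \<omega>|Q. f (Z \<omega>))\<bar> < 3 * e + 2 * ((2 * B + 1) * (D * e))"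
      unfolding abs_less_iff abs_le_iff by linarith
    also have "\<dots> = K * e" by (simp add: K_def algebra_simps)
    also have "\<dots> \<le> K * (r / K)" using \<open>K > 0\<close> by (intro mult_left_mono) (auto simp: e_def)
    also have "\<dots> = r" using \<open>K > 0\<close> by simp
    finally show ?case by simp
  qed
  then show "\<exists>no. \<forall>n\<ge>no. norm ((LINT \<omega>|P. f (Y n \<omega>)) - (LINT \<omega>|Q. f (Z \<omega>))) < r"
    by (simp add: eventually_sequentially)
qed

corollary char_tendsto_continuous_image:
  fixes Y :: "nat \<Rightarrow> 'w \<Rightarrow> 'a::euclidean_space" and Z :: "'q \<Rightarrow> 'a" and \<psi> :: "'a \<Rightarrow> real"
  assumes P: "prob_space P" and Q: "prob_space Q"
    and Y [measurable]: "\<And>n. Y n \<in> borel_measurable P" and Z [measurable]: "Z \<in> borel_measurable Q"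
    and char: "\<And>t. (\<lambda>n. CLINT \<omega>|P. iexp (t \<bullet> Y n \<omega>)) \<longlonglongrightarrow> (CLINT \<omega>|Q. iexp (t \<bullet> Z \<omega>))"
    and cont: "continuous_on UNIV \<psi>"
  shows "(\<lambda>n. CLINT \<omega>|P. iexp (\<psi> (Y n \<omega>))) \<longlonglongrightarrow> (CLINT \<omega>|Q. iexp (\<psi> (Z \<omega>)))"
proof -
  have [measurable]: "\<psi> \<in> borel_measurable borel"
    using cont by (rule borel_measurable_continuous_onI)
  have split: "(CLINT \<omega>|M. iexp (\<psi> (V \<omega>)))
      = complex_of_real (LINT \<omega>|M. cos (\<psi> (V \<omega>))) + \<i> * complex_of_real (LINT \<omega>|M. sin (\<psi> (V \<omega>)))"
    if M: "prob_space M" and [measurable]: "V \<in> borel_measurable M" for M :: "'c measure" and V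
  proof -
    interpret prob_space M by fact
    have int: "integrable M (\<lambda>\<omega>. cos (\<psi> (V \<omega>)))" "integrable M (\<lambda>\<omega>. sin (\<psi> (V \<omega>)))"
      by (rule integrable_const_bound[where B = 1]; simp)+
    have "(CLINT \<omega>|M. iexp (\<psi> (V \<omega>)))
        = (CLINT \<omega>|M. complex_of_real (cos (\<psi> (V \<omega>))) + \<i> * complex_of_real (sin (\<psi> (V \<omega>))))"
      by (intro Bochner_Integration.integral_cong refl)
         (simp only: cis_conv_exp[symmetric] cis.code complex_eq_iff, simp)
    then show ?thesis
      by (simp only: Bochner_Integration.integral_add integral_mult_right_zero integral_complex_of_real
          integrable_of_real integrable_mult_right int)
  qed
  have "(\<lambda>n. LINT \<omega>|P. cos (\<psi> (Y n \<omega>))) \<longlonglongrightarrow> (LINT \<omega>|Q. cos (\<psi> (Z \<omega>)))"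
    by (rule expectation_tendsto_of_char_tendsto[OF P Q Y Z char, where B = 1])
       (auto intro: continuous_on_cos cont)
  moreover have "(\<lambda>n. LINT \<omega>|P. sin (\<psi> (Y n \<omega>))) \<longlonglongrightarrow> (LINT \<omega>|Q. sin (\<psi> (Z \<omega>)))"
    by (rule expectation_tendsto_of_char_tendsto[OF P Q Y Z char, where B = 1])
       (auto intro: continuous_on_sin cont)
  ultimately show ?thesis
    unfolding split[OF P Y] split[OF Q Z] by (intro tendsto_intros)
qed

section \<open>Gaussian vectors and the central limit theorem in terms of characteristic functions\<close>

lemma normal_variable_square_integrable:
  assumes "prob_space Q" "normal_variable Q Y"
  shows "integrable Q (\<lambda>\<omega>. (Y \<omega>)\<^sup>2)"
proof -
  interpret prob_space Q by fact
  have [measurable]: "Y \<in> borel_measurable Q"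
    using assms(2) by (simp add: normal_variable_def)
  from assms(2) consider c where "AE \<omega> in Q. Y \<omega> = c"
    | \<mu> \<sigma> where "\<sigma> > 0" "distributed Q lborel Y (normal_density \<mu> \<sigma>)"
    unfolding normal_variable_def by auto
  then show ?thesis
  proof cases
    case (1 c)
    then show ?thesis
      by (intro integrable_cong_AE_imp[OF integrable_const[of "c\<^sup>2"]]) auto
  next
    case (2 \<mu> \<sigma>)
    have "integrable lborel (\<lambda>x. normal_density \<mu> \<sigma> x * (x - \<mu>)^2)"
      by (rule integrable_normal_moment[OF 2(1)])
    moreover have "integrable lborel (\<lambda>x. 2 * \<mu> * (normal_density \<mu> \<sigma> x * x) - \<mu>\<^sup>2 * normal_density \<mu> \<sigma> x)"
      by (intro Bochner_Integration.integrable_diff integrable_mult_right integrable_normal_moment_nz_1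
          integrable_normal_density 2(1))
    ultimately have "integrable lborel (\<lambda>x. normal_density \<mu> \<sigma> x * (x - \<mu>)^2
        + (2 * \<mu> * (normal_density \<mu> \<sigma> x * x) - \<mu>\<^sup>2 * normal_density \<mu> \<sigma> x))"
      by (rule Bochner_Integration.integrable_add)
    then have "integrable lborel (\<lambda>x. normal_density \<mu> \<sigma> x * x\<^sup>2)"
      by (rule back_subst[of "integrable lborel"]) (simp add: fun_eq_iff power2_eq_square algebra_simps)
    then show ?thesis
      using distributed_integrable[OF 2(2), of "\<lambda>x. x\<^sup>2"] by simp
  qed
qed

text \<open>A constant variable with mean zero vanishes almost surely, so the formula also covers variance zero.\<close>

lemma centered_normal_char:
  assumes "prob_space Q" "normal_variable Q Y" and mean: "(\<integral>\<omega>. Y \<omega> \<partial>Q) = 0"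
  shows "(CLINT \<omega>|Q. iexp (Y \<omega>)) = complex_of_real (exp (- (\<integral>\<omega>. (Y \<omega>)\<^sup>2 \<partial>Q) / 2))"
proof -
  interpret prob_space Q by fact
  have Y [measurable]: "Y \<in> borel_measurable Q"
    using assms(2) by (simp add: normal_variable_def)
  from assms(2) consider c where "AE \<omega> in Q. Y \<omega> = c"
    | \<mu> \<sigma> where "\<sigma> > 0" "distributed Q lborel Y (normal_density \<mu> \<sigma>)"
    unfolding normal_variable_def by auto
  then show ?thesis
  proof cases
    case (1 c)
    have "(\<integral>\<omega>. Y \<omega> \<partial>Q) = (\<integral>\<omega>. c \<partial>Q)"
      using 1 by (intro integral_cong_AE) auto
    with mean have "c = 0" by (simp add: prob_space)
    have "(\<integral>\<omega>. (Y \<omega>)\<^sup>2 \<partial>Q) = (\<integral>\<omega>. 0 \<partial>Q)"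
      using 1 \<open>c = 0\<close> by (intro integral_cong_AE) auto
    moreover have "(CLINT \<omega>|Q. iexp (Y \<omega>)) = (CLINT \<omega>|Q. 1)"
      using 1 \<open>c = 0\<close> by (intro integral_cong_AE) auto
    ultimately show ?thesis by (simp add: prob_space)
  next
    case (2 \<mu> \<sigma>)
    have "\<mu> = 0" using normal_distributed_expectation[OF 2] mean by simp
    then have "distributed Q lborel (\<lambda>\<omega>. Y \<omega> / \<sigma>) std_normal_density"
      using 2 normal_standard_normal_convert[OF 2(1), of Y \<mu>] by simp
    then have "distr Q lborel (\<lambda>\<omega>. Y \<omega> / \<sigma>) = std_normal_distribution"
      by (rule distributed_distr_eq_density)
    moreover have "distr Q borel (\<lambda>\<omega>. Y \<omega> / \<sigma>) = distr Q lborel (\<lambda>\<omega>. Y \<omega> / \<sigma>)"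
      by (rule distr_cong) auto
    ultimately have law: "distr Q borel (\<lambda>\<omega>. Y \<omega> / \<sigma>) = std_normal_distribution" by simp
    have "(CLINT \<omega>|Q. iexp (Y \<omega>)) = char (distr Q borel (\<lambda>\<omega>. Y \<omega> / \<sigma>)) \<sigma>"
      using 2(1) by (simp add: char_def integral_distr)
    also have "\<dots> = complex_of_real (exp (- \<sigma>\<^sup>2 / 2))"
      by (simp add: law char_std_normal_distribution)
    also have "\<sigma>\<^sup>2 = (\<integral>\<omega>. (Y \<omega>)\<^sup>2 \<partial>Q)"
      using normal_distributed_variance[OF 2] mean by simp
    finally show ?thesis .
  qed
qed

lemma (in finite_measure) square_integrable_prod:
  fixes u v :: "'a \<Rightarrow> real"
  assumes [measurable]: "u \<in> borel_measurable M" "v \<in> borel_measurable M"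
    and "integrable M (\<lambda>x. (u x)\<^sup>2)" "integrable M (\<lambda>x. (v x)\<^sup>2)"
  shows "integrable M (\<lambda>x. u x * v x)"
proof (rule Bochner_Integration.integrable_bound)
  show "integrable M (\<lambda>x. (u x)\<^sup>2 + (v x)\<^sup>2)"
    using assms by (intro Bochner_Integration.integrable_add)
  have "\<bar>u x * v x\<bar> \<le> (u x)\<^sup>2 + (v x)\<^sup>2" for x
    using sum_squares_bound[of "\<bar>u x\<bar>" "\<bar>v x\<bar>"] by (simp add: abs_mult mult.assoc)
       (smt (verit) mult_nonneg_nonneg abs_ge_zero)
  then show "AE x in M. norm (u x * v x) \<le> norm ((u x)\<^sup>2 + (v x)\<^sup>2)" by simp
qed measurable

text \<open>The law of a Gaussian vector depends on its mean and covariance alone: every linear functional is a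
centred normal variable, whose variance is the quadratic form of \<open>\<Sigma>\<close>.\<close>

lemma gaussian_vector_char:
  fixes Z :: "'q \<Rightarrow> real ^ 'n"
  assumes Q: "prob_space Q" and Z: "gaussian_vector Q Z 0 \<Sigma>"
  shows "(CLINT \<omega>|Q. iexp (t \<bullet> Z \<omega>))
    = complex_of_real (exp (- (\<Sum>i\<in>UNIV. \<Sum>j\<in>UNIV. t $ i * t $ j * \<Sigma> $ i $ j) / 2))"
proof -
  interpret prob_space Q by fact
  have normal: "normal_variable Q (\<lambda>\<omega>. s \<bullet> Z \<omega>)" for s
    using Z by (simp add: gaussian_vector_def)
  have coord: "normal_variable Q (\<lambda>\<omega>. Z \<omega> $ i)" for i
    using normal[of "axis i 1"] by (simp add: inner_axis')
  then have meas: "(\<lambda>\<omega>. Z \<omega> $ i) \<in> borel_measurable Q" for i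
    by (simp add: normal_variable_def)
  have prod_int: "integrable Q (\<lambda>\<omega>. Z \<omega> $ i * Z \<omega> $ j)" for i j
    using meas normal_variable_square_integrable[OF Q coord] by (intro square_integrable_prod)
  have int: "integrable Q (\<lambda>\<omega>. Z \<omega> $ i)" for i
    using square_integrable_imp_integrable[OF meas normal_variable_square_integrable[OF Q coord]] .
  have "(\<integral>\<omega>. t \<bullet> Z \<omega> \<partial>Q) = (\<Sum>i\<in>UNIV. t $ i * (\<integral>\<omega>. Z \<omega> $ i \<partial>Q))"
    by (simp add: inner_vec_def int)
  then have mean: "(\<integral>\<omega>. t \<bullet> Z \<omega> \<partial>Q) = 0"
    using Z by (simp add: gaussian_vector_def)
  have "(\<integral>\<omega>. (t \<bullet> Z \<omega>)\<^sup>2 \<partial>Q) = (\<integral>\<omega>. (\<Sum>i\<in>UNIV. \<Sum>j\<in>UNIV. t $ i * t $ j * (Z \<omega> $ i * Z \<omega> $ j)) \<partial>Q)"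
    by (intro Bochner_Integration.integral_cong refl)
       (simp add: inner_vec_def power2_eq_square sum_product ac_simps)
  also have "\<dots> = (\<Sum>i\<in>UNIV. \<Sum>j\<in>UNIV. t $ i * t $ j * (\<integral>\<omega>. Z \<omega> $ i * Z \<omega> $ j \<partial>Q))"
    by (simp add: prod_int)
  also have "\<dots> = (\<Sum>i\<in>UNIV. \<Sum>j\<in>UNIV. t $ i * t $ j * \<Sigma> $ i $ j)"
    using Z by (simp add: gaussian_vector_def)
  finally show ?thesis
    using centered_normal_char[OF Q normal mean] by simp
qed

lemma (in prob_space) indep_vars_reindex_inj:
  assumes ind: "indep_vars (\<lambda>_. N) V UNIV" and inj: "inj_on f J"
  shows "indep_vars (\<lambda>_. N) (\<lambda>j. V (f j)) J"
proof -
  have "indep_vars (\<lambda>j. PiM {f j} (\<lambda>_. N)) (\<lambda>j \<omega>. restrict (\<lambda>i. V i \<omega>) {f j}) J"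
    using inj by (intro indep_vars_restrict[OF ind]) (auto simp: disjoint_family_on_def inj_on_def)
  then have "indep_vars (\<lambda>_. N) (\<lambda>j \<omega>. (restrict (\<lambda>i. V i \<omega>) {f j}) (f j)) J"
    by (rule indep_vars_compose2) auto
  then show ?thesis by simp
qed

text \<open>The central limit theorem without the restriction to positive variance; when the variance is zero all
summands vanish almost surely.\<close>

lemma (in prob_space) iid_sum_char_tendsto:
  fixes V :: "nat \<Rightarrow> 'a \<Rightarrow> real"
  assumes ind: "indep_vars (\<lambda>_. borel) V UNIV"
    and mean: "\<And>i. expectation (V i) = 0"
    and sq: "\<And>i. integrable M (\<lambda>\<omega>. (V i \<omega>)\<^sup>2)"
    and law: "\<And>i. distr M borel (V i) = \<mu>"
  shows "(\<lambda>n. CLINT \<omega>|M. iexp ((\<Sum>i=1..n. V i \<omega>) / sqrt (real n)))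
    \<longlonglongrightarrow> complex_of_real (exp (- expectation (\<lambda>\<omega>. (V 0 \<omega>)\<^sup>2) / 2))"
proof -
  have V [measurable]: "V i \<in> borel_measurable M" for i
    using ind unfolding indep_vars_def by auto
  define v where "v = expectation (\<lambda>\<omega>. (V 0 \<omega>)\<^sup>2)"
  have var: "expectation (\<lambda>\<omega>. (V i \<omega>)\<^sup>2) = v" for i
  proof -
    have "expectation (\<lambda>\<omega>. (V k \<omega>)\<^sup>2) = (\<integral>x. x\<^sup>2 \<partial>\<mu>)" for k
      unfolding law[of k, symmetric] by (subst integral_distr) auto
    then show ?thesis by (simp add: v_def)
  qed
  have "v \<ge> 0" by (simp add: v_def)
  then consider "v = 0" | "v > 0" by linarith
  then show ?thesis
  proof cases
    case 1
    have "AE \<omega> in M. (V i \<omega>)\<^sup>2 = 0" for i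
      using integral_nonneg_eq_0_iff_AE[OF sq[of i]] var[of i] 1 by simp
    then have "AE \<omega> in M. \<forall>i\<in>{1..n}. V i \<omega> = 0" for n
      by (intro AE_finite_allI) auto
    moreover have "iexp ((\<Sum>i=1..n. V i \<omega>) / sqrt (real n)) = 1" if "\<forall>i\<in>{1..n}. V i \<omega> = 0" for n \<omega>
      by (subst sum.neutral[OF that]) simp
    ultimately have "AE \<omega> in M. iexp ((\<Sum>i=1..n. V i \<omega>) / sqrt (real n)) = 1" for n
      by (rule eventually_mono)
    then have "(CLINT \<omega>|M. iexp ((\<Sum>i=1..n. V i \<omega>) / sqrt (real n))) = (CLINT \<omega>|M. 1)" for n
      by (intro integral_cong_AE) auto
    with 1 show ?thesis by (simp add: v_def[symmetric] prob_space)
  next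
    case 2
    define \<sigma> where "\<sigma> = sqrt v"
    have \<sigma>: "\<sigma> > 0" "\<sigma>\<^sup>2 = v" using 2 by (auto simp: \<sigma>_def)
    let ?W = "\<lambda>i. V (Suc i)"
    have indW: "indep_vars (\<lambda>_. borel) ?W UNIV"
      by (rule indep_vars_reindex_inj[OF ind]) simp
    have "weak_conv_m (\<lambda>n. distr M borel (\<lambda>\<omega>. (\<Sum>i<n. ?W i \<omega>) / sqrt (real n * \<sigma>\<^sup>2))) std_normal_distribution"
      by (rule central_limit_theorem_zero_mean[OF indW mean \<sigma>(1) sq _ law]) (simp add: mean var \<sigma>)
    then have "(\<lambda>n. char (distr M borel (\<lambda>\<omega>. (\<Sum>i<n. ?W i \<omega>) / sqrt (real n * \<sigma>\<^sup>2))) \<sigma>)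
        \<longlonglongrightarrow> char std_normal_distribution \<sigma>"
      by (intro levy_continuity1 real_dist_normal_dist real_distribution_distr) auto
    moreover have "char (distr M borel (\<lambda>\<omega>. (\<Sum>i<n. ?W i \<omega>) / sqrt (real n * \<sigma>\<^sup>2))) \<sigma>
        = (CLINT \<omega>|M. iexp ((\<Sum>i=1..n. V i \<omega>) / sqrt (real n)))" for n
    proof -
      have "(\<Sum>i<n. ?W i \<omega>) = (\<Sum>i=1..n. V i \<omega>)" for \<omega>
        by (rule sum.reindex_bij_witness[of _ "\<lambda>i. i - 1" Suc]) auto
      then have eq: "\<sigma> * ((\<Sum>i<n. ?W i \<omega>) / sqrt (real n * \<sigma>\<^sup>2)) = (\<Sum>i=1..n. V i \<omega>) / sqrt (real n)" for \<omega>
        using \<sigma>(1) by (simp add: real_sqrt_mult)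
      have "char (distr M borel (\<lambda>\<omega>. (\<Sum>i<n. ?W i \<omega>) / sqrt (real n * \<sigma>\<^sup>2))) \<sigma>
          = (CLINT \<omega>|M. iexp (\<sigma> * ((\<Sum>i<n. ?W i \<omega>) / sqrt (real n * \<sigma>\<^sup>2))))"
        unfolding char_def by (rule integral_distr) auto
      then show ?thesis by (simp only: eq)
    qed
    ultimately show ?thesis
      by (simp add: char_std_normal_distribution \<sigma> v_def[symmetric])
  qed
qed

section \<open>Sums of the smallest values\<close>

definition smallest_sum :: "('i \<Rightarrow> real) \<Rightarrow> 'i set \<Rightarrow> nat \<Rightarrow> real" where
  "smallest_sum Y I k = sum_list (take k (sorted_list_of_multiset (image_mset Y (mset_set I))))"

text \<open>The concave function of \<open>c\<close> whose maximum is the sum of the \<open>k\<close> smallest values.\<close>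

definition hinge_bound :: "('i \<Rightarrow> real) \<Rightarrow> 'i set \<Rightarrow> nat \<Rightarrow> real \<Rightarrow> real" where
  "hinge_bound Y I k c = real k * c - (\<Sum>i\<in>I. max 0 (c - Y i))"

lemma sum_list_map_sorted_list_of_values:
  "finite I \<Longrightarrow> (\<Sum>y\<leftarrow>sorted_list_of_multiset (image_mset Y (mset_set I)). f y) = (\<Sum>i\<in>I. f (Y i))"
  by (simp add: sum_mset_sum_list[symmetric] sum_unfold_sum_mset image_mset.compositionality comp_def)

lemma length_sorted_list_of_values:
  "length (sorted_list_of_multiset (image_mset Y (mset_set I))) = card I"
  by (metis mset_sorted_list_of_multiset size_image_mset size_mset size_mset_set)

text \<open>Any \<open>k\<close> entries \<open>y\<close> satisfy \<open>\<Sum> (c - y) \<le> \<Sum> max 0 (c - y)\<close>, and the right-hand side only grows when it is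
extended to all entries.\<close>

lemma sum_list_take_ge:
  fixes ys :: "real list"
  assumes "k \<le> length ys"
  shows "real k * c - (\<Sum>y\<leftarrow>ys. max 0 (c - y)) \<le> sum_list (take k ys)"
proof -
  have "real k * c - sum_list (take k ys) = (\<Sum>y\<leftarrow>take k ys. c - y)"
    using assms by (simp add: sum_list_subtractf sum_list_triv)
  also have "\<dots> \<le> (\<Sum>y\<leftarrow>take k ys. max 0 (c - y))"
    by (intro sum_list_mono) auto
  also have "\<dots> \<le> (\<Sum>y\<leftarrow>take k ys. max 0 (c - y)) + (\<Sum>y\<leftarrow>drop k ys. max 0 (c - y))"
    by (simp, rule sum_list_nonneg) auto
  also have "\<dots> = (\<Sum>y\<leftarrow>ys. max 0 (c - y))"
    by (metis append_take_drop_id map_append sum_list_append)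
  finally show ?thesis by simp
qed

text \<open>At \<open>c\<close> equal to the \<open>k\<close>-th smallest entry the first \<open>k\<close> entries are at most \<open>c\<close> and the others at least \<open>c\<close>, so
nothing is lost in the preceding inequality.\<close>

lemma sum_list_take_sorted_attained:
  fixes ys :: "real list"
  assumes "sorted ys" "1 \<le> k" "k \<le> length ys"
  defines "c \<equiv> ys ! (k - 1)"
  shows "sum_list (take k ys) = real k * c - (\<Sum>y\<leftarrow>ys. max 0 (c - y))"
proof -
  have lo: "y \<le> c" if "y \<in> set (take k ys)" for y
    using that assms by (auto simp: in_set_conv_nth c_def intro!: sorted_nth_mono)
  have hi: "c \<le> y" if "y \<in> set (drop k ys)" for y
    using that assms by (auto simp: in_set_conv_nth c_def intro!: sorted_nth_mono)
  have "(\<Sum>y\<leftarrow>ys. max 0 (c - y)) = (\<Sum>y\<leftarrow>take k ys. max 0 (c - y)) + (\<Sum>y\<leftarrow>drop k ys. max 0 (c - y))"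
    by (metis append_take_drop_id map_append sum_list_append)
  also have "map (\<lambda>y. max 0 (c - y)) (take k ys) = map (\<lambda>y. c - y) (take k ys)"
    using lo by (intro map_cong) auto
  also have "map (\<lambda>y. max 0 (c - y)) (drop k ys) = map (\<lambda>y. 0) (drop k ys)"
    using hi by (intro map_cong) auto
  finally show ?thesis
    using assms(3) by (simp add: sum_list_subtractf sum_list_triv)
qed

lemma hinge_bound_le_smallest_sum:
  assumes "finite I" "k \<le> card I"
  shows "hinge_bound Y I k c \<le> smallest_sum Y I k"
  using sum_list_take_ge[of k "sorted_list_of_multiset (image_mset Y (mset_set I))" c] assms
  by (simp add: hinge_bound_def smallest_sum_def length_sorted_list_of_values
      sum_list_map_sorted_list_of_values)

lemma smallest_sum_attained:
  assumes "finite I" "1 \<le> k" "k \<le> card I"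
  obtains j where "j \<in> I" "smallest_sum Y I k = hinge_bound Y I k (Y j)"
proof -
  let ?ys = "sorted_list_of_multiset (image_mset Y (mset_set I))"
  have "?ys ! (k - 1) \<in> set ?ys"
    using assms by (intro nth_mem) (simp add: length_sorted_list_of_values)
  then obtain j where "j \<in> I" "?ys ! (k - 1) = Y j"
    using assms(1) by auto
  with sum_list_take_sorted_attained[of ?ys k] assms show ?thesis
    by (intro that[of j]) (simp_all add: hinge_bound_def smallest_sum_def length_sorted_list_of_values
      sum_list_map_sorted_list_of_values)
qed

text \<open>A finite maximum of explicit functions of the values: this makes the trimmed sum measurable.\<close>

lemma smallest_sum_eq_Max:
  assumes "finite I" "1 \<le> k" "k \<le> card I"
  shows "smallest_sum Y I k = Max ((\<lambda>j. hinge_bound Y I k (Y j)) ` I)"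
proof -
  from smallest_sum_attained[OF assms] obtain j
    where "j \<in> I" "smallest_sum Y I k = hinge_bound Y I k (Y j)" .
  moreover have "hinge_bound Y I k (Y i) \<le> smallest_sum Y I k" for i
    using assms by (intro hinge_bound_le_smallest_sum)
  ultimately show ?thesis
    using assms by (intro Max_eqI[symmetric]) auto
qed

lemma smallest_sum_0 [simp]: "smallest_sum Y I 0 = 0"
  by (simp add: smallest_sum_def)

lemma measurable_smallest_sum:
  assumes "finite I" "k \<le> card I" and [measurable]: "\<And>i. i \<in> I \<Longrightarrow> (\<lambda>\<omega>. Y \<omega> i) \<in> borel_measurable M"
  shows "(\<lambda>\<omega>. smallest_sum (Y \<omega>) I k) \<in> borel_measurable M"
proof (cases "k = 0")
  case False
  have "(\<lambda>\<omega>. Max ((\<lambda>j. hinge_bound (Y \<omega>) I k (Y \<omega> j)) ` I)) \<in> borel_measurable M"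
    unfolding hinge_bound_def by (intro borel_measurable_Max assms(1)) measurable
  with False assms show ?thesis
    by (simp add: smallest_sum_eq_Max)
qed simp

lemma sum_ordered_values_eq_smallest_sum:
  assumes "a \<le> b" "b \<le> card I"
  shows "(\<Sum>i = a + 1..b. sorted_list_of_multiset (image_mset Y (mset_set I)) ! (i - 1))
    = smallest_sum Y I b - smallest_sum Y I a"
proof -
  let ?ys = "sorted_list_of_multiset (image_mset Y (mset_set I))"
  have take: "smallest_sum Y I k = (\<Sum>i<k. ?ys ! i)" if "k \<le> card I" for k
    using that unfolding smallest_sum_def
    by (simp add: sum_list_sum_nth length_sorted_list_of_values lessThan_atLeast0)
  have "(\<Sum>i = a + 1..b. ?ys ! (i - 1)) = (\<Sum>i\<in>{a..<b}. ?ys ! i)"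
    by (rule sum.reindex_bij_witness[of _ Suc "\<lambda>i. i - 1"]) auto
  also have "\<dots> = (\<Sum>i<b. ?ys ! i) - (\<Sum>i<a. ?ys ! i)"
    using assms(1) by (simp add: lessThan_atLeast0 sum_diff_nat_ivl)
  finally show ?thesis using assms by (simp add: take)
qed

lemma hinge_difference_bounds:
  fixes c c' y :: real
  assumes "c \<le> c'"
  shows "(c' - c) * of_bool (y \<le> c) \<le> max 0 (c' - y) - max 0 (c - y)"
    and "max 0 (c' - y) - max 0 (c - y) \<le> (c' - c) * of_bool (y < c')"
  using assms by (auto simp: max_def)

text \<open>Difference quotients of a concave function lie between its one-sided slopes, which are \<open>p\<close> minus the empirical
distribution function at the left end point and \<open>p\<close> minus its left limit at the right end point.\<close>

lemma hinge_bound_slope: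
  assumes "finite I" "I \<noteq> {}" "c \<le> c'"
  shows "hinge_bound Y I k c' / card I - hinge_bound Y I k c / card I
      \<le> (c' - c) * (real k / card I - (\<Sum>i\<in>I. of_bool (Y i \<le> c)) / card I)"
    and "(c' - c) * (real k / card I - (\<Sum>i\<in>I. of_bool (Y i < c')) / card I)
      \<le> hinge_bound Y I k c' / card I - hinge_bound Y I k c / card I"
proof -
  have N: "real (card I) > 0" using assms by (simp add: card_gt_0_iff)
  have eq: "hinge_bound Y I k c' - hinge_bound Y I k c
      = (c' - c) * real k - (\<Sum>i\<in>I. max 0 (c' - Y i) - max 0 (c - Y i))"
    by (simp add: hinge_bound_def algebra_simps sum_subtractf)
  have "(\<Sum>i\<in>I. (c' - c) * of_bool (Y i \<le> c)) \<le> (\<Sum>i\<in>I. max 0 (c' - Y i) - max 0 (c - Y i))"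
    by (intro sum_mono hinge_difference_bounds assms)
  with eq have "hinge_bound Y I k c' - hinge_bound Y I k c
      \<le> (c' - c) * (real k - (\<Sum>i\<in>I. of_bool (Y i \<le> c)))"
    unfolding right_diff_distrib sum_distrib_left[symmetric] by linarith
  from divide_right_mono[OF this, of "real (card I)"] N
  show "hinge_bound Y I k c' / card I - hinge_bound Y I k c / card I
      \<le> (c' - c) * (real k / card I - (\<Sum>i\<in>I. of_bool (Y i \<le> c)) / card I)"
    by (simp add: diff_divide_distrib[symmetric])
  have "(\<Sum>i\<in>I. max 0 (c' - Y i) - max 0 (c - Y i)) \<le> (\<Sum>i\<in>I. (c' - c) * of_bool (Y i < c'))"
    by (intro sum_mono hinge_difference_bounds assms)
  with eq have "(c' - c) * (real k - (\<Sum>i\<in>I. of_bool (Y i < c'))) \<le> hinge_bound Y I k c' - hinge_bound Y I k c"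
    unfolding right_diff_distrib sum_distrib_left[symmetric] by linarith
  from divide_right_mono[OF this, of "real (card I)"] N
  show "(c' - c) * (real k / card I - (\<Sum>i\<in>I. of_bool (Y i < c')) / card I)
      \<le> hinge_bound Y I k c' / card I - hinge_bound Y I k c / card I"
    by (simp add: diff_divide_distrib[symmetric])
qed

text \<open>The hypotheses \<open>left\<close> and \<open>right\<close> say that the concave function increases up to \<open>l - d\<close> and decreases from
\<open>u + d\<close> on, so its maximum is attained in \<open>[l - d, u + d]\<close>. The three terms bound its
increase along \<open>[l, u]\<close>, along \<open>[u, u + d]\<close>, and backwards along \<open>[l - d, l]\<close>.\<close>

lemma smallest_sum_upper_bound:
  fixes Y :: "'i \<Rightarrow> real" and l u d :: real
  assumes I: "finite I" "I \<noteq> {}" and k: "1 \<le> k" "k \<le> card I" and "l \<le> u" "d \<ge> 0"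
  defines "F \<equiv> \<lambda>c. (\<Sum>i\<in>I. of_bool (Y i \<le> c)) / real (card I)"
    and "p \<equiv> real k / real (card I)"
  assumes left: "F (l - d) \<le> p" and right: "p \<le> F (u + d)"
  shows "smallest_sum Y I k / card I - hinge_bound Y I k l / card I
    \<le> (u - l) * max 0 (p - F l)
      + d * (max 0 (p - F u) + max 0 ((\<Sum>i\<in>I. of_bool (Y i < l)) / card I - p))"
    (is "_ \<le> ?R")
proof -
  define \<phi> where "\<phi> c = hinge_bound Y I k c / card I" for c
  define E where "E = (\<Sum>i\<in>I. of_bool (Y i < l)) / real (card I)"
  define F' where "F' c = (\<Sum>i\<in>I. of_bool (Y i < c)) / real (card I)" for c
  have up: "\<phi> c' - \<phi> c \<le> (c' - c) * (p - F c)" and low: "(c' - c) * (p - F' c') \<le> \<phi> c' - \<phi> c"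
    if "c \<le> c'" for c c'
    using hinge_bound_slope[OF I that, where Y = Y and k = k] unfolding \<phi>_def p_def F_def F'_def by blast+
  have F'_le: "F' c \<le> F c" for c
    unfolding F_def F'_def by (intro divide_right_mono sum_mono) auto
  have 1: "\<phi> c - \<phi> u \<le> d * max 0 (p - F u)" if "u \<le> c" "c \<le> u + d" for c
  proof -
    have "\<phi> c - \<phi> u \<le> (c - u) * (p - F u)" using up that by simp
    also have "\<dots> \<le> (c - u) * max 0 (p - F u)" using that by (intro mult_left_mono) auto
    also have "\<dots> \<le> d * max 0 (p - F u)" using that by (intro mult_right_mono) auto
    finally show ?thesis .
  qed
  have 2: "\<phi> c - \<phi> l \<le> (u - l) * max 0 (p - F l)" if "l \<le> c" "c \<le> u" for c
  proof -
    have "\<phi> c - \<phi> l \<le> (c - l) * (p - F l)" using up that by simp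
    also have "\<dots> \<le> (c - l) * max 0 (p - F l)" using that by (intro mult_left_mono) auto
    also have "\<dots> \<le> (u - l) * max 0 (p - F l)" using that by (intro mult_right_mono) auto
    finally show ?thesis .
  qed
  have 3: "\<phi> c - \<phi> l \<le> d * max 0 (E - p)" if "l - d \<le> c" "c \<le> l" for c
  proof -
    have "\<phi> c - \<phi> l \<le> (l - c) * (E - p)" using low[OF that(2)] by (simp add: E_def F'_def algebra_simps)
    also have "\<dots> \<le> (l - c) * max 0 (E - p)" using that by (intro mult_left_mono) auto
    also have "\<dots> \<le> d * max 0 (E - p)" using that by (intro mult_right_mono) auto
    finally show ?thesis .
  qed
  have 4: "\<phi> c \<le> \<phi> (u + d)" if "u + d \<le> c" for c
    using up[OF that] right that by (smt (verit) mult_nonneg_nonpos)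
  have 5: "\<phi> c \<le> \<phi> (l - d)" if "c \<le> l - d" for c
  proof -
    have "0 \<le> (l - d - c) * (p - F' (l - d))"
      using left F'_le[of "l - d"] that by (intro mult_nonneg_nonneg) auto
    with low[OF that] show ?thesis by simp
  qed
  have nn: "0 \<le> (u - l) * max 0 (p - F l)" "0 \<le> d * max 0 (p - F u)" "0 \<le> d * max 0 (E - p)"
    using assms by auto
  have R: "?R = (u - l) * max 0 (p - F l) + d * max 0 (p - F u) + d * max 0 (E - p)"
    by (simp add: E_def algebra_simps)
  have all: "\<phi> c - \<phi> l \<le> ?R" for c
  proof -
    consider "c \<le> l - d" | "l - d \<le> c" "c \<le> l" | "l \<le> c" "c \<le> u" | "u \<le> c" "c \<le> u + d" | "u + d \<le> c"
      by linarith
    then show ?thesis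
    proof cases
      case 1
      have "\<phi> (l - d) - \<phi> l \<le> d * max 0 (E - p)" using \<open>d \<ge> 0\<close> by (intro 3) auto
      with 5[OF 1] nn show ?thesis unfolding R by linarith
    next
      case 2
      then show ?thesis using 3[of c] nn unfolding R by linarith
    next
      case 3
      then show ?thesis using 2[of c] nn unfolding R by linarith
    next
      case 4
      then show ?thesis using 1[of c] 2[of u] nn \<open>l \<le> u\<close> unfolding R by linarith
    next
      case 5
      then show ?thesis using 4[of c] 1[of "u + d"] 2[of u] nn \<open>l \<le> u\<close> \<open>d \<ge> 0\<close> unfolding R by linarith
    qed
  qed
  from smallest_sum_attained[OF I(1) k] obtain j where "smallest_sum Y I k = hinge_bound Y I k (Y j)" .
  with all[of "Y j"] show ?thesis by (simp add: \<phi>_def)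
qed

section \<open>Counting overlapping index tuples\<close>

lemma finite_index_tuples [simp]: "finite (index_tuples m n)"
  unfolding index_tuples_def by (rule finite_subset[of _ "{1..m} \<rightarrow>\<^sub>E {1..n}"]) (auto intro: finite_PiE)

lemma index_tuplesD:
  assumes "\<iota> \<in> index_tuples m n"
  shows "inj_on \<iota> {1..m}" "\<iota> ` {1..m} \<subseteq> {1..n}" "card (\<iota> ` {1..m}) = m"
proof -
  show inj: "inj_on \<iota> {1..m}"
    using assms by (auto simp: index_tuples_def intro: strict_mono_on_imp_inj_on)
  show "\<iota> ` {1..m} \<subseteq> {1..n}"
    using assms by (auto simp: index_tuples_def PiE_iff)
  show "card (\<iota> ` {1..m}) = m"
    using card_image[OF inj] by simp
qed

lemma index_tuple_list:
  assumes "\<iota> \<in> index_tuples m n"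
  shows "map \<iota> [1..<Suc m] = sorted_list_of_set (\<iota> ` {1..m})"
proof (rule sorted_distinct_set_unique)
  have "strict_mono_on {1..m} \<iota>" using assms by (simp add: index_tuples_def)
  then show "sorted (map \<iota> [1..<Suc m])"
    by (auto simp: sorted_iff_nth_mono_less simp del: upt_Suc
        intro!: less_imp_le elim!: strict_mono_onD)
  show "distinct (map \<iota> [1..<Suc m])"
    using index_tuplesD(1)[OF assms] by (simp add: distinct_map atLeastLessThanSuc_atLeastAtMost del: upt_Suc)
  show "set (map \<iota> [1..<Suc m]) = set (sorted_list_of_set (\<iota> ` {1..m}))"
    by (simp add: atLeastLessThanSuc_atLeastAtMost del: upt_Suc)
qed simp_all

text \<open>Increasing index tuples are enumerations of \<open>m\<close>-element sets, so that they can be counted as sets.\<close>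

lemma bij_betw_index_tuples:
  "bij_betw (\<lambda>\<iota>. \<iota> ` {1..m}) (index_tuples m n) {A. A \<subseteq> {1..n} \<and> card A = m}"
  unfolding bij_betw_def
proof
  show "inj_on (\<lambda>\<iota>. \<iota> ` {1..m}) (index_tuples m n)"
  proof (rule inj_onI)
    fix \<iota> \<kappa> assume *: "\<iota> \<in> index_tuples m n" "\<kappa> \<in> index_tuples m n" "\<iota> ` {1..m} = \<kappa> ` {1..m}"
    then have "map \<iota> [1..<Suc m] = map \<kappa> [1..<Suc m]"
      by (simp only: index_tuple_list)
    then have "\<iota> j = \<kappa> j" if "j \<in> {1..m}" for j
      using that by (auto simp del: upt_Suc)
    with * show "\<iota> = \<kappa>"
      by (intro PiE_ext[of _ "{1..m}" "\<lambda>_. {1..n}"]) (auto simp: index_tuples_def)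
  qed
  show "(\<lambda>\<iota>. \<iota> ` {1..m}) ` index_tuples m n = {A. A \<subseteq> {1..n} \<and> card A = m}"
  proof (intro equalityI subsetI)
    fix A assume "A \<in> {A. A \<subseteq> {1..n} \<and> card A = m}"
    then have A: "A \<subseteq> {1..n}" "card A = m" "finite A" by (auto intro: finite_subset)
    let ?xs = "sorted_list_of_set A"
    let ?\<iota> = "\<lambda>j\<in>{1..m}. ?xs ! (j - 1)"
    have len: "length ?xs = m" using A by simp
    have img: "?\<iota> ` {1..m} = A"
    proof -
      have "?\<iota> ` {1..m} = (\<lambda>i. ?xs ! i) ` {..<m}"
        by (force simp: image_iff intro: bexI[of _ "Suc _"])
      also have "\<dots> = set ?xs" using len by (auto simp: set_conv_nth)
      finally show ?thesis using A by simp
    qed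
    have "strict_mono_on {1..m} ?\<iota>"
    proof (rule strict_mono_onI)
      fix r s assume "r \<in> {1..m}" "s \<in> {1..m}" "r < s"
      then show "?\<iota> r < ?\<iota> s"
        using sorted_wrt_nth_less[OF strict_sorted_list_of_set[of A], of "r - 1" "s - 1"] len by auto
    qed
    with img A(1) have "?\<iota> \<in> index_tuples m n"
      by (auto simp: index_tuples_def)
    with img show "A \<in> (\<lambda>\<iota>. \<iota> ` {1..m}) ` index_tuples m n" by (metis image_eqI)
  next
    fix A assume "A \<in> (\<lambda>\<iota>. \<iota> ` {1..m}) ` index_tuples m n"
    then show "A \<in> {A. A \<subseteq> {1..n} \<and> card A = m}"
      using index_tuplesD(2,3) by blast
  qed
qed

lemma card_index_tuples_superset:
  assumes "D \<subseteq> {1..n}" "card D \<le> m"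
  shows "card {\<iota> \<in> index_tuples m n. D \<subseteq> \<iota> ` {1..m}} = (n - card D) choose (m - card D)"
proof -
  have fin: "finite D" using assms by (auto intro: finite_subset)
  have "bij_betw (\<lambda>\<iota>. \<iota> ` {1..m}) {\<iota> \<in> index_tuples m n. D \<subseteq> \<iota> ` {1..m}}
      {A. A \<subseteq> {1..n} \<and> card A = m \<and> D \<subseteq> A}"
  proof (rule bij_betw_subset[OF bij_betw_index_tuples])
    have "(\<lambda>\<iota>. \<iota> ` {1..m}) ` {\<iota> \<in> index_tuples m n. D \<subseteq> \<iota> ` {1..m}}
        = {A \<in> (\<lambda>\<iota>. \<iota> ` {1..m}) ` index_tuples m n. D \<subseteq> A}"
      by blast
    also have "\<dots> = {A. A \<subseteq> {1..n} \<and> card A = m \<and> D \<subseteq> A}"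
      unfolding bij_betw_imp_surj_on[OF bij_betw_index_tuples] by blast
    finally show "(\<lambda>\<iota>. \<iota> ` {1..m}) ` {\<iota> \<in> index_tuples m n. D \<subseteq> \<iota> ` {1..m}}
        = {A. A \<subseteq> {1..n} \<and> card A = m \<and> D \<subseteq> A}" .
  qed blast
  then have "card {\<iota> \<in> index_tuples m n. D \<subseteq> \<iota> ` {1..m}} = card {A. A \<subseteq> {1..n} \<and> card A = m \<and> D \<subseteq> A}"
    by (rule bij_betw_same_card)
  also have "card {A. A \<subseteq> {1..n} \<and> card A = m \<and> D \<subseteq> A} = card {B. B \<subseteq> {1..n} - D \<and> card B = m - card D}"
  proof (rule bij_betw_same_card)
    show "bij_betw (\<lambda>A. A - D) {A. A \<subseteq> {1..n} \<and> card A = m \<and> D \<subseteq> A}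
      {B. B \<subseteq> {1..n} - D \<and> card B = m - card D}"
    proof (rule bij_betw_byWitness[where f' = "\<lambda>B. B \<union> D"])
    show "(\<lambda>A. A - D) ` {A. A \<subseteq> {1..n} \<and> card A = m \<and> D \<subseteq> A} \<subseteq> {B. B \<subseteq> {1..n} - D \<and> card B = m - card D}"
      using fin by (auto simp: card_Diff_subset)
    show "(\<lambda>B. B \<union> D) ` {B. B \<subseteq> {1..n} - D \<and> card B = m - card D} \<subseteq> {A. A \<subseteq> {1..n} \<and> card A = m \<and> D \<subseteq> A}"
    proof safe
      fix B assume B: "B \<subseteq> {1..n} - D" "card B = m - card D"
      then have "finite B" "B \<inter> D = {}" by (auto intro: finite_subset)
      with B fin assms(2) show "card (B \<union> D) = m" by (simp add: card_Un_disjoint)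
    qed (use assms in auto)
    qed auto
  qed
  also have "\<dots> = (n - card D) choose (m - card D)"
    using assms fin by (simp add: n_subsets card_Diff_subset)
  finally show ?thesis .
qed

lemma card_index_tuples: "card (index_tuples m n) = n choose m"
  using card_index_tuples_superset[of "{}" n m] by simp

text \<open>An index set meeting \<open>B\<close> in at least \<open>r\<close> points contains one of the \<open>r\<close>-element subsets of \<open>B\<close>. As a
fraction of all \<open>m\<close>-element sets this is of order \<open>n ^ - r\<close>.\<close>

lemma card_index_tuples_overlap:
  assumes "r \<le> n" and B: "B \<subseteq> {1..n}" "card B = m"
  shows "real (card {\<iota> \<in> index_tuples m n. r \<le> card (\<iota> ` {1..m} \<inter> B)})
    \<le> (real (m choose r))\<^sup>2 / real (n choose r) * real (n choose m)"
proof (cases "r \<le> m")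
  case False
  have "finite B" using B by (auto intro: finite_subset)
  then have "card (\<iota> ` {1..m} \<inter> B) \<le> m" for \<iota> :: "nat \<Rightarrow> nat"
    using B card_mono[of B "\<iota> ` {1..m} \<inter> B"] by simp
  with False have "{\<iota> \<in> index_tuples m n. r \<le> card (\<iota> ` {1..m} \<inter> B)} = {}"
    by (auto dest: order_trans)
  then show ?thesis by (simp only: card.empty) simp
next
  case True
  have fin: "finite B" using B by (auto intro: finite_subset)
  have mn: "m \<le> n" using B card_mono[of "{1..n}" B] by simp
  let ?\<D> = "{D. D \<subseteq> B \<and> card D = r}"
  have "{\<iota> \<in> index_tuples m n. r \<le> card (\<iota> ` {1..m} \<inter> B)}
      \<subseteq> (\<Union>D\<in>?\<D>. {\<iota> \<in> index_tuples m n. D \<subseteq> \<iota> ` {1..m}})"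
  proof
    fix \<iota> assume *: "\<iota> \<in> {\<iota> \<in> index_tuples m n. r \<le> card (\<iota> ` {1..m} \<inter> B)}"
    then obtain D where "D \<subseteq> \<iota> ` {1..m} \<inter> B" "card D = r"
      using obtain_subset_with_card_n[of r "\<iota> ` {1..m} \<inter> B"] by blast
    with * show "\<iota> \<in> (\<Union>D\<in>?\<D>. {\<iota> \<in> index_tuples m n. D \<subseteq> \<iota> ` {1..m}})" by blast
  qed
  then have "card {\<iota> \<in> index_tuples m n. r \<le> card (\<iota> ` {1..m} \<inter> B)}
      \<le> card (\<Union>D\<in>?\<D>. {\<iota> \<in> index_tuples m n. D \<subseteq> \<iota> ` {1..m}})"
    using fin by (intro card_mono) auto
  also have "\<dots> \<le> (\<Sum>D\<in>?\<D>. card {\<iota> \<in> index_tuples m n. D \<subseteq> \<iota> ` {1..m}})"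
    using fin by (intro card_UN_le) auto
  also have "\<dots> = (\<Sum>D\<in>?\<D>. (n - r) choose (m - r))"
  proof (intro sum.cong refl)
    fix D assume "D \<in> ?\<D>"
    then have "D \<subseteq> {1..n}" "card D = r" using B by auto
    then show "card {\<iota> \<in> index_tuples m n. D \<subseteq> \<iota> ` {1..m}} = (n - r) choose (m - r)"
      using card_index_tuples_superset[of D n m] True by simp
  qed
  also have "\<dots> = (m choose r) * ((n - r) choose (m - r))"
    using fin B by (simp add: n_subsets)
  finally have "real (card {\<iota> \<in> index_tuples m n. r \<le> card (\<iota> ` {1..m} \<inter> B)})
      \<le> real (m choose r) * real ((n - r) choose (m - r))"
    by (subst of_nat_mult[symmetric], subst of_nat_le_iff)
  also have "real ((n - r) choose (m - r)) = real (m choose r) * real (n choose m) / real (n choose r)"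
    using arg_cong[OF choose_mult[OF True mn], of real] assms(1) by (simp add: field_simps)
  finally show ?thesis by (simp add: power2_eq_square ac_simps)
qed

text \<open>Every \<open>i\<close> belongs to \<open>(n - 1) choose (m - 1) = (n choose m) * m / n\<close> of the index sets.\<close>

lemma sum_index_tuples_entries:
  fixes f :: "nat \<Rightarrow> real"
  assumes "1 \<le> m" "m \<le> n"
  shows "(\<Sum>\<iota>\<in>index_tuples m n. \<Sum>j\<in>{1..m}. f (\<iota> j)) = real (n choose m) * real m / real n * (\<Sum>i\<in>{1..n}. f i)"
proof -
  have "(\<Sum>\<iota>\<in>index_tuples m n. \<Sum>j\<in>{1..m}. f (\<iota> j)) = (\<Sum>\<iota>\<in>index_tuples m n. \<Sum>i\<in>\<iota> ` {1..m}. f i)"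
    by (rule sum.cong[OF refl], subst sum.reindex) (auto dest: index_tuplesD(1) simp del: One_nat_def)
  also have "\<dots> = (\<Sum>\<iota>\<in>index_tuples m n. \<Sum>i\<in>{1..n}. f i * of_bool (i \<in> \<iota> ` {1..m}))"
  proof (rule sum.cong[OF refl])
    fix \<iota> assume "\<iota> \<in> index_tuples m n"
    then have "\<iota> ` {1..m} \<subseteq> {1..n}" by (rule index_tuplesD)
    then show "(\<Sum>i\<in>\<iota> ` {1..m}. f i) = (\<Sum>i\<in>{1..n}. f i * of_bool (i \<in> \<iota> ` {1..m}))"
      by (intro sum.mono_neutral_cong_left) auto
  qed
  also have "\<dots> = (\<Sum>i\<in>{1..n}. f i * (\<Sum>\<iota>\<in>index_tuples m n. of_bool (i \<in> \<iota> ` {1..m})))"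
    by (subst sum.swap) (simp only: sum_distrib_left)
  also have "\<dots> = (\<Sum>i\<in>{1..n}. f i * real ((n - 1) choose (m - 1)))"
  proof (rule sum.cong[OF refl])
    fix i assume "i \<in> {1..n}"
    then have "card {\<iota> \<in> index_tuples m n. {i} \<subseteq> \<iota> ` {1..m}} = (n - 1) choose (m - 1)"
      using assms by (subst card_index_tuples_superset) auto
    moreover have "(\<Sum>\<iota>\<in>index_tuples m n. of_bool (i \<in> \<iota> ` {1..m}) :: real)
        = real (card {\<iota> \<in> index_tuples m n. {i} \<subseteq> \<iota> ` {1..m}})"
      by (subst sum_of_bool_eq) (simp_all add: Int_def)
    ultimately show "f i * (\<Sum>\<iota>\<in>index_tuples m n. of_bool (i \<in> \<iota> ` {1..m})) = f i * real ((n - 1) choose (m - 1))"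
      by simp
  qed
  also have "\<dots> = real ((n - 1) choose (m - 1)) * (\<Sum>i\<in>{1..n}. f i)"
    by (simp add: sum_distrib_right mult.commute)
  also have "real ((n - 1) choose (m - 1)) = real (n choose m) * real m / real n"
    using arg_cong[OF times_binomial_minus1_eq[of m n], of real] assms by (simp add: field_simps)
  finally show ?thesis .
qed

section \<open>Convergence to zero in probability\<close>

text \<open>The expectation of \<open>min 1 \<bar>Z\<bar>\<close> metrises convergence in probability. It is subadditive and bounded
by both the mean of \<open>\<bar>Z\<bar>\<close> and the probability that \<open>Z \<noteq> 0\<close>, so estimates of either kind can be added up.\<close>

definition (in prob_space) vanishes_in_prob :: "(nat \<Rightarrow> 'a \<Rightarrow> real) \<Rightarrow> bool" where
  "vanishes_in_prob Z \<longleftrightarrow>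
     (\<forall>n. Z n \<in> borel_measurable M) \<and> (\<lambda>n. expectation (\<lambda>\<omega>. min 1 \<bar>Z n \<omega>\<bar>)) \<longlonglongrightarrow> 0"

context prob_space
begin

lemma integrable_min_1_abs:
  fixes Z :: "'a \<Rightarrow> real"
  assumes [measurable]: "Z \<in> borel_measurable M"
  shows "integrable M (\<lambda>\<omega>. min 1 \<bar>Z \<omega>\<bar>)"
  by (rule integrable_const_bound[where B = 1]) auto

lemma vanishes_in_prob_bound:
  assumes Z: "vanishes_in_prob Z" and Z' [measurable]: "\<And>n. Z' n \<in> borel_measurable M"
    and le: "\<forall>\<^sub>F n in sequentially. AE \<omega> in M. \<bar>Z' n \<omega>\<bar> \<le> c * \<bar>Z n \<omega>\<bar>"
  shows "vanishes_in_prob Z'"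
  unfolding vanishes_in_prob_def
proof (intro conjI allI Z')
  have Zm [measurable]: "Z n \<in> borel_measurable M" for n
    using Z by (simp add: vanishes_in_prob_def)
  show "(\<lambda>n. expectation (\<lambda>\<omega>. min 1 \<bar>Z' n \<omega>\<bar>)) \<longlonglongrightarrow> 0"
  proof (rule tendsto_sandwich[OF _ _ tendsto_const])
    show "(\<lambda>n. (1 + \<bar>c\<bar>) * expectation (\<lambda>\<omega>. min 1 \<bar>Z n \<omega>\<bar>)) \<longlonglongrightarrow> 0"
      using Z unfolding vanishes_in_prob_def by (auto intro: tendsto_mult_right_zero)
    show "\<forall>\<^sub>F n in sequentially. expectation (\<lambda>\<omega>. min 1 \<bar>Z' n \<omega>\<bar>) \<le> (1 + \<bar>c\<bar>) * expectation (\<lambda>\<omega>. min 1 \<bar>Z n \<omega>\<bar>)"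
      using le
    proof eventually_elim
      case (elim n)
      have "expectation (\<lambda>\<omega>. min 1 \<bar>Z' n \<omega>\<bar>) \<le> expectation (\<lambda>\<omega>. (1 + \<bar>c\<bar>) * min 1 \<bar>Z n \<omega>\<bar>)"
      proof (rule integral_mono_AE)
        show "AE \<omega> in M. min 1 \<bar>Z' n \<omega>\<bar> \<le> (1 + \<bar>c\<bar>) * min 1 \<bar>Z n \<omega>\<bar>"
          using elim
        proof eventually_elim
          case (elim \<omega>)
          have "c * \<bar>Z n \<omega>\<bar> \<le> (1 + \<bar>c\<bar>) * \<bar>Z n \<omega>\<bar>" by (intro mult_right_mono) auto
          with elim show ?case by (cases "\<bar>Z n \<omega>\<bar> \<le> 1") (auto simp: min_def)
        qed
      qed (auto intro: integrable_min_1_abs)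
      then show ?case by simp
    qed
  qed auto
qed

lemma vanishes_in_prob_add:
  assumes Z: "vanishes_in_prob Z" and Z': "vanishes_in_prob Z'"
  shows "vanishes_in_prob (\<lambda>n \<omega>. Z n \<omega> + Z' n \<omega>)"
proof -
  have m [measurable]: "Z n \<in> borel_measurable M" "Z' n \<in> borel_measurable M" for n
    using assms by (simp_all add: vanishes_in_prob_def)
  have lim: "(\<lambda>n. expectation (\<lambda>\<omega>. min 1 \<bar>Z n \<omega>\<bar>) + expectation (\<lambda>\<omega>. min 1 \<bar>Z' n \<omega>\<bar>)) \<longlonglongrightarrow> 0"
    using tendsto_add[of _ 0 sequentially _ 0] assms by (simp add: vanishes_in_prob_def)
  have le: "expectation (\<lambda>\<omega>. min 1 \<bar>Z n \<omega> + Z' n \<omega>\<bar>)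
      \<le> expectation (\<lambda>\<omega>. min 1 \<bar>Z n \<omega>\<bar>) + expectation (\<lambda>\<omega>. min 1 \<bar>Z' n \<omega>\<bar>)" for n
    unfolding Bochner_Integration.integral_add[OF integrable_min_1_abs[OF m(1)] integrable_min_1_abs[OF m(2)], symmetric]
    by (intro integral_mono Bochner_Integration.integrable_add integrable_min_1_abs m borel_measurable_add) (auto simp: min_def)
  show ?thesis
    unfolding vanishes_in_prob_def
    by (intro conjI allI borel_measurable_add m tendsto_sandwich[OF _ _ tendsto_const lim] always_eventually le)
       auto
qed

lemma vanishes_in_prob_cmult:
  assumes "vanishes_in_prob Z"
  shows "vanishes_in_prob (\<lambda>n \<omega>. c * Z n \<omega>)"
proof (rule vanishes_in_prob_bound[where c = "\<bar>c\<bar>", OF assms])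
  have [measurable]: "Z n \<in> borel_measurable M" for n
    using assms by (simp add: vanishes_in_prob_def)
  show "(\<lambda>\<omega>. c * Z n \<omega>) \<in> borel_measurable M" for n by measurable
qed (simp add: abs_mult)

lemma vanishes_in_prob_abs:
  assumes "vanishes_in_prob Z"
  shows "vanishes_in_prob (\<lambda>n \<omega>. \<bar>Z n \<omega>\<bar>)"
  by (rule vanishes_in_prob_bound[OF assms, where c = 1])
     (use assms in \<open>auto simp: vanishes_in_prob_def intro: borel_measurable_abs\<close>)

lemma vanishes_in_prob_L1:
  assumes int: "\<And>n. integrable M (Z n)" and lim: "(\<lambda>n. expectation (\<lambda>\<omega>. \<bar>Z n \<omega>\<bar>)) \<longlonglongrightarrow> 0"
  shows "vanishes_in_prob Z"
  unfolding vanishes_in_prob_def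
proof (intro conjI allI tendsto_sandwich[OF _ _ tendsto_const lim] always_eventually)
  fix n show m: "Z n \<in> borel_measurable M" using int[of n] by simp
  show "expectation (\<lambda>\<omega>. min 1 \<bar>Z n \<omega>\<bar>) \<le> expectation (\<lambda>\<omega>. \<bar>Z n \<omega>\<bar>)"
    by (intro integral_mono integrable_min_1_abs m) (auto intro: int)
qed auto

lemma vanishes_in_prob_const:
  assumes "c \<longlonglongrightarrow> 0"
  shows "vanishes_in_prob (\<lambda>n _. c n)"
  using assms by (intro vanishes_in_prob_L1) (auto simp: prob_space tendsto_rabs_zero)

lemma iexp_diff_le: "norm (iexp x - iexp y) \<le> \<bar>x - y\<bar>"
proof -
  have "iexp x - iexp y = iexp y * (iexp (x - y) - 1)"
    by (simp add: algebra_simps exp_add[symmetric])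
  then have "norm (iexp x - iexp y) = norm (iexp (x - y) - 1)"
    by (simp add: norm_mult)
  with iexp_approx1[of "x - y" 0] show ?thesis by simp
qed

text \<open>Slutsky's lemma in terms of characteristic functions: \<open>iexp\<close> is bounded and Lipschitz.\<close>

lemma char_tendsto_perturb:
  assumes V: "vanishes_in_prob (\<lambda>n \<omega>. A n \<omega> - B n \<omega>)"
    and A [measurable]: "\<And>n. A n \<in> borel_measurable M" and B [measurable]: "\<And>n. B n \<in> borel_measurable M"
    and lim: "(\<lambda>n. CLINT \<omega>|M. iexp (s * B n \<omega>)) \<longlonglongrightarrow> c"
  shows "(\<lambda>n. CLINT \<omega>|M. iexp (s * A n \<omega>)) \<longlonglongrightarrow> c"
proof -
  have int: "integrable M (\<lambda>\<omega>. iexp (f \<omega>))" if [measurable]: "f \<in> borel_measurable M" for f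
    by (rule integrable_const_bound[where B = 1]) auto
  have pt: "norm (iexp (s * a) - iexp (s * b)) \<le> (2 + \<bar>s\<bar>) * min 1 \<bar>a - b\<bar>" for a b
  proof (cases "\<bar>a - b\<bar> \<le> 1")
    case True
    have "norm (iexp (s * a) - iexp (s * b)) \<le> \<bar>s\<bar> * \<bar>a - b\<bar>"
      using iexp_diff_le[of "s * a" "s * b"] by (simp add: abs_mult[symmetric] right_diff_distrib)
    also have "\<dots> \<le> (2 + \<bar>s\<bar>) * \<bar>a - b\<bar>" by (intro mult_right_mono) auto
    finally show ?thesis using True by (simp add: min_def)
  next
    case False
    have "norm (iexp (s * a) - iexp (s * b)) \<le> norm (iexp (s * a)) + norm (iexp (s * b))"
      by (rule norm_triangle_ineq4)
    then have "norm (iexp (s * a) - iexp (s * b)) \<le> 2" unfolding norm_exp_i_times by simp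
    also have "2 \<le> (2 + \<bar>s\<bar>) * min 1 \<bar>a - b\<bar>" using False by (simp add: min_def)
    finally show ?thesis .
  qed
  have "(\<lambda>n. (CLINT \<omega>|M. iexp (s * A n \<omega>)) - (CLINT \<omega>|M. iexp (s * B n \<omega>))) \<longlonglongrightarrow> 0"
  proof (rule Lim_null_comparison[OF always_eventually])
    show "(\<lambda>n. (2 + \<bar>s\<bar>) * expectation (\<lambda>\<omega>. min 1 \<bar>A n \<omega> - B n \<omega>\<bar>)) \<longlonglongrightarrow> 0"
      using V unfolding vanishes_in_prob_def by (auto intro: tendsto_mult_right_zero)
    show "\<forall>n. norm ((CLINT \<omega>|M. iexp (s * A n \<omega>)) - (CLINT \<omega>|M. iexp (s * B n \<omega>)))
        \<le> (2 + \<bar>s\<bar>) * expectation (\<lambda>\<omega>. min 1 \<bar>A n \<omega> - B n \<omega>\<bar>)"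
    proof
      fix n
      have mA: "(\<lambda>\<omega>. s * A n \<omega>) \<in> borel_measurable M" and mB: "(\<lambda>\<omega>. s * B n \<omega>) \<in> borel_measurable M"
        by measurable
      have "norm ((CLINT \<omega>|M. iexp (s * A n \<omega>)) - (CLINT \<omega>|M. iexp (s * B n \<omega>)))
          = norm (CLINT \<omega>|M. iexp (s * A n \<omega>) - iexp (s * B n \<omega>))"
        by (subst Bochner_Integration.integral_diff[OF int[OF mA] int[OF mB]]) (rule refl)
      also have "\<dots> \<le> expectation (\<lambda>\<omega>. norm (iexp (s * A n \<omega>) - iexp (s * B n \<omega>)))"
        by (rule integral_norm_bound)
      also have "\<dots> \<le> expectation (\<lambda>\<omega>. (2 + \<bar>s\<bar>) * min 1 \<bar>A n \<omega> - B n \<omega>\<bar>)"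
        by (intro integral_mono pt integrable_norm Bochner_Integration.integrable_diff int mA mB
            integrable_mult_right integrable_min_1_abs borel_measurable_diff A B)
      finally show "norm ((CLINT \<omega>|M. iexp (s * A n \<omega>)) - (CLINT \<omega>|M. iexp (s * B n \<omega>)))
        \<le> (2 + \<bar>s\<bar>) * expectation (\<lambda>\<omega>. min 1 \<bar>A n \<omega> - B n \<omega>\<bar>)" by simp
    qed
  qed
  from tendsto_add[OF this lim] show ?thesis by simp
qed

end

section \<open>Lower and upper quantiles\<close>

context real_distribution
begin

lemma quantile_sets:
  assumes "0 < \<gamma>" "\<gamma> < 1"
  shows "{x. \<gamma> \<le> cdf M x} \<noteq> {}" "bdd_below {x. \<gamma> \<le> cdf M x}"
    and "{x. cdf M x \<le> \<gamma>} \<noteq> {}" "bdd_above {x. cdf M x \<le> \<gamma>}"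
proof -
  have "\<forall>\<^sub>F x in at_top. cdf M x > \<gamma>" by (rule order_tendstoD(1)[OF cdf_lim_at_top_prob assms(2)])
  then obtain b where b: "\<And>x. x \<ge> b \<Longrightarrow> cdf M x > \<gamma>" unfolding eventually_at_top_linorder by blast
  have "\<forall>\<^sub>F x in at_bot. cdf M x < \<gamma>" by (rule order_tendstoD(2)[OF cdf_lim_at_bot assms(1)])
  then obtain a where a: "\<And>x. x \<le> a \<Longrightarrow> cdf M x < \<gamma>" unfolding eventually_at_bot_linorder by blast
  show "{x. \<gamma> \<le> cdf M x} \<noteq> {}" using b[of b] by (auto intro: less_imp_le)
  show "{x. cdf M x \<le> \<gamma>} \<noteq> {}" using a[of a] by (auto intro: less_imp_le)
  show "bdd_below {x. \<gamma> \<le> cdf M x}"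
  proof (rule bdd_belowI[of _ a])
    fix x assume "x \<in> {x. \<gamma> \<le> cdf M x}"
    then show "a \<le> x" using a[of x] by (cases "x \<le> a") auto
  qed
  show "bdd_above {x. cdf M x \<le> \<gamma>}"
  proof (rule bdd_aboveI[of _ b])
    fix x assume "x \<in> {x. cdf M x \<le> \<gamma>}"
    then show "x \<le> b" using b[of x] by (cases "b \<le> x") auto
  qed
qed

text \<open>Right-continuity transports lower bounds from the right of \<open>a\<close> to \<open>a\<close> itself.\<close>

lemma le_of_at_right: "(\<And>x. x > a \<Longrightarrow> \<gamma> \<le> cdf M x) \<Longrightarrow> \<gamma> \<le> cdf M a"
  using cdf_is_right_cont[of a] unfolding continuous_within
  by (rule tendsto_lowerbound) (auto simp: eventually_at_filter)

context
  fixes \<gamma> :: real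
  assumes \<gamma>: "0 < \<gamma>" "\<gamma> < 1"
begin

lemma cdf_below_lower_quantile: "x < lower_quantile (cdf M) \<gamma> \<Longrightarrow> cdf M x < \<gamma>"
  unfolding lower_quantile_def
  using cInf_lower[OF _ quantile_sets(2)[OF \<gamma>], of x] by (cases "\<gamma> \<le> cdf M x") auto

lemma cdf_above_upper_quantile: "upper_quantile (cdf M) \<gamma> < x \<Longrightarrow> \<gamma> < cdf M x"
  unfolding upper_quantile_def
  using cSup_upper[OF _ quantile_sets(4)[OF \<gamma>], of x] by (cases "cdf M x \<le> \<gamma>") auto

lemma cdf_above_lower_quantile: "lower_quantile (cdf M) \<gamma> < x \<Longrightarrow> \<gamma> \<le> cdf M x"
  unfolding lower_quantile_def cInf_less_iff[OF quantile_sets(1,2)[OF \<gamma>]]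
  by (auto intro: order_trans[OF _ cdf_nondecreasing[OF less_imp_le]])

lemma cdf_below_upper_quantile: "x < upper_quantile (cdf M) \<gamma> \<Longrightarrow> cdf M x \<le> \<gamma>"
  unfolding upper_quantile_def less_cSup_iff[OF quantile_sets(3,4)[OF \<gamma>]]
  by (auto intro: order_trans[OF cdf_nondecreasing[OF less_imp_le]])

lemma cdf_lower_quantile: "\<gamma> \<le> cdf M (lower_quantile (cdf M) \<gamma>)"
  by (rule le_of_at_right) (rule cdf_above_lower_quantile)

lemma cdf_upper_quantile: "\<gamma> \<le> cdf M (upper_quantile (cdf M) \<gamma>)"
  by (rule le_of_at_right) (rule less_imp_le[OF cdf_above_upper_quantile])

lemma lower_quantile_le_upper_quantile: "lower_quantile (cdf M) \<gamma> \<le> upper_quantile (cdf M) \<gamma>"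
proof (rule ccontr)
  assume "\<not> ?thesis"
  then have "upper_quantile (cdf M) \<gamma> < lower_quantile (cdf M) \<gamma>" by simp
  from dense[OF this] obtain x where "upper_quantile (cdf M) \<gamma> < x" "x < lower_quantile (cdf M) \<gamma>"
    by blast
  with cdf_above_upper_quantile[of x] cdf_below_lower_quantile[of x] show False by simp
qed

lemma measure_less_upper_quantile: "measure M {..<upper_quantile (cdf M) \<gamma>} \<le> \<gamma>"
  by (rule tendsto_upperbound[OF cdf_at_left])
     (auto simp: eventually_at_filter cdf_below_upper_quantile)

lemma measure_less_lower_quantile: "measure M {..<lower_quantile (cdf M) \<gamma>} \<le> \<gamma>"
  using measure_less_upper_quantile lower_quantile_le_upper_quantile
  by (intro order_trans[OF finite_measure_mono measure_less_upper_quantile]) auto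

text \<open>Where the two quantiles differ, the distribution function is flat at height \<open>\<gamma>\<close> between them.\<close>

lemma quantile_gap:
  assumes "lower_quantile (cdf M) \<gamma> < upper_quantile (cdf M) \<gamma>"
  shows "cdf M (lower_quantile (cdf M) \<gamma>) = \<gamma>"
    and "measure M {..<upper_quantile (cdf M) \<gamma>} = \<gamma>"
    and "measure M {lower_quantile (cdf M) \<gamma><..<upper_quantile (cdf M) \<gamma>} = 0"
proof -
  let ?l = "lower_quantile (cdf M) \<gamma>" and ?u = "upper_quantile (cdf M) \<gamma>"
  show 1: "cdf M ?l = \<gamma>"
    using cdf_lower_quantile cdf_below_upper_quantile[OF assms] by simp
  have "{..<?u} = {..?l} \<union> {?l<..<?u}" using assms by auto
  then have "measure M {..<?u} = measure M ({..?l} \<union> {?l<..<?u})"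
    by (rule arg_cong)
  also have "\<dots> = measure M {..?l} + measure M {?l<..<?u}"
    by (rule finite_measure_Union) auto
  finally have "measure M {..<?u} = measure M {..?l} + measure M {?l<..<?u}" .
  then have eq: "measure M {..<?u} = \<gamma> + measure M {?l<..<?u}"
    using 1 by (simp add: cdf_def)
  with measure_less_upper_quantile measure_nonneg[of M "{?l<..<?u}"]
  show "measure M {?l<..<?u} = 0" by linarith
  with eq show "measure M {..<?u} = \<gamma>" by simp
qed

end

end

section \<open>Second moments of U-statistics\<close>

\<comment> \<open>Keeps the position sets in the form \<open>{1..m}\<close>, in which the domain of the kernels is stated.\<close>
declare One_nat_def [simp del]

lemma (in prob_space) abs_integral_le_bound:
  fixes f :: "'a \<Rightarrow> real"
  assumes "\<And>x. \<bar>f x\<bar> \<le> B"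
  shows "\<bar>expectation f\<bar> \<le> B"
proof (cases "integrable M f")
  case True
  have "\<bar>expectation f\<bar> \<le> expectation (\<lambda>x. \<bar>f x\<bar>)" by (rule integral_abs_bound)
  also have "\<dots> \<le> expectation (\<lambda>_. B)" using True assms by (intro integral_mono) auto
  finally show ?thesis by (simp add: prob_space)
next
  case False
  have "0 \<le> B" using assms by (meson abs_ge_zero order_trans)
  with False show ?thesis by (simp add: not_integrable_integral_eq)
qed

lemma (in prob_space) expectation_abs_le_sqrt:
  fixes Z :: "'a \<Rightarrow> real"
  assumes "integrable M Z" "integrable M (\<lambda>\<omega>. (Z \<omega>)\<^sup>2)"
  shows "expectation (\<lambda>\<omega>. \<bar>Z \<omega>\<bar>) \<le> sqrt (expectation (\<lambda>\<omega>. (Z \<omega>)\<^sup>2))"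
proof -
  have "0 \<le> variance (\<lambda>\<omega>. \<bar>Z \<omega>\<bar>)" by (rule variance_positive)
  also have "\<dots> = expectation (\<lambda>\<omega>. (Z \<omega>)\<^sup>2) - (expectation (\<lambda>\<omega>. \<bar>Z \<omega>\<bar>))\<^sup>2"
    using assms by (subst variance_eq) auto
  finally show ?thesis by (intro real_le_rsqrt) simp
qed

text \<open>The index \<open>0\<close> of the family serves as the generic copy; U-statistics use the indices \<open>1, \<dots>, n\<close>.\<close>

locale iid_sample = prob_space P for P :: "'w measure" +
  fixes S F :: "'a measure" and X :: "nat \<Rightarrow> 'w \<Rightarrow> 'a" and m :: nat
  assumes indep: "indep_vars (\<lambda>_. S) X UNIV"
    and distr_X: "\<And>i. distr P S (X i) = F"
    and m_pos: "m \<ge> 1"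
begin

abbreviation tuple :: "(nat \<Rightarrow> nat) \<Rightarrow> 'w \<Rightarrow> nat \<Rightarrow> 'a" where
  "tuple \<iota> \<omega> \<equiv> \<lambda>j\<in>{1..m}. X (\<iota> j) \<omega>"

abbreviation kernel_space :: "(nat \<Rightarrow> 'a) measure" where
  "kernel_space \<equiv> PiM {1..m} (\<lambda>_. S)"

definition ustat :: "((nat \<Rightarrow> 'a) \<Rightarrow> real) \<Rightarrow> nat \<Rightarrow> 'w \<Rightarrow> real" where
  "ustat q n \<omega> = (\<Sum>\<iota>\<in>index_tuples m n. q (tuple \<iota> \<omega>)) / real (n choose m)"

definition kernel_mean :: "((nat \<Rightarrow> 'a) \<Rightarrow> real) \<Rightarrow> real" where
  "kernel_mean q = expectation (\<lambda>\<omega>. q (\<lambda>j\<in>{1..m}. X j \<omega>))"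

text \<open>The first-order term of the Hoeffding decomposition of a symmetric kernel.\<close>

definition hajek :: "((nat \<Rightarrow> 'a) \<Rightarrow> real) \<Rightarrow> 'a \<Rightarrow> real" where
  "hajek q x = expectation (\<lambda>\<omega>. q (\<lambda>j\<in>{1..m}. if j = 1 then x else X j \<omega>)) - kernel_mean q"

lemma X_measurable [measurable]: "X i \<in> measurable P S"
  using indep unfolding indep_vars_def by auto

lemma X_space: "\<omega> \<in> space P \<Longrightarrow> X i \<omega> \<in> space S"
  using measurable_space[OF X_measurable] .

lemma measurable_tuple [measurable]: "tuple \<iota> \<in> measurable P kernel_space"
  by (rule measurable_restrict) measurable

lemma measurable_kernel_of_tuple:
  fixes q :: "(nat \<Rightarrow> 'a) \<Rightarrow> real"
  assumes "q \<in> borel_measurable kernel_space"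
  shows "(\<lambda>\<omega>. q (tuple \<iota> \<omega>)) \<in> borel_measurable P"
  by (rule measurable_compose[OF measurable_tuple assms])

lemma integrable_bounded:
  fixes f :: "'w \<Rightarrow> real"
  shows "f \<in> borel_measurable P \<Longrightarrow> (\<And>\<omega>. \<bar>f \<omega>\<bar> \<le> B) \<Longrightarrow> integrable P f"
  by (rule integrable_const_bound[where B = B]) auto

lemma distr_tuple:
  assumes "inj_on \<iota> {1..m}"
  shows "distr P kernel_space (tuple \<iota>) = PiM {1..m} (\<lambda>_. F)"
  using indep_vars_reindex_inj[OF indep assms] m_pos
  by (subst (asm) indep_vars_iff_distr_eq_PiM') (auto simp: distr_X)

lemma expectation_tuple_eq:
  fixes q :: "(nat \<Rightarrow> 'a) \<Rightarrow> real"
  assumes "inj_on \<iota> {1..m}" "inj_on \<kappa> {1..m}" and [measurable]: "q \<in> borel_measurable kernel_space"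
  shows "expectation (\<lambda>\<omega>. q (tuple \<iota> \<omega>)) = expectation (\<lambda>\<omega>. q (tuple \<kappa> \<omega>))"
proof -
  have "expectation (\<lambda>\<omega>. q (tuple \<nu> \<omega>)) = (LINT z|PiM {1..m} (\<lambda>_. F). q z)" if "inj_on \<nu> {1..m}" for \<nu>
    unfolding distr_tuple[OF that, symmetric]
    by (rule integral_distr[symmetric, OF measurable_tuple assms(3)])
  with assms show ?thesis by simp
qed

lemma expectation_tuple:
  fixes q :: "(nat \<Rightarrow> 'a) \<Rightarrow> real"
  assumes "inj_on \<iota> {1..m}" "q \<in> borel_measurable kernel_space"
  shows "expectation (\<lambda>\<omega>. q (tuple \<iota> \<omega>)) = kernel_mean q"
  unfolding kernel_mean_def using expectation_tuple_eq[OF assms(1) _ assms(2), of "\<lambda>j. j"] by simp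

text \<open>Fubini for the sample. The variables with index in \<open>K\<close> are independent of those among
\<open>X (\<iota> 1), \<dots>, X (\<iota> m)\<close> with index outside \<open>K\<close>, so the latter can be integrated first, over an
independent copy \<open>\<omega>'\<close>. This is conditioning on \<open>(X i)\<close> for \<open>i\<close> in \<open>K\<close>, without conditional expectations.\<close>

lemma expectation_split:
  fixes q :: "(nat \<Rightarrow> 'a) \<Rightarrow> real" and w :: "(nat \<Rightarrow> 'a) \<Rightarrow> real"
  assumes inj: "inj_on \<iota> {1..m}"
    and q [measurable]: "q \<in> borel_measurable kernel_space" and qB: "\<And>z. \<bar>q z\<bar> \<le> B"
    and w [measurable]: "w \<in> borel_measurable (PiM K (\<lambda>_. S))" and wC: "\<And>u. \<bar>w u\<bar> \<le> C"
  shows "expectation (\<lambda>\<omega>. q (tuple \<iota> \<omega>) * w (\<lambda>i\<in>K. X i \<omega>))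
    = expectation (\<lambda>\<omega>. w (\<lambda>i\<in>K. X i \<omega>)
        * expectation (\<lambda>\<omega>'. q (\<lambda>j\<in>{1..m}. if \<iota> j \<in> K then X (\<iota> j) \<omega> else X (\<iota> j) \<omega>')))"
proof -
  define A where "A = \<iota> ` {1..m} - K"
  define XK where "XK \<omega> = (\<lambda>i\<in>K. X i \<omega>)" for \<omega>
  define XA where "XA \<omega> = (\<lambda>i\<in>A. X i \<omega>)" for \<omega>
  let ?SK = "PiM K (\<lambda>_. S)" and ?SA = "PiM A (\<lambda>_. S)"
  define glue where "glue u v = (\<lambda>j\<in>{1..m}. if \<iota> j \<in> K then u (\<iota> j) else v (\<iota> j))" for u v :: "nat \<Rightarrow> 'a"
  have XK [measurable]: "XK \<in> measurable P ?SK" and XA [measurable]: "XA \<in> measurable P ?SA"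
    unfolding XK_def[abs_def] XA_def[abs_def] by (auto intro!: measurable_restrict)
  define G where "G p = q (glue (fst p) (snd p)) * w (fst p)" for p
  have "(\<lambda>p. glue (fst p) (snd p)) \<in> measurable (?SK \<Otimes>\<^sub>M ?SA) kernel_space"
    unfolding glue_def
  proof (rule measurable_restrict)
    fix j assume j: "j \<in> {1..m}"
    show "(\<lambda>p. if \<iota> j \<in> K then fst p (\<iota> j) else snd p (\<iota> j)) \<in> measurable (?SK \<Otimes>\<^sub>M ?SA) S"
    proof (cases "\<iota> j \<in> K")
      case True
      from measurable_compose[OF measurable_fst measurable_component_singleton[OF True]] True
      show ?thesis by simp
    next
      case False
      then have "\<iota> j \<in> A" using j by (simp add: A_def)
      from measurable_compose[OF measurable_snd measurable_component_singleton[OF this]] False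
      show ?thesis by simp
    qed
  qed
  from measurable_compose[OF this q] measurable_compose[OF measurable_fst w]
  have G: "G \<in> borel_measurable (?SK \<Otimes>\<^sub>M ?SA)"
    unfolding G_def[abs_def] by (rule borel_measurable_times)
  have ind: "indep_var ?SK XK ?SA XA"
    unfolding XK_def[abs_def] XA_def[abs_def] by (rule indep_var_restrict[OF indep]) (auto simp: A_def)
  then have joint: "distr P ?SK XK \<Otimes>\<^sub>M distr P ?SA XA = distr P (?SK \<Otimes>\<^sub>M ?SA) (\<lambda>\<omega>. (XK \<omega>, XA \<omega>))"
    by (simp add: indep_var_distribution_eq)
  interpret K: prob_space "distr P ?SK XK" by (rule prob_space_distr[OF XK])
  interpret A: prob_space "distr P ?SA XA" by (rule prob_space_distr[OF XA])
  interpret KA: pair_prob_space "distr P ?SK XK" "distr P ?SA XA" ..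
  have bound: "\<bar>G p\<bar> \<le> B * C" for p
    using mult_mono[OF qB wC] qB[THEN order_trans[OF abs_ge_zero]] by (simp add: G_def abs_mult)
  have int: "integrable (distr P ?SK XK \<Otimes>\<^sub>M distr P ?SA XA) G"
  proof (rule KA.integrable_const_bound[where B = "B * C"])
    show "G \<in> borel_measurable (distr P ?SK XK \<Otimes>\<^sub>M distr P ?SA XA)"
      unfolding joint measurable_distr_eq1 by (rule G)
  qed (simp add: bound)
  have eq: "tuple \<iota> \<omega> = glue (XK \<omega>) (XA \<omega>)" for \<omega>
    by (auto simp: glue_def XK_def XA_def A_def fun_eq_iff)
  have eq': "(\<lambda>j\<in>{1..m}. if \<iota> j \<in> K then X (\<iota> j) \<omega> else X (\<iota> j) \<omega>') = glue (XK \<omega>) (XA \<omega>')" for \<omega> \<omega>'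
    by (auto simp: glue_def XK_def XA_def A_def fun_eq_iff)
  have "expectation (\<lambda>\<omega>. q (tuple \<iota> \<omega>) * w (\<lambda>i\<in>K. X i \<omega>)) = expectation (\<lambda>\<omega>. G (XK \<omega>, XA \<omega>))"
    by (simp only: eq G_def XK_def[symmetric] fst_conv snd_conv)
  also have "\<dots> = (LINT p|distr P (?SK \<Otimes>\<^sub>M ?SA) (\<lambda>\<omega>. (XK \<omega>, XA \<omega>)). G p)"
    by (rule integral_distr[symmetric, OF measurable_Pair[OF XK XA] G])
  also have "\<dots> = (LINT u|distr P ?SK XK. LINT v|distr P ?SA XA. G (u, v))"
    unfolding joint[symmetric] by (rule KA.integral_fst'[OF int, symmetric])
  also have "\<dots> = (LINT u|distr P ?SK XK. expectation (\<lambda>\<omega>'. G (u, XA \<omega>')))"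
  proof (rule Bochner_Integration.integral_cong[OF refl])
    fix u assume "u \<in> space (distr P ?SK XK)"
    then have "u \<in> space ?SK" by simp
    from measurable_compose[OF measurable_Pair1'[OF this] G]
    show "(LINT v|distr P ?SA XA. G (u, v)) = expectation (\<lambda>\<omega>'. G (u, XA \<omega>'))"
      by (rule integral_distr[OF XA])
  qed
  also have "\<dots> = expectation (\<lambda>\<omega>. expectation (\<lambda>\<omega>'. G (XK \<omega>, XA \<omega>')))"
  proof (rule integral_distr[OF XK])
    have "(\<lambda>(u, \<omega>'). G (u, XA \<omega>')) \<in> borel_measurable (?SK \<Otimes>\<^sub>M P)"
      unfolding split_beta'
      by (rule measurable_compose[OF measurable_Pair[OF measurable_fst measurable_compose[OF measurable_snd XA]] G])
    then show "(\<lambda>u. expectation (\<lambda>\<omega>'. G (u, XA \<omega>'))) \<in> borel_measurable ?SK"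
      by (rule borel_measurable_lebesgue_integral)
  qed
  finally show ?thesis
    by (simp only: eq' G_def fst_conv snd_conv XK_def[symmetric] mult.commute[of "w _"] integral_mult_left_zero)
qed

text \<open>In the double sum over pairs of index tuples only those with at least \<open>r\<close> common indices contribute, each by at
most \<open>B\<^sup>2\<close>.\<close>

lemma ustat_second_moment:
  assumes q [measurable]: "q \<in> borel_measurable kernel_space" and qB: "\<And>z. \<bar>q z\<bar> \<le> B"
    and "m \<le> n" "r \<le> n"
    and orth: "\<And>\<iota> \<kappa>. \<iota> \<in> index_tuples m n \<Longrightarrow> \<kappa> \<in> index_tuples m n \<Longrightarrow> card (\<iota> ` {1..m} \<inter> \<kappa> ` {1..m}) < r
      \<Longrightarrow> expectation (\<lambda>\<omega>. q (tuple \<iota> \<omega>) * q (tuple \<kappa> \<omega>)) = 0"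
  shows "expectation (\<lambda>\<omega>. (ustat q n \<omega>)\<^sup>2) \<le> B\<^sup>2 * (real (m choose r))\<^sup>2 / real (n choose r)"
proof -
  define T where "T = index_tuples m n"
  define N where "N = real (n choose m)"
  have N: "N > 0" using assms by (simp add: N_def)
  have "finite T" and cardT: "real (card T) = N" by (simp_all add: T_def N_def card_index_tuples)
  have bound: "\<bar>q z * q z'\<bar> \<le> B\<^sup>2" for z z'
    using mult_mono[OF qB[of z] qB[of z']] qB[of z] by (simp add: abs_mult power2_eq_square)
  have int: "integrable P (\<lambda>\<omega>. q (tuple \<iota> \<omega>) * q (tuple \<kappa> \<omega>))" for \<iota> \<kappa>
    by (rule integrable_bounded[OF borel_measurable_times bound]) (rule measurable_kernel_of_tuple[OF q])+
  have pair: "expectation (\<lambda>\<omega>. q (tuple \<iota> \<omega>) * q (tuple \<kappa> \<omega>))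
      \<le> B\<^sup>2 * of_bool (r \<le> card (\<iota> ` {1..m} \<inter> \<kappa> ` {1..m}))" if "\<iota> \<in> T" "\<kappa> \<in> T" for \<iota> \<kappa>
  proof (cases "r \<le> card (\<iota> ` {1..m} \<inter> \<kappa> ` {1..m})")
    case True
    have "\<bar>expectation (\<lambda>\<omega>. q (tuple \<iota> \<omega>) * q (tuple \<kappa> \<omega>))\<bar> \<le> B\<^sup>2"
      by (rule abs_integral_le_bound) (rule bound)
    with True show ?thesis by simp
  next
    case False
    with orth that show ?thesis by (simp add: T_def)
  qed
  have row: "(\<Sum>\<iota>\<in>T. B\<^sup>2 * of_bool (r \<le> card (\<iota> ` {1..m} \<inter> \<kappa> ` {1..m})))
      \<le> B\<^sup>2 * ((real (m choose r))\<^sup>2 / real (n choose r) * N)" if "\<kappa> \<in> T" for \<kappa>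
  proof -
    have "(\<Sum>\<iota>\<in>T. of_bool (r \<le> card (\<iota> ` {1..m} \<inter> \<kappa> ` {1..m})) :: real)
        = real (card {\<iota> \<in> T. r \<le> card (\<iota> ` {1..m} \<inter> \<kappa> ` {1..m})})"
      using \<open>finite T\<close> by (subst sum_of_bool_eq) (simp_all add: Int_def)
    also have "\<dots> \<le> (real (m choose r))\<^sup>2 / real (n choose r) * N"
      unfolding T_def N_def using that index_tuplesD(2,3)[of \<kappa> m n] assms(4)
      by (intro card_index_tuples_overlap) (simp_all add: T_def)
    finally show ?thesis
      by (simp only: sum_distrib_left[symmetric] mult_left_mono zero_le_power2)
  qed
  have "expectation (\<lambda>\<omega>. (ustat q n \<omega>)\<^sup>2)
      = expectation (\<lambda>\<omega>. (\<Sum>\<kappa>\<in>T. \<Sum>\<iota>\<in>T. q (tuple \<iota> \<omega>) * q (tuple \<kappa> \<omega>)) / N\<^sup>2)"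
    unfolding ustat_def T_def[symmetric] N_def[symmetric] power_divide
      power2_eq_square[of "sum _ _"] sum_product by (subst sum.swap) (rule refl)
  also have "\<dots> = (\<Sum>\<kappa>\<in>T. \<Sum>\<iota>\<in>T. expectation (\<lambda>\<omega>. q (tuple \<iota> \<omega>) * q (tuple \<kappa> \<omega>))) / N\<^sup>2"
    by (simp only: integral_divide_zero Bochner_Integration.integral_sum Bochner_Integration.integrable_sum int)
  also have "\<dots> \<le> (\<Sum>\<kappa>\<in>T. \<Sum>\<iota>\<in>T. B\<^sup>2 * of_bool (r \<le> card (\<iota> ` {1..m} \<inter> \<kappa> ` {1..m}))) / N\<^sup>2"
    by (intro divide_right_mono sum_mono pair) auto
  also have "\<dots> \<le> (\<Sum>\<kappa>\<in>T. B\<^sup>2 * ((real (m choose r))\<^sup>2 / real (n choose r) * N)) / N\<^sup>2"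
    by (intro divide_right_mono sum_mono row) auto
  also have "\<dots> = B\<^sup>2 * (real (m choose r))\<^sup>2 / real (n choose r)"
    using N by (simp add: cardT power2_eq_square)
  finally show ?thesis .
qed

lemma ustat_measurable [measurable]:
  assumes "q \<in> borel_measurable kernel_space"
  shows "ustat q n \<in> borel_measurable P"
  unfolding ustat_def[abs_def]
  by (intro borel_measurable_divide borel_measurable_sum borel_measurable_const
      measurable_kernel_of_tuple assms)

lemma abs_ustat_le:
  assumes "\<And>z. \<bar>q z\<bar> \<le> B"
  shows "\<bar>ustat q n \<omega>\<bar> \<le> B"
proof -
  have "0 \<le> B" using assms by (meson abs_ge_zero order_trans)
  have "\<bar>\<Sum>\<iota>\<in>index_tuples m n. q (tuple \<iota> \<omega>)\<bar> \<le> (\<Sum>\<iota>\<in>index_tuples m n. B)"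
    by (rule order_trans[OF sum_abs]) (intro sum_mono assms)
  then show ?thesis
    using \<open>0 \<le> B\<close> by (cases "n choose m = 0") (auto simp: ustat_def card_index_tuples abs_divide field_simps)
qed

lemma ustat_L1:
  assumes q [measurable]: "q \<in> borel_measurable kernel_space" and qB: "\<And>z. \<bar>q z\<bar> \<le> B"
    and "m \<le> n" "r \<le> n"
    and "\<And>\<iota> \<kappa>. \<iota> \<in> index_tuples m n \<Longrightarrow> \<kappa> \<in> index_tuples m n \<Longrightarrow> card (\<iota> ` {1..m} \<inter> \<kappa> ` {1..m}) < r
      \<Longrightarrow> expectation (\<lambda>\<omega>. q (tuple \<iota> \<omega>) * q (tuple \<kappa> \<omega>)) = 0"
  shows "expectation (\<lambda>\<omega>. \<bar>ustat q n \<omega>\<bar>) \<le> B * real (m choose r) / sqrt (real (n choose r))"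
proof -
  have B: "0 \<le> B" using qB by (meson abs_ge_zero order_trans)
  have "(ustat q n \<omega>)\<^sup>2 \<le> B\<^sup>2" for \<omega>
    using abs_ustat_le[of q B n \<omega>, OF qB] B by (intro abs_le_square_iff[THEN iffD1]) simp
  then have "integrable P (\<lambda>\<omega>. (ustat q n \<omega>)\<^sup>2)"
    by (intro integrable_bounded[where B = "B\<^sup>2"] borel_measurable_power ustat_measurable q) simp
  moreover have "integrable P (ustat q n)"
    by (rule integrable_bounded[OF ustat_measurable[OF q] abs_ustat_le[OF qB]])
  ultimately have "expectation (\<lambda>\<omega>. \<bar>ustat q n \<omega>\<bar>) \<le> sqrt (expectation (\<lambda>\<omega>. (ustat q n \<omega>)\<^sup>2))"
    by (intro expectation_abs_le_sqrt)
  also have "\<dots> \<le> sqrt (B\<^sup>2 * (real (m choose r))\<^sup>2 / real (n choose r))"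
    by (rule real_sqrt_le_mono[OF ustat_second_moment[OF assms]])
  also have "\<dots> = B * real (m choose r) / sqrt (real (n choose r))"
    using B by (simp add: real_sqrt_divide real_sqrt_mult)
  finally show ?thesis .
qed

lemma tuple_as_restriction:
  "tuple \<kappa> \<omega> = (\<lambda>j\<in>{1..m}. (\<lambda>i\<in>\<kappa> ` {1..m}. X i \<omega>) (\<kappa> j))"
  by auto

lemma measurable_kernel_of_restriction:
  fixes q :: "(nat \<Rightarrow> 'a) \<Rightarrow> real"
  assumes "q \<in> borel_measurable kernel_space"
  shows "(\<lambda>u. q (\<lambda>j\<in>{1..m}. u (\<kappa> j))) \<in> borel_measurable (PiM (\<kappa> ` {1..m}) (\<lambda>_. S))"
  by (rule measurable_compose[OF _ assms]) (auto intro!: measurable_restrict measurable_component_singleton)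

lemma orthogonal_disjoint:
  fixes q :: "(nat \<Rightarrow> 'a) \<Rightarrow> real"
  assumes q: "q \<in> borel_measurable kernel_space" and qB: "\<And>z. \<bar>q z\<bar> \<le> B"
    and zero: "kernel_mean q = 0"
    and \<iota>: "inj_on \<iota> {1..m}" and disj: "\<iota> ` {1..m} \<inter> \<kappa> ` {1..m} = {}"
  shows "expectation (\<lambda>\<omega>. q (tuple \<iota> \<omega>) * q (tuple \<kappa> \<omega>)) = 0"
proof -
  have eq: "(\<lambda>j\<in>{1..m}. if \<iota> j \<in> \<kappa> ` {1..m} then X (\<iota> j) \<omega> else X (\<iota> j) \<omega>') = tuple \<iota> \<omega>'" for \<omega> \<omega>'
  proof -
    have "\<iota> j \<notin> \<kappa> ` {1..m}" if "j \<in> {1..m}" for j using disj that by blast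
    then show ?thesis by (auto simp: fun_eq_iff restrict_def)
  qed
  show ?thesis
    using expectation_split[OF \<iota> q qB measurable_kernel_of_restriction[OF q, of \<kappa>] qB]
    unfolding eq expectation_tuple[OF \<iota> q] zero tuple_as_restriction[symmetric] by simp
qed

text \<open>Given all variables occurring in the tuple \<open>\<kappa>\<close>, only one argument of \<open>q (tuple \<iota>)\<close> is fixed, and by
degeneracy the average over the others is zero.\<close>

lemma orthogonal_overlap_one:
  fixes q :: "(nat \<Rightarrow> 'a) \<Rightarrow> real"
  assumes q: "q \<in> borel_measurable kernel_space" and qB: "\<And>z. \<bar>q z\<bar> \<le> B"
    and degenerate: "\<And>j x. j \<in> {1..m} \<Longrightarrow> x \<in> space S
      \<Longrightarrow> expectation (\<lambda>\<omega>. q (\<lambda>k\<in>{1..m}. if k = j then x else X (\<iota> k) \<omega>)) = 0"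
    and \<iota>: "inj_on \<iota> {1..m}" and j: "j \<in> {1..m}" and overlap: "\<iota> ` {1..m} \<inter> \<kappa> ` {1..m} = {\<iota> j}"
  shows "expectation (\<lambda>\<omega>. q (tuple \<iota> \<omega>) * q (tuple \<kappa> \<omega>)) = 0"
proof -
  have iff: "\<iota> k \<in> \<kappa> ` {1..m} \<longleftrightarrow> k = j" if k: "k \<in> {1..m}" for k
  proof -
    have "\<iota> k \<in> \<kappa> ` {1..m} \<longleftrightarrow> \<iota> k = \<iota> j" using k overlap by blast
    also have "\<dots> \<longleftrightarrow> k = j" using inj_on_eq_iff[OF \<iota> k j] .
    finally show ?thesis .
  qed
  have eq: "(\<lambda>k\<in>{1..m}. if \<iota> k \<in> \<kappa> ` {1..m} then X (\<iota> k) \<omega> else X (\<iota> k) \<omega>')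
      = (\<lambda>k\<in>{1..m}. if k = j then X (\<iota> j) \<omega> else X (\<iota> k) \<omega>')" for \<omega> \<omega>'
    using iff by (auto simp: fun_eq_iff restrict_def)
  have "expectation (\<lambda>\<omega>. q (tuple \<iota> \<omega>) * q (tuple \<kappa> \<omega>))
      = expectation (\<lambda>\<omega>. q (tuple \<kappa> \<omega>)
        * expectation (\<lambda>\<omega>'. q (\<lambda>k\<in>{1..m}. if k = j then X (\<iota> j) \<omega> else X (\<iota> k) \<omega>')))"
    using expectation_split[OF \<iota> q qB measurable_kernel_of_restriction[OF q, of \<kappa>] qB]
    unfolding eq tuple_as_restriction[symmetric] .
  also have "\<dots> = expectation (\<lambda>\<omega>. 0)"
    by (intro Bochner_Integration.integral_cong refl) (simp add: degenerate[OF j X_space])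
  finally show ?thesis by simp
qed

lemma kernel_mean_diff_const:
  assumes [measurable]: "q \<in> borel_measurable kernel_space" and "\<And>z. \<bar>q z\<bar> \<le> B"
  shows "kernel_mean (\<lambda>z. q z - c) = kernel_mean q - c"
proof -
  have "integrable P (\<lambda>\<omega>. q (\<lambda>j\<in>{1..m}. X j \<omega>))"
    by (rule integrable_bounded[OF _ assms(2)]) (rule measurable_kernel_of_tuple[OF assms(1)])
  then show ?thesis by (simp add: kernel_mean_def prob_space)
qed

lemma abs_kernel_mean_le: "(\<And>z. \<bar>q z\<bar> \<le> B) \<Longrightarrow> \<bar>kernel_mean q\<bar> \<le> B"
  unfolding kernel_mean_def by (rule abs_integral_le_bound)

lemma abs_hajek_le:
  assumes "\<And>z. \<bar>q z\<bar> \<le> B"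
  shows "\<bar>hajek q x\<bar> \<le> 2 * B"
proof -
  have "\<bar>expectation (\<lambda>\<omega>. q (\<lambda>j\<in>{1..m}. if j = 1 then x else X j \<omega>))\<bar> \<le> B"
    by (rule abs_integral_le_bound) (rule assms)
  with abs_kernel_mean_le[of q B, OF assms] show ?thesis unfolding hajek_def by linarith
qed

lemma ustat_L1_rate:
  assumes q [measurable]: "q \<in> borel_measurable kernel_space" and qB: "\<And>z. \<bar>q z\<bar> \<le> B" and "m \<le> n"
  shows "expectation (\<lambda>\<omega>. \<bar>ustat q n \<omega> - kernel_mean q\<bar>) \<le> 2 * B * real m / sqrt (real n)"
proof -
  let ?q = "\<lambda>z. q z - kernel_mean q"
  have bound: "\<bar>?q z\<bar> \<le> 2 * B" for z
    using qB[of z] abs_kernel_mean_le[of q B, OF qB] by linarith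
  have qm: "?q \<in> borel_measurable kernel_space"
    by (intro borel_measurable_diff q borel_measurable_const)
  have zero: "kernel_mean ?q = 0" by (simp add: kernel_mean_diff_const[OF q qB])
  have "n choose m > 0" using assms by simp
  then have eq: "ustat ?q n \<omega> = ustat q n \<omega> - kernel_mean q" for \<omega>
    by (simp add: ustat_def sum_subtractf card_index_tuples diff_divide_distrib)
  have "expectation (\<lambda>\<omega>. \<bar>ustat ?q n \<omega>\<bar>) \<le> 2 * B * real (m choose 1) / sqrt (real (n choose 1))"
  proof (rule ustat_L1[OF qm bound \<open>m \<le> n\<close>])
    show "1 \<le> n" using m_pos \<open>m \<le> n\<close> by simp
    fix \<iota> \<kappa> assume *: "\<iota> \<in> index_tuples m n" "card (\<iota> ` {1..m} \<inter> \<kappa> ` {1..m}) < 1"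
    then have "\<iota> ` {1..m} \<inter> \<kappa> ` {1..m} = {}" by simp
    then show "expectation (\<lambda>\<omega>. ?q (tuple \<iota> \<omega>) * ?q (tuple \<kappa> \<omega>)) = 0"
      by (intro orthogonal_disjoint[OF qm bound zero index_tuplesD(1)[OF *(1)]])
  qed
  then show ?thesis by (simp add: eq choose_one)
qed

lemma measurable_hajek [measurable]:
  assumes "q \<in> borel_measurable kernel_space"
  shows "hajek q \<in> borel_measurable S"
proof -
  have "(\<lambda>p. \<lambda>j\<in>{1..m}. if j = 1 then fst p else X j (snd p)) \<in> measurable (S \<Otimes>\<^sub>M P) kernel_space"
  proof (rule measurable_restrict)
    fix j :: nat
    show "(\<lambda>p. if j = 1 then fst p else X j (snd p)) \<in> measurable (S \<Otimes>\<^sub>M P) S"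
      using measurable_compose[OF measurable_snd X_measurable] by (cases "j = 1") simp_all
  qed
  from measurable_compose[OF this assms]
  have "(\<lambda>(x, \<omega>). q (\<lambda>j\<in>{1..m}. if j = 1 then x else X j \<omega>)) \<in> borel_measurable (S \<Otimes>\<^sub>M P)"
    unfolding split_beta' .
  then have "(\<lambda>x. expectation (\<lambda>\<omega>. q (\<lambda>j\<in>{1..m}. if j = 1 then x else X j \<omega>))) \<in> borel_measurable S"
    by (rule borel_measurable_lebesgue_integral)
  then show ?thesis unfolding hajek_def[abs_def] by (intro borel_measurable_diff borel_measurable_const)
qed

lemma measurable_hajek_X [measurable]:
  "q \<in> borel_measurable kernel_space \<Longrightarrow> (\<lambda>\<omega>. hajek q (X i \<omega>)) \<in> borel_measurable P"
  by (rule measurable_compose[OF X_measurable measurable_hajek])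

text \<open>By symmetry the fixed argument can be moved from position \<open>j\<close> to the first position, and which
i.i.d. variables fill the other positions is immaterial.\<close>

lemma expectation_section:
  assumes q: "q \<in> borel_measurable kernel_space" and sym: "symmetric_kernel S m q"
    and \<iota>: "inj_on \<iota> {1..m}" and j: "j \<in> {1..m}" and x: "x \<in> space S"
  shows "expectation (\<lambda>\<omega>. q (\<lambda>k\<in>{1..m}. if k = j then x else X (\<iota> k) \<omega>)) = hajek q x + kernel_mean q"
proof -
  define \<pi> where "\<pi> = Transposition.transpose 1 j"
  have \<pi>: "\<pi> permutes {1..m}"
    unfolding \<pi>_def using j m_pos by (intro permutes_swap_id) auto
  have \<pi>m: "\<pi> k \<in> {1..m} \<longleftrightarrow> k \<in> {1..m}" for k using permutes_in_image[OF \<pi>] .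
  have \<pi>j: "\<pi> k = j \<longleftrightarrow> k = 1" for k by (auto simp: \<pi>_def Transposition.transpose_def)
  have swap: "q (\<lambda>k\<in>{1..m}. if k = j then x else X (\<iota> k) \<omega>)
      = q (\<lambda>k\<in>{1..m}. if k = 1 then x else X ((\<iota> \<circ> \<pi>) k) \<omega>)" if "\<omega> \<in> space P" for \<omega>
  proof -
    let ?z = "\<lambda>k\<in>{1..m}. if k = j then x else X (\<iota> k) \<omega>"
    have "?z \<in> {1..m} \<rightarrow>\<^sub>E space S" using x X_space[OF that] by auto
    moreover have "\<forall>z\<in>{1..m} \<rightarrow>\<^sub>E space S. q (z \<circ> \<pi>) = q z"
      using sym \<pi> by (simp add: symmetric_kernel_def)
    ultimately have "q (?z \<circ> \<pi>) = q ?z" by (rule bspec[rotated])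
    moreover have "?z \<circ> \<pi> = (\<lambda>k\<in>{1..m}. if k = 1 then x else X ((\<iota> \<circ> \<pi>) k) \<omega>)"
    proof
      fix k show "(?z \<circ> \<pi>) k = (\<lambda>k\<in>{1..m}. if k = 1 then x else X ((\<iota> \<circ> \<pi>) k) \<omega>) k"
        unfolding comp_def restrict_def \<pi>m \<pi>j by simp
    qed
    ultimately show ?thesis by simp
  qed
  let ?q = "\<lambda>z. q (\<lambda>k\<in>{1..m}. if k = 1 then x else z k)"
  have "(\<lambda>z. \<lambda>k\<in>{1..m}. if k = 1 then x else z k) \<in> measurable kernel_space kernel_space"
    using x by (intro measurable_restrict) auto
  then have qm: "?q \<in> borel_measurable kernel_space"
    by (rule measurable_compose[OF _ q])
  have restr: "(\<lambda>k\<in>{1..m}. if k = 1 then x else X (\<nu> k) \<omega>) = (\<lambda>k\<in>{1..m}. if k = 1 then x else tuple \<nu> \<omega> k)" for \<nu> \<omega>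
    by auto
  have "inj_on (\<iota> \<circ> \<pi>) {1..m}"
    using \<iota> \<pi> by (intro comp_inj_on) (auto simp: permutes_image permutes_inj_on)
  have "expectation (\<lambda>\<omega>. q (\<lambda>k\<in>{1..m}. if k = j then x else X (\<iota> k) \<omega>))
      = expectation (\<lambda>\<omega>. q (\<lambda>k\<in>{1..m}. if k = 1 then x else X ((\<iota> \<circ> \<pi>) k) \<omega>))"
    by (intro Bochner_Integration.integral_cong refl swap)
  also have "\<dots> = expectation (\<lambda>\<omega>. q (\<lambda>k\<in>{1..m}. if k = 1 then x else X k \<omega>))"
    using expectation_tuple_eq[OF \<open>inj_on (\<iota> \<circ> \<pi>) {1..m}\<close> _ qm, of "\<lambda>k. k"]
    by (simp only: restr inj_on_id2)
  finally show ?thesis by (simp add: hajek_def)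
qed

text \<open>Averaging the section of \<open>q\<close> over its first argument gives the mean of \<open>q\<close>. The variable \<open>X 0\<close> is
used as the first argument because it is independent of \<open>X 1, \<dots>, X m\<close>.\<close>

lemma expectation_hajek:
  assumes q: "q \<in> borel_measurable kernel_space" and qB: "\<And>z. \<bar>q z\<bar> \<le> B"
  shows "expectation (\<lambda>\<omega>. hajek q (X i \<omega>)) = 0"
proof -
  \<comment> \<open>The tuple \<open>(X 0, X 2, \<dots>, X m)\<close> has the law of \<open>(X 1, \<dots>, X m)\<close>.\<close>
  let ?\<iota> = "\<lambda>j::nat. if j = 1 then 0 else j"
  have \<iota>: "inj_on ?\<iota> {1..m}" by (auto simp: inj_on_def)
  have eq: "(\<lambda>j\<in>{1..m}. if ?\<iota> j \<in> {0} then X (?\<iota> j) \<omega> else X (?\<iota> j) \<omega>')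
      = (\<lambda>j\<in>{1..m}. if j = 1 then X 0 \<omega> else X j \<omega>')" for \<omega> \<omega>'
    by (auto simp: fun_eq_iff)
  have "kernel_mean q = expectation (\<lambda>\<omega>. expectation (\<lambda>\<omega>'. q (\<lambda>j\<in>{1..m}. if j = 1 then X 0 \<omega> else X j \<omega>')))"
    using expectation_split[OF \<iota> q qB, of "\<lambda>_. 1" "{0}" 1] expectation_tuple[OF \<iota> q] unfolding eq by simp
  also have "\<dots> = expectation (\<lambda>\<omega>. hajek q (X 0 \<omega>) + kernel_mean q)"
    by (simp add: hajek_def)
  also have "\<dots> = expectation (\<lambda>\<omega>. hajek q (X 0 \<omega>)) + kernel_mean q"
  proof -
    have "integrable P (\<lambda>\<omega>. hajek q (X 0 \<omega>))"
      by (rule integrable_bounded[OF measurable_hajek_X[OF q] abs_hajek_le[OF qB]])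
    then show ?thesis by (simp add: prob_space)
  qed
  finally have 0: "expectation (\<lambda>\<omega>. hajek q (X 0 \<omega>)) = 0" by simp
  have "expectation (\<lambda>\<omega>. hajek q (X k \<omega>)) = (LINT x|F. hajek q x)" for k
    unfolding distr_X[of k, symmetric]
    by (rule integral_distr[symmetric, OF X_measurable measurable_hajek[OF q]])
  with 0 show ?thesis by metis
qed

text \<open>The kernel \<open>\<Psi>\<close> obtained from \<open>q\<close> by removing its mean and its projections on single arguments is degenerate, so pairs
of tuples with at most one common index do not contribute to the second moment of its U-statistic. The right-hand
side is of order \<open>1 / n\<close>.\<close>

lemma hajek_projection_L1:
  assumes q [measurable]: "q \<in> borel_measurable kernel_space" and qB: "\<And>z. \<bar>q z\<bar> \<le> B"
    and sym: "symmetric_kernel S m q" and n: "m \<le> n" "2 \<le> n"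
  shows "expectation (\<lambda>\<omega>. \<bar>ustat q n \<omega> - kernel_mean q - real m / real n * (\<Sum>i=1..n. hajek q (X i \<omega>))\<bar>)
    \<le> 2 * (real m + 1) * B * real (m choose 2) / sqrt (real (n choose 2))"
proof -
  define \<Psi> where "\<Psi> z = q z - kernel_mean q - (\<Sum>j=1..m. hajek q (z j))" for z
  have \<Psi>m [measurable]: "\<Psi> \<in> borel_measurable kernel_space"
  proof -
    have "(\<lambda>z. hajek q (z j)) \<in> borel_measurable kernel_space" if "j \<in> {1..m}" for j
      by (rule measurable_compose[OF measurable_component_singleton[OF that] measurable_hajek[OF q]])
    then show ?thesis
      unfolding \<Psi>_def[abs_def] by (intro borel_measurable_diff borel_measurable_sum q borel_measurable_const)
  qed
  have bound: "\<bar>\<Psi> z\<bar> \<le> 2 * (real m + 1) * B" for z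
  proof -
    have "\<bar>\<Sum>j=1..m. hajek q (z j)\<bar> \<le> (\<Sum>j=1..m. 2 * B)"
      by (rule order_trans[OF sum_abs]) (intro sum_mono abs_hajek_le qB)
    with qB[of z] abs_kernel_mean_le[of q B, OF qB] show ?thesis
      unfolding \<Psi>_def by (simp add: algebra_simps)
  qed
  have intq: "integrable P (\<lambda>\<omega>. q (Z \<omega>))" if "Z \<in> measurable P kernel_space" for Z
    by (rule integrable_bounded[OF measurable_compose[OF that q] qB])
  have inth: "integrable P (\<lambda>\<omega>. hajek q (X i \<omega>))" for i
    by (rule integrable_bounded[OF measurable_hajek_X[OF q] abs_hajek_le[OF qB]])
  have mean: "kernel_mean \<Psi> = 0"
  proof -
    have "kernel_mean \<Psi> = expectation (\<lambda>\<omega>. q (\<lambda>j\<in>{1..m}. X j \<omega>) - kernel_mean q - (\<Sum>j=1..m. hajek q (X j \<omega>)))"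
      unfolding kernel_mean_def[of \<Psi>] \<Psi>_def by (intro Bochner_Integration.integral_cong refl) simp
    also have "\<dots> = kernel_mean q - kernel_mean q - (\<Sum>j=1..m. expectation (\<lambda>\<omega>. hajek q (X j \<omega>)))"
      unfolding kernel_mean_def by (simp add: inth intq measurable_restrict prob_space)
    finally show ?thesis by (simp add: expectation_hajek[OF q qB])
  qed
  have degenerate: "expectation (\<lambda>\<omega>. \<Psi> (\<lambda>k\<in>{1..m}. if k = j then x else X (\<iota> k) \<omega>)) = 0"
    if \<iota>: "inj_on \<iota> {1..m}" and j: "j \<in> {1..m}" and x: "x \<in> space S" for \<iota> j x
  proof -
    have "\<Psi> (\<lambda>k\<in>{1..m}. if k = j then x else X (\<iota> k) \<omega>)
        = q (\<lambda>k\<in>{1..m}. if k = j then x else X (\<iota> k) \<omega>) - kernel_mean q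
          - (hajek q x + (\<Sum>k\<in>{1..m} - {j}. hajek q (X (\<iota> k) \<omega>)))" for \<omega>
      unfolding \<Psi>_def using j by (subst sum.remove[of "{1..m}" j]) auto
    then have "expectation (\<lambda>\<omega>. \<Psi> (\<lambda>k\<in>{1..m}. if k = j then x else X (\<iota> k) \<omega>))
        = expectation (\<lambda>\<omega>. q (\<lambda>k\<in>{1..m}. if k = j then x else X (\<iota> k) \<omega>) - kernel_mean q
          - (hajek q x + (\<Sum>k\<in>{1..m} - {j}. hajek q (X (\<iota> k) \<omega>))))"
      by simp
    also have "\<dots> = expectation (\<lambda>\<omega>. q (\<lambda>k\<in>{1..m}. if k = j then x else X (\<iota> k) \<omega>)) - kernel_mean q
          - (hajek q x + (\<Sum>k\<in>{1..m} - {j}. expectation (\<lambda>\<omega>. hajek q (X (\<iota> k) \<omega>))))"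
    proof -
      have "(\<lambda>\<omega>. \<lambda>k\<in>{1..m}. if k = j then x else X (\<iota> k) \<omega>) \<in> measurable P kernel_space"
        using x by (intro measurable_restrict) auto
      from intq[OF this] show ?thesis by (simp add: inth prob_space)
    qed
    also have "\<dots> = 0"
      by (simp add: expectation_hajek[OF q qB] expectation_section[OF q sym \<iota> j x])
    finally show ?thesis .
  qed
  have "n choose m > 0" using n by simp
  have eq: "ustat \<Psi> n \<omega> = ustat q n \<omega> - kernel_mean q - real m / real n * (\<Sum>i=1..n. hajek q (X i \<omega>))" for \<omega>
  proof -
    have "(\<Sum>\<iota>\<in>index_tuples m n. \<Psi> (tuple \<iota> \<omega>))
        = (\<Sum>\<iota>\<in>index_tuples m n. q (tuple \<iota> \<omega>) - kernel_mean q - (\<Sum>j=1..m. hajek q (X (\<iota> j) \<omega>)))"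
      unfolding \<Psi>_def by (intro sum.cong refl) simp
    also have "\<dots> = (\<Sum>\<iota>\<in>index_tuples m n. q (tuple \<iota> \<omega>)) - real (n choose m) * kernel_mean q
        - real (n choose m) * real m / real n * (\<Sum>i\<in>{1..n}. hajek q (X i \<omega>))"
      using sum_index_tuples_entries[OF m_pos n(1), of "\<lambda>i. hajek q (X i \<omega>)"]
      by (simp add: sum_subtractf card_index_tuples)
    finally show ?thesis
      using \<open>n choose m > 0\<close> by (simp add: ustat_def diff_divide_distrib)
  qed
  have "expectation (\<lambda>\<omega>. \<bar>ustat \<Psi> n \<omega>\<bar>)
      \<le> 2 * (real m + 1) * B * real (m choose 2) / sqrt (real (n choose 2))"
  proof (rule ustat_L1[OF \<Psi>m bound n])
    fix \<iota> \<kappa> assume *: "\<iota> \<in> index_tuples m n" "card (\<iota> ` {1..m} \<inter> \<kappa> ` {1..m}) < 2"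
    note \<iota> = index_tuplesD(1)[OF *(1)]
    show "expectation (\<lambda>\<omega>. \<Psi> (tuple \<iota> \<omega>) * \<Psi> (tuple \<kappa> \<omega>)) = 0"
    proof (cases "\<iota> ` {1..m} \<inter> \<kappa> ` {1..m} = {}")
      case True
      then show ?thesis by (rule orthogonal_disjoint[OF \<Psi>m bound mean \<iota>])
    next
      case False
      then have "card (\<iota> ` {1..m} \<inter> \<kappa> ` {1..m}) \<noteq> 0" by simp
      with *(2) have "card (\<iota> ` {1..m} \<inter> \<kappa> ` {1..m}) = 1" by linarith
      then obtain i where i: "\<iota> ` {1..m} \<inter> \<kappa> ` {1..m} = {i}" by (rule card_1_singletonE)
      then obtain j where "j \<in> {1..m}" "i = \<iota> j" by blast
      with i show ?thesis
        by (intro orthogonal_overlap_one[OF \<Psi>m bound degenerate[OF \<iota>] \<iota>]) auto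
    qed
  qed
  then show ?thesis by (simp add: eq)
qed

end

section \<open>The remainder of the trimmed sum\<close>

locale iid_kernel = iid_sample P S F X m
  for P :: "'w measure" and S F :: "'a measure" and X :: "nat \<Rightarrow> 'w \<Rightarrow> 'a" and m :: nat +
  fixes h :: "(nat \<Rightarrow> 'a) \<Rightarrow> real"
  assumes h_measurable: "h \<in> borel_measurable (PiM {1..m} (\<lambda>_. S))"
    and symmetric: "symmetric_kernel S m h"
begin

definition kval :: "'w \<Rightarrow> (nat \<Rightarrow> nat) \<Rightarrow> real" where
  "kval \<omega> \<iota> = h (tuple \<iota> \<omega>)"

abbreviation emp :: "(real \<Rightarrow> real) \<Rightarrow> nat \<Rightarrow> 'w \<Rightarrow> real" where
  "emp f \<equiv> ustat (\<lambda>z. f (h z))"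

abbreviation law :: "real measure" where
  "law \<equiv> kernel_law P X m h"

lemma emp_eq: "emp f n \<omega> = (\<Sum>\<iota>\<in>index_tuples m n. f (kval \<omega> \<iota>)) / real (n choose m)"
  by (simp add: ustat_def kval_def)

lemma kval_measurable [measurable]: "(\<lambda>\<omega>. kval \<omega> \<iota>) \<in> borel_measurable P"
  unfolding kval_def by (rule measurable_kernel_of_tuple[OF h_measurable])

lemma real_distribution_law: "real_distribution law"
  unfolding kernel_law_def
  using measurable_kernel_of_tuple[OF h_measurable, of "\<lambda>j. j"] by (rule real_distribution_distr)

lemma measurable_fun_of_kernel: "f \<in> borel_measurable borel \<Longrightarrow> (\<lambda>z. f (h z)) \<in> borel_measurable kernel_space"
  by (rule measurable_compose[OF h_measurable])

lemma kernel_mean_eq_law: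
  "f \<in> borel_measurable borel \<Longrightarrow> kernel_mean (\<lambda>z. f (h z)) = (LINT y|law. f y)"
  unfolding kernel_mean_def kernel_law_def
  by (rule integral_distr[symmetric, OF measurable_kernel_of_tuple[OF h_measurable]])

lemma kernel_mean_of_bool:
  assumes "A \<in> sets borel"
  shows "kernel_mean (\<lambda>z. of_bool (h z \<in> A)) = measure law A"
proof -
  interpret L: real_distribution law by (rule real_distribution_law)
  have eq: "(\<lambda>y. of_bool (y \<in> A)) = (indicator A :: real \<Rightarrow> real)" by (auto simp: indicator_def)
  have "kernel_mean (\<lambda>z. of_bool (h z \<in> A)) = (LINT y|law. of_bool (y \<in> A))"
    by (rule kernel_mean_eq_law) (use assms in \<open>simp add: eq\<close>)
  also have "\<dots> = measure law A"
    using assms by (simp add: eq)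
  finally show ?thesis .
qed

lemma kernel_mean_le: "kernel_mean (\<lambda>z. of_bool (h z \<le> c)) = cdf law c"
  using kernel_mean_of_bool[of "{..c}"] by (simp add: cdf_def)

lemma kernel_mean_less: "kernel_mean (\<lambda>z. of_bool (h z < c)) = measure law {..<c}"
  using kernel_mean_of_bool[of "{..<c}"] by simp

lemma symmetric_fun: "symmetric_kernel S m (\<lambda>z. f (h z))"
  using symmetric by (simp add: symmetric_kernel_def)

lemma emp_measurable: "f \<in> borel_measurable borel \<Longrightarrow> emp f n \<in> borel_measurable P"
  by (rule ustat_measurable[OF measurable_fun_of_kernel])

lemma measurable_of_bool_le [measurable]: "(\<lambda>y::real. of_bool (y \<le> c) :: real) \<in> borel_measurable borel"
proof -
  have "(\<lambda>y::real. of_bool (y \<le> c) :: real) = indicator {..c}" by (auto simp: indicator_def)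
  then show ?thesis by simp
qed

lemma measurable_of_bool_less [measurable]: "(\<lambda>y::real. of_bool (y < c) :: real) \<in> borel_measurable borel"
proof -
  have "(\<lambda>y::real. of_bool (y < c) :: real) = indicator {..<c}" by (auto simp: indicator_def)
  then show ?thesis by simp
qed

abbreviation emp_le :: "real \<Rightarrow> nat \<Rightarrow> 'w \<Rightarrow> real" where
  "emp_le c \<equiv> emp (\<lambda>y. of_bool (y \<le> c))"

abbreviation emp_less :: "real \<Rightarrow> nat \<Rightarrow> 'w \<Rightarrow> real" where
  "emp_less c \<equiv> emp (\<lambda>y. of_bool (y < c))"

lemmas emp_le_eq = emp_eq[of "\<lambda>y. of_bool (y \<le> c)" for c]
lemmas emp_less_eq = emp_eq[of "\<lambda>y. of_bool (y < c)" for c]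

lemma emp_le_measurable [measurable]: "emp_le c n \<in> borel_measurable P"
  by (rule emp_measurable) measurable

lemma emp_less_measurable [measurable]: "emp_less c n \<in> borel_measurable P"
  by (rule emp_measurable) measurable

lemma emp_L1_rate:
  assumes "f \<in> borel_measurable borel" "\<And>y. \<bar>f y\<bar> \<le> B" "m \<le> n"
  shows "expectation (\<lambda>\<omega>. \<bar>emp f n \<omega> - kernel_mean (\<lambda>z. f (h z))\<bar>) \<le> 2 * B * real m / sqrt (real n)"
  by (rule ustat_L1_rate[OF measurable_fun_of_kernel[OF assms(1)] assms(2,3)])

lemma emp_le_rate: "m \<le> n \<Longrightarrow> expectation (\<lambda>\<omega>. \<bar>emp_le c n \<omega> - cdf law c\<bar>) \<le> 2 * real m / sqrt (real n)"
  using emp_L1_rate[of "\<lambda>y. of_bool (y \<le> c)" 1 n] by (simp add: kernel_mean_le)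

lemma emp_less_rate: "m \<le> n \<Longrightarrow> expectation (\<lambda>\<omega>. \<bar>emp_less c n \<omega> - measure law {..<c}\<bar>) \<le> 2 * real m / sqrt (real n)"
  using emp_L1_rate[of "\<lambda>y. of_bool (y < c)" 1 n] by (simp add: kernel_mean_less)

lemma integrable_emp:
  assumes "f \<in> borel_measurable borel" "\<And>y. \<bar>f y\<bar> \<le> B"
  shows "integrable P (emp f n)"
  by (rule integrable_bounded[OF emp_measurable[OF assms(1)] abs_ustat_le[OF assms(2)]])

lemma integrable_emp_le [simp]: "integrable P (emp_le c n)"
  by (rule integrable_emp[where B = 1]) auto

lemma integrable_emp_less [simp]: "integrable P (emp_less c n)"
  by (rule integrable_emp[where B = 1]) auto

text \<open>The trimming proportion after rounding.\<close>

definition level :: "real \<Rightarrow> nat \<Rightarrow> real" where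
  "level \<gamma> n = real (trim_index m \<gamma> n) / real (n choose m)"

text \<open>Rounding \<open>\<gamma> N\<close> to an integer costs \<open>1 / N\<close>, which has to be negligible at scale \<open>1 / sqrt n\<close>.\<close>

lemma inverse_choose_le:
  assumes "m \<le> n"
  shows "1 / real (n choose m) \<le> real m / real n"
proof -
  have "m * (n choose m) = n * ((n - 1) choose (m - 1))"
    using times_binomial_minus1_eq[of m n] m_pos by simp
  moreover have "0 < (n - 1) choose (m - 1)" using assms by simp
  then have "n * 1 \<le> n * ((n - 1) choose (m - 1))" by (intro mult_left_mono) linarith+
  ultimately have "n \<le> m * (n choose m)" by simp
  then have "real n \<le> real m * real (n choose m)"
    by (simp only: of_nat_mult[symmetric] of_nat_le_iff)
  moreover have "real n > 0" using assms m_pos by simp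
  moreover have "real (n choose m) > 0" using assms by simp
  ultimately show ?thesis by (simp add: field_simps)
qed

lemma level_bounds:
  assumes "0 < \<gamma>" "m \<le> n"
  shows "\<bar>level \<gamma> n - \<gamma>\<bar> \<le> real m / real n" "level \<gamma> n \<le> \<gamma>" "0 \<le> level \<gamma> n"
proof -
  let ?N = "real (n choose m)"
  have N: "?N > 0" using assms by simp
  have "real (trim_index m \<gamma> n) = of_int \<lfloor>\<gamma> * ?N\<rfloor>"
    unfolding trim_index_def using assms N by (intro of_nat_nat) simp
  then have "real (trim_index m \<gamma> n) \<le> \<gamma> * ?N" "\<gamma> * ?N < real (trim_index m \<gamma> n) + 1"
    by linarith+
  then have *: "level \<gamma> n \<le> \<gamma>" "\<gamma> < level \<gamma> n + 1 / ?N"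
    using N by (simp_all add: level_def field_simps)
  then show "\<bar>level \<gamma> n - \<gamma>\<bar> \<le> real m / real n" "level \<gamma> n \<le> \<gamma>"
    using inverse_choose_le[OF assms(2)] by auto
  show "0 \<le> level \<gamma> n" by (simp add: level_def)
qed

lemma sqrt_level_tendsto:
  assumes "0 < \<gamma>"
  shows "(\<lambda>n. sqrt (real n) * \<bar>level \<gamma> n - \<gamma>\<bar>) \<longlonglongrightarrow> 0"
proof (rule tendsto_sandwich[OF _ _ tendsto_const])
  have "(\<lambda>n. real m / sqrt (real n)) \<longlonglongrightarrow> 0"
    by (intro real_tendsto_divide_at_top[OF tendsto_const] filterlim_compose[OF sqrt_at_top] filterlim_real_sequentially)
  then show "(\<lambda>n. real m / sqrt (real n)) \<longlonglongrightarrow> 0" .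
  show "\<forall>\<^sub>F n in sequentially. sqrt (real n) * \<bar>level \<gamma> n - \<gamma>\<bar> \<le> real m / sqrt (real n)"
    using eventually_ge_at_top[of m]
  proof eventually_elim
    case (elim n)
    then have n: "real n > 0" using m_pos by simp
    have "sqrt (real n) * \<bar>level \<gamma> n - \<gamma>\<bar> \<le> sqrt (real n) * (real m / real n)"
      using level_bounds(1)[OF assms elim] by (intro mult_left_mono) auto
    also have "\<dots> = real m / sqrt (real n)"
      using n by (simp add: field_simps)
    finally show ?case .
  qed
qed auto

lemma level_tendsto:
  assumes "0 < \<gamma>"
  shows "level \<gamma> \<longlonglongrightarrow> \<gamma>"
proof -
  have "(\<lambda>n. real m / real n) \<longlonglongrightarrow> 0"
    by (intro real_tendsto_divide_at_top[OF tendsto_const] filterlim_real_sequentially)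
  then have "(\<lambda>n. level \<gamma> n - \<gamma>) \<longlonglongrightarrow> 0"
    by (rule Lim_null_comparison[rotated])
       (use level_bounds(1)[OF assms] in \<open>auto intro: eventually_sequentiallyI[of m]\<close>)
  then show ?thesis by (rule LIM_zero_cancel)
qed

lemma trim_index_range:
  assumes "0 < \<gamma>" "\<gamma> < 1"
  shows "trim_index m \<gamma> n \<le> n choose m"
    and "\<forall>\<^sub>F n in sequentially. 1 \<le> trim_index m \<gamma> n"
proof -
  have "\<gamma> * real (n choose m) \<le> 1 * real (n choose m)"
    using assms by (intro mult_right_mono) auto
  then have "\<lfloor>\<gamma> * real (n choose m)\<rfloor> \<le> int (n choose m)" by linarith
  then show "trim_index m \<gamma> n \<le> n choose m" by (simp add: trim_index_def)
  show "\<forall>\<^sub>F n in sequentially. 1 \<le> trim_index m \<gamma> n"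
    using order_tendstoD(1)[OF level_tendsto[OF assms(1)] assms(1)]
  proof eventually_elim
    case (elim n)
    then show ?case by (cases "trim_index m \<gamma> n = 0") (simp_all add: level_def Suc_leI)
  qed
qed

definition lower_sum :: "real \<Rightarrow> nat \<Rightarrow> 'w \<Rightarrow> real" where
  "lower_sum \<gamma> n \<omega> = smallest_sum (kval \<omega>) (index_tuples m n) (trim_index m \<gamma> n) / real (n choose m)"

definition lower_hinge :: "real \<Rightarrow> real \<Rightarrow> nat \<Rightarrow> 'w \<Rightarrow> real" where
  "lower_hinge \<gamma> c n \<omega> = hinge_bound (kval \<omega>) (index_tuples m n) (trim_index m \<gamma> n) c / real (n choose m)"

lemma lower_sum_measurable [measurable]:
  assumes "0 < \<gamma>" "\<gamma> < 1"
  shows "lower_sum \<gamma> n \<in> borel_measurable P"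
  unfolding lower_sum_def[abs_def]
  by (intro borel_measurable_divide borel_measurable_const measurable_smallest_sum)
     (auto simp: card_index_tuples trim_index_range assms)

lemma lower_hinge_measurable [measurable]: "lower_hinge \<gamma> c n \<in> borel_measurable P"
  unfolding lower_hinge_def[abs_def] hinge_bound_def
  by (intro borel_measurable_divide borel_measurable_const borel_measurable_diff borel_measurable_sum
      borel_measurable_max kval_measurable)

lemma index_tuples_nonempty: "m \<le> n \<Longrightarrow> index_tuples m n \<noteq> {}"
  using card_index_tuples[of m n] by (metis card.empty binomial_eq_0_iff linorder_not_le)

lemma lower_hinge_slope:
  assumes "m \<le> n" "c \<le> c'"
  shows "lower_hinge \<gamma> c' n \<omega> - lower_hinge \<gamma> c n \<omega> \<le> (c' - c) * (level \<gamma> n - emp_le c n \<omega>)"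
    and "(c' - c) * (level \<gamma> n - emp_less c' n \<omega>) \<le> lower_hinge \<gamma> c' n \<omega> - lower_hinge \<gamma> c n \<omega>"
  using hinge_bound_slope[OF finite_index_tuples index_tuples_nonempty[OF assms(1)] assms(2),
      where Y = "kval \<omega>" and k = "trim_index m \<gamma> n"]
  unfolding lower_hinge_def level_def emp_le_eq emp_less_eq by (simp_all only: card_index_tuples)

lemma lower_hinge_le_lower_sum:
  assumes "0 < \<gamma>" "\<gamma> < 1"
  shows "lower_hinge \<gamma> c n \<omega> \<le> lower_sum \<gamma> n \<omega>"
  unfolding lower_hinge_def lower_sum_def
  by (intro divide_right_mono hinge_bound_le_smallest_sum) (auto simp: card_index_tuples trim_index_range assms)

text \<open>Almost surely no kernel value falls into an interval of measure zero.\<close>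

lemma emp_less_eq_emp_le:
  assumes "measure law {c<..<c'} = 0" "c < c'"
  shows "AE \<omega> in P. emp_less c' n \<omega> = emp_le c n \<omega>"
proof -
  have "expectation (\<lambda>\<omega>. of_bool (kval \<omega> \<iota> \<in> {c<..<c'})) = (0::real)" if "\<iota> \<in> index_tuples m n" for \<iota>
  proof -
    have eq: "(\<lambda>y. of_bool (y \<in> {c<..<c'})) = (indicator {c<..<c'} :: real \<Rightarrow> real)" by (auto simp: indicator_def)
    have "(\<lambda>y::real. of_bool (y \<in> {c<..<c'}) :: real) \<in> borel_measurable borel" unfolding eq by simp
    from expectation_tuple[OF index_tuplesD(1)[OF that] measurable_fun_of_kernel[OF this]]
    show ?thesis using kernel_mean_of_bool[of "{c<..<c'}"] assms(1) by (simp add: kval_def)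
  qed
  moreover have int: "integrable P (\<lambda>\<omega>. of_bool (kval \<omega> \<iota> \<in> {c<..<c'}) :: real)" for \<iota>
  proof (rule integrable_bounded[where B = 1])
    have "(\<lambda>\<omega>. of_bool (kval \<omega> \<iota> \<in> {c<..<c'}) :: real) = (\<lambda>\<omega>. indicator {c<..<c'} (kval \<omega> \<iota>))"
      by (auto simp: indicator_def)
    then show "(\<lambda>\<omega>. of_bool (kval \<omega> \<iota> \<in> {c<..<c'}) :: real) \<in> borel_measurable P" by simp
  qed simp
  ultimately have "AE \<omega> in P. of_bool (kval \<omega> \<iota> \<in> {c<..<c'}) = (0::real)" if "\<iota> \<in> index_tuples m n" for \<iota>
    using that integral_nonneg_eq_0_iff_AE[OF int[of \<iota>]] by simp
  then have "AE \<omega> in P. \<forall>\<iota>\<in>index_tuples m n. of_bool (kval \<omega> \<iota> \<in> {c<..<c'}) = (0::real)"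
    by (intro AE_finite_allI) auto
  then show ?thesis
  proof eventually_elim
    case (elim \<omega>)
    have "(\<Sum>\<iota>\<in>index_tuples m n. of_bool (kval \<omega> \<iota> < c')) = (\<Sum>\<iota>\<in>index_tuples m n. of_bool (kval \<omega> \<iota> \<le> c) :: real)"
    proof (rule sum.cong[OF refl])
      fix \<iota> assume "\<iota> \<in> index_tuples m n"
      with elim have "\<not> (c < kval \<omega> \<iota> \<and> kval \<omega> \<iota> < c')" by auto
      with \<open>c < c'\<close> show "of_bool (kval \<omega> \<iota> < c') = (of_bool (kval \<omega> \<iota> \<le> c) :: real)"
        by (cases "kval \<omega> \<iota> \<le> c") auto
    qed
    then show ?case by (simp only: emp_le_eq emp_less_eq)
  qed
qed

lemma emp_quantile_gap:
  assumes \<gamma>: "0 < \<gamma>" "\<gamma> < 1"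
  defines "l \<equiv> lower_quantile (cdf law) \<gamma>" and "u \<equiv> upper_quantile (cdf law) \<gamma>"
  shows "AE \<omega> in P. (u - l) * emp_less u n \<omega> = (u - l) * emp_le l n \<omega>"
proof (cases "l < u")
  case True
  interpret L: real_distribution law by (rule real_distribution_law)
  have "measure law {l<..<u} = 0"
    using True unfolding l_def u_def by (rule L.quantile_gap(3)[OF \<gamma>])
  from emp_less_eq_emp_le[OF this True, of n] show ?thesis by eventually_elim simp
next
  case False
  interpret L: real_distribution law by (rule real_distribution_law)
  from False have "u = l"
    using L.lower_quantile_le_upper_quantile[OF \<gamma>] unfolding l_def u_def by simp
  then show ?thesis by simp
qed

lemma lower_sum_upper_bound:
  assumes "m \<le> n" "1 \<le> trim_index m \<gamma> n" "0 < \<gamma>" "\<gamma> < 1" "l \<le> u" "d \<ge> 0"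
    and "emp_le (l - d) n \<omega> \<le> level \<gamma> n" "level \<gamma> n \<le> emp_le (u + d) n \<omega>"
  shows "lower_sum \<gamma> n \<omega> - lower_hinge \<gamma> l n \<omega>
    \<le> (u - l) * max 0 (level \<gamma> n - emp_le l n \<omega>)
      + d * (max 0 (level \<gamma> n - emp_le u n \<omega>) + max 0 (emp_less l n \<omega> - level \<gamma> n))"
proof -
  have k: "trim_index m \<gamma> n \<le> card (index_tuples m n)"
    using trim_index_range(1)[OF assms(3,4)] by (simp add: card_index_tuples)
  show ?thesis
    using smallest_sum_upper_bound[OF finite_index_tuples index_tuples_nonempty[OF assms(1)] assms(2) k assms(5,6),
        where Y = "kval \<omega>"] assms(7,8)
    unfolding lower_hinge_def lower_sum_def level_def emp_le_eq emp_less_eq by (simp only: card_index_tuples)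
qed

text \<open>The maximum of the concave function exceeds its value at the lower quantile by the increase along the gap
\<open>[l, u]\<close>, which is \<open>u - l\<close> times a non-negative part of order \<open>1 / sqrt n\<close>. From below this is a
comparison with the two points \<open>l\<close> and \<open>u\<close>. From above, for every \<open>d > 0\<close> the maximiser lies in
\<open>[l - d, u + d]\<close> with probability tending to one, by the law of large numbers at \<open>l - d\<close> and \<open>u + d\<close>,
and the additional increase outside \<open>[l, u]\<close> is at most \<open>d\<close> times a term of order \<open>1 / sqrt n\<close>.\<close>

lemma lower_sum_remainder:
  assumes \<gamma>: "0 < \<gamma>" "\<gamma> < 1"
  defines "l \<equiv> lower_quantile (cdf law) \<gamma>" and "u \<equiv> upper_quantile (cdf law) \<gamma>"
  shows "vanishes_in_prob (\<lambda>n \<omega>. sqrt (real n)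
    * (lower_sum \<gamma> n \<omega> - lower_hinge \<gamma> l n \<omega> - (u - l) * max 0 (\<gamma> - emp_le l n \<omega>)))"
proof -
  interpret L: real_distribution law by (rule real_distribution_law)
  define p where "p = level \<gamma>"
  define R where "R n \<omega> = lower_sum \<gamma> n \<omega> - lower_hinge \<gamma> l n \<omega> - (u - l) * max 0 (\<gamma> - emp_le l n \<omega>)" for n \<omega>
  have lu: "l \<le> u" unfolding l_def u_def by (rule L.lower_quantile_le_upper_quantile[OF \<gamma>])
  have Hu: "\<gamma> \<le> cdf law u" unfolding u_def by (rule L.cdf_upper_quantile[OF \<gamma>])
  have Hl: "measure law {..<l} \<le> \<gamma>" unfolding l_def by (rule L.measure_less_lower_quantile[OF \<gamma>])
  note [measurable] = lower_sum_measurable[OF \<gamma>]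
  have Rm: "R n \<in> borel_measurable P" for n
    unfolding R_def[abs_def] by measurable
  have gap: "AE \<omega> in P. (u - l) * emp_less u n \<omega> = (u - l) * emp_le l n \<omega>" for n
  unfolding l_def u_def by (rule emp_quantile_gap[OF \<gamma>])
  have lower: "AE \<omega> in P. - ((u - l) * \<bar>p n - \<gamma>\<bar>) \<le> R n \<omega>" if "m \<le> n" for n
    using gap[of n]
  proof eventually_elim
    case (elim \<omega>)
    let ?d = "lower_sum \<gamma> n \<omega> - lower_hinge \<gamma> l n \<omega>"
    have "0 \<le> ?d" using lower_hinge_le_lower_sum[OF \<gamma>] by simp
    moreover have "(u - l) * (p n - emp_le l n \<omega>) \<le> ?d"
      using lower_hinge_slope(2)[OF that lu, of \<gamma> \<omega>] lower_hinge_le_lower_sum[OF \<gamma>, of u n \<omega>] elim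
      by (simp add: p_def right_diff_distrib)
    ultimately have "(u - l) * max 0 (p n - emp_le l n \<omega>) \<le> ?d"
      using lu by (simp add: max_def)
    moreover have "(u - l) * max 0 (\<gamma> - emp_le l n \<omega>)
        \<le> (u - l) * (max 0 (p n - emp_le l n \<omega>) + \<bar>p n - \<gamma>\<bar>)"
      using lu by (intro mult_left_mono) auto
    ultimately show ?case unfolding R_def by (simp add: distrib_left)
  qed
  have upper: "R n \<omega> \<le> (u - l + 2 * d) * \<bar>p n - \<gamma>\<bar>
      + d * (\<bar>emp_le u n \<omega> - cdf law u\<bar> + \<bar>emp_less l n \<omega> - measure law {..<l}\<bar>)"
    if "m \<le> n" "1 \<le> trim_index m \<gamma> n" "d \<ge> 0" "emp_le (l - d) n \<omega> \<le> p n" "p n \<le> emp_le (u + d) n \<omega>" for n d \<omega>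
  proof -
    have "lower_sum \<gamma> n \<omega> - lower_hinge \<gamma> l n \<omega>
      \<le> (u - l) * max 0 (p n - emp_le l n \<omega>)
        + d * (max 0 (p n - emp_le u n \<omega>) + max 0 (emp_less l n \<omega> - p n))"
      unfolding p_def using that lu \<gamma> by (intro lower_sum_upper_bound) (auto simp: p_def)
    also have "(u - l) * max 0 (p n - emp_le l n \<omega>)
        \<le> (u - l) * (max 0 (\<gamma> - emp_le l n \<omega>) + \<bar>p n - \<gamma>\<bar>)"
      using lu by (intro mult_left_mono) auto
    also have "d * (max 0 (p n - emp_le u n \<omega>) + max 0 (emp_less l n \<omega> - p n))
        \<le> d * (2 * \<bar>p n - \<gamma>\<bar> + \<bar>emp_le u n \<omega> - cdf law u\<bar> + \<bar>emp_less l n \<omega> - measure law {..<l}\<bar>)"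
    proof (rule mult_left_mono)
      have "max 0 (p n - emp_le u n \<omega>) \<le> \<bar>p n - \<gamma>\<bar> + \<bar>emp_le u n \<omega> - cdf law u\<bar>"
        using Hu by linarith
      moreover have "max 0 (emp_less l n \<omega> - p n) \<le> \<bar>p n - \<gamma>\<bar> + \<bar>emp_less l n \<omega> - measure law {..<l}\<bar>"
        using Hl by linarith
      ultimately show "max 0 (p n - emp_le u n \<omega>) + max 0 (emp_less l n \<omega> - p n)
          \<le> 2 * \<bar>p n - \<gamma>\<bar> + \<bar>emp_le u n \<omega> - cdf law u\<bar> + \<bar>emp_less l n \<omega> - measure law {..<l}\<bar>"
        by linarith
    qed (rule \<open>d \<ge> 0\<close>)
    finally show ?thesis unfolding R_def by (simp add: algebra_simps)
  qed
  have key: "\<exists>a. a \<longlonglongrightarrow> 0 \<and> (\<forall>\<^sub>F n in sequentially. expectation (\<lambda>\<omega>. min 1 \<bar>sqrt (real n) * R n \<omega>\<bar>) \<le> a n + 4 * real m * d)"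
    if d: "d > 0" for d
  proof -
    \<comment> \<open>Half the distance of the distribution function from \<open>\<gamma>\<close>; the other half absorbs the rounding of the level.\<close>
    define \<eta> where "\<eta> = (\<gamma> - cdf law (l - d)) / 2"
    define \<zeta> where "\<zeta> = (cdf law (u + d) - \<gamma>) / 2"
    have \<eta>: "\<eta> > 0" unfolding \<eta>_def l_def using d L.cdf_below_lower_quantile[OF \<gamma>, of "l - d"] by (simp add: l_def)
    have \<zeta>: "\<zeta> > 0" unfolding \<zeta>_def u_def using d L.cdf_above_upper_quantile[OF \<gamma>, of "u + d"] by (simp add: u_def)
    define W where "W n \<omega> = \<bar>emp_le (l - d) n \<omega> - cdf law (l - d)\<bar> / \<eta>
        + \<bar>emp_le (u + d) n \<omega> - cdf law (u + d)\<bar> / \<zeta>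
        + (u - l + 2 * d) * (sqrt (real n) * \<bar>p n - \<gamma>\<bar>)
        + d * sqrt (real n) * (\<bar>emp_le u n \<omega> - cdf law u\<bar> + \<bar>emp_less l n \<omega> - measure law {..<l}\<bar>)" for n \<omega>
    define a where "a n = 2 * real m / sqrt (real n) / \<eta> + 2 * real m / sqrt (real n) / \<zeta>
        + (u - l + 2 * d) * (sqrt (real n) * \<bar>p n - \<gamma>\<bar>)" for n
    have "(\<lambda>n. 2 * real m / sqrt (real n)) \<longlonglongrightarrow> 0"
      by (intro real_tendsto_divide_at_top[OF tendsto_const] filterlim_compose[OF sqrt_at_top] filterlim_real_sequentially)
    then have "a \<longlonglongrightarrow> 0 / \<eta> + 0 / \<zeta> + (u - l + 2 * d) * 0"
      unfolding a_def[abs_def] p_def using \<eta> \<zeta>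
      by (intro tendsto_add tendsto_divide tendsto_const tendsto_mult sqrt_level_tendsto \<gamma>) auto
    then have "a \<longlonglongrightarrow> 0" by simp
    moreover have "\<forall>\<^sub>F n in sequentially. expectation (\<lambda>\<omega>. min 1 \<bar>sqrt (real n) * R n \<omega>\<bar>) \<le> a n + 4 * real m * d"
    proof -
      have "\<forall>\<^sub>F n in sequentially. \<gamma> - \<eta> < p n"
        unfolding p_def by (rule order_tendstoD(1)[OF level_tendsto[OF \<gamma>(1)]]) (use \<eta> in simp)
      then show ?thesis
        using trim_index_range(2)[OF \<gamma>] eventually_ge_at_top[of m]
      proof eventually_elim
        case (elim n)
        have n: "real n > 0" using m_pos elim(3) by simp
        have bound: "AE \<omega> in P. min 1 \<bar>sqrt (real n) * R n \<omega>\<bar> \<le> W n \<omega>"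
          using lower[OF elim(3)]
        proof eventually_elim
          case (elim \<omega>)
          define w1 where "w1 = \<bar>emp_le (l - d) n \<omega> - cdf law (l - d)\<bar> / \<eta>"
          define w2 where "w2 = \<bar>emp_le (u + d) n \<omega> - cdf law (u + d)\<bar> / \<zeta>"
          define w3 where "w3 = (u - l + 2 * d) * (sqrt (real n) * \<bar>p n - \<gamma>\<bar>)"
          define w4 where "w4 = d * sqrt (real n) * (\<bar>emp_le u n \<omega> - cdf law u\<bar> + \<bar>emp_less l n \<omega> - measure law {..<l}\<bar>)"
          have W: "W n \<omega> = w1 + w2 + w3 + w4" by (simp add: W_def w1_def w2_def w3_def w4_def)
          have nn: "0 \<le> w1" "0 \<le> w2" "0 \<le> w3" "0 \<le> w4"
            using \<eta> \<zeta> lu d by (auto simp: w1_def w2_def w3_def w4_def)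
          \<comment> \<open>In the first two cases a deviation from the law of large numbers makes \<open>W n \<omega> \<ge> 1\<close>.\<close>
          consider "p n < emp_le (l - d) n \<omega>" | "emp_le (u + d) n \<omega> < p n"
            | "emp_le (l - d) n \<omega> \<le> p n" "p n \<le> emp_le (u + d) n \<omega>" by linarith
          then show ?case
          proof cases
            case 1
            have "(\<gamma> - c) / 2 \<le> \<bar>e - c\<bar>" if "p n < e" "\<gamma> - (\<gamma> - c) / 2 < p n" for e c :: real
              using that abs_ge_self[of "e - c"] by (simp add: field_simps)
            then have "\<eta> \<le> \<bar>emp_le (l - d) n \<omega> - cdf law (l - d)\<bar>"
              using 1 \<open>\<gamma> - \<eta> < p n\<close> unfolding \<eta>_def by blast
            then have "1 \<le> w1" using \<eta> by (simp add: w1_def)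
            with nn W show ?thesis by linarith
          next
            case 2
            have "p n \<le> \<gamma>" unfolding p_def by (rule level_bounds(2)[OF \<gamma>(1) \<open>m \<le> n\<close>])
            moreover have "(c - \<gamma>) / 2 \<le> \<bar>e - c\<bar>" if "p n \<le> \<gamma>" "e < p n" "0 < (c - \<gamma>) / 2" for e c :: real
              using that abs_ge_minus_self[of "e - c"] by (simp add: field_simps)
            ultimately have "\<zeta> \<le> \<bar>emp_le (u + d) n \<omega> - cdf law (u + d)\<bar>"
              using 2 \<zeta> unfolding \<zeta>_def by blast
            then have "1 \<le> w2" using \<zeta> by (simp add: w2_def)
            with nn W show ?thesis by linarith
          next
            case 3
            let ?b = "(u - l + 2 * d) * \<bar>p n - \<gamma>\<bar>
              + d * (\<bar>emp_le u n \<omega> - cdf law u\<bar> + \<bar>emp_less l n \<omega> - measure law {..<l}\<bar>)"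
            have up: "R n \<omega> \<le> ?b"
              using upper[OF \<open>m \<le> n\<close> \<open>1 \<le> trim_index m \<gamma> n\<close> _ 3] d by simp
            have "(u - l) * \<bar>p n - \<gamma>\<bar> \<le> (u - l + 2 * d) * \<bar>p n - \<gamma>\<bar>"
              using d by (intro mult_right_mono) auto
            moreover have "0 \<le> d * (\<bar>emp_le u n \<omega> - cdf law u\<bar> + \<bar>emp_less l n \<omega> - measure law {..<l}\<bar>)"
              using d by simp
            ultimately have "\<bar>R n \<omega>\<bar> \<le> ?b" using elim up by linarith
            then have "\<bar>sqrt (real n) * R n \<omega>\<bar> \<le> sqrt (real n) * ?b"
              by (simp add: abs_mult mult_left_mono)
            also have "\<dots> = w3 + w4" by (simp add: w3_def w4_def algebra_simps)
            finally show ?thesis using nn W by linarith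
          qed
        qed
        have int: "integrable P (W n)"
          unfolding W_def[abs_def] by simp
        have "expectation (\<lambda>\<omega>. min 1 \<bar>sqrt (real n) * R n \<omega>\<bar>) \<le> expectation (W n)"
          by (intro integral_mono_AE bound int integrable_min_1_abs borel_measurable_times borel_measurable_const Rm)
        also have "\<dots> = expectation (\<lambda>\<omega>. \<bar>emp_le (l - d) n \<omega> - cdf law (l - d)\<bar>) / \<eta>
            + expectation (\<lambda>\<omega>. \<bar>emp_le (u + d) n \<omega> - cdf law (u + d)\<bar>) / \<zeta>
            + (u - l + 2 * d) * (sqrt (real n) * \<bar>p n - \<gamma>\<bar>)
            + d * sqrt (real n) * (expectation (\<lambda>\<omega>. \<bar>emp_le u n \<omega> - cdf law u\<bar>)
              + expectation (\<lambda>\<omega>. \<bar>emp_less l n \<omega> - measure law {..<l}\<bar>))"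
          unfolding W_def[abs_def] by (simp add: prob_space)
        also have "\<dots> \<le> 2 * real m / sqrt (real n) / \<eta> + 2 * real m / sqrt (real n) / \<zeta>
            + (u - l + 2 * d) * (sqrt (real n) * \<bar>p n - \<gamma>\<bar>)
            + d * sqrt (real n) * (2 * real m / sqrt (real n) + 2 * real m / sqrt (real n))"
          using elim(3) d \<eta> \<zeta> lu
          by (intro add_mono divide_right_mono mult_left_mono emp_le_rate emp_less_rate) auto
        also have "\<dots> = a n + 4 * real m * d"
          using n by (simp add: a_def)
        finally show ?case .
      qed
    qed
    ultimately show ?thesis by blast
  qed
  have "(\<lambda>n. expectation (\<lambda>\<omega>. min 1 \<bar>sqrt (real n) * R n \<omega>\<bar>)) \<longlonglongrightarrow> 0"
  proof (rule order_tendstoI)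
    fix e :: real assume "e < 0"
    have "0 \<le> expectation (\<lambda>\<omega>. min 1 \<bar>sqrt (real n) * R n \<omega>\<bar>)" for n by simp
    with \<open>e < 0\<close> show "\<forall>\<^sub>F n in sequentially. e < expectation (\<lambda>\<omega>. min 1 \<bar>sqrt (real n) * R n \<omega>\<bar>)"
      by (intro always_eventually allI) (rule less_le_trans)
  next
    fix e :: real assume "0 < e"
    \<comment> \<open>This makes the contribution \<open>4 m d\<close> of the neighbourhood equal to \<open>e / 2\<close>.\<close>
    define d where "d = e / (8 * real m)"
    have d: "d > 0" "4 * real m * d = e / 2" using \<open>0 < e\<close> m_pos by (simp_all add: d_def)
    from key[OF d(1)] obtain a where a: "a \<longlonglongrightarrow> 0"
      and le: "\<forall>\<^sub>F n in sequentially. expectation (\<lambda>\<omega>. min 1 \<bar>sqrt (real n) * R n \<omega>\<bar>) \<le> a n + 4 * real m * d"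
      by blast
    have "\<forall>\<^sub>F n in sequentially. a n < e / 2" by (rule order_tendstoD(2)[OF a]) (use \<open>0 < e\<close> in simp)
    with le show "\<forall>\<^sub>F n in sequentially. expectation (\<lambda>\<omega>. min 1 \<bar>sqrt (real n) * R n \<omega>\<bar>) < e"
      by eventually_elim (use d in linarith)
  qed
  then show ?thesis
    unfolding vanishes_in_prob_def R_def[symmetric]
    by (intro conjI allI borel_measurable_times borel_measurable_const Rm)
qed

end

section \<open>Linearisation of the trimmed U-statistic\<close>

context iid_kernel
begin

lemma theta_eq: "theta P X m h \<alpha> \<beta> = (LINT y|law. trim_fun (cdf law) \<alpha> \<beta> y)"
  by (simp add: theta_def kernel_cdf_def)

lemma trim_fun_eq:
  "trim_fun H \<alpha> \<beta> y = \<beta> * lower_quantile H \<beta> - \<alpha> * upper_quantile H \<alpha>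
    - max 0 (lower_quantile H \<beta> - y) + max 0 (upper_quantile H \<alpha> - y)"
  by (auto simp: trim_fun_def Let_def max_def)

lemma trim_fun_measurable: "trim_fun H \<alpha> \<beta> \<in> borel_measurable borel"
  unfolding trim_fun_eq[abs_def] by measurable

lemma trim_fun_bounded:
  "\<bar>trim_fun H \<alpha> \<beta> y\<bar> \<le> \<bar>\<beta> * lower_quantile H \<beta> - \<alpha> * upper_quantile H \<alpha>\<bar>
    + \<bar>lower_quantile H \<beta> - upper_quantile H \<alpha>\<bar>"
  unfolding trim_fun_eq by (simp add: max_def abs_if)

lemma kernel_mean_trim_fun:
  "kernel_mean (\<lambda>z. trim_fun (cdf law) \<alpha> \<beta> (h z)) = theta P X m h \<alpha> \<beta>"
  unfolding theta_eq by (rule kernel_mean_eq_law[OF trim_fun_measurable])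

lemma proj_g_eq_hajek: "proj_g P X m h \<alpha> \<beta> x = hajek (\<lambda>z. trim_fun (cdf law) \<alpha> \<beta> (h z)) x"
  by (simp add: proj_g_def hajek_def kernel_section_def kernel_mean_trim_fun kernel_cdf_def)

lemma proj_lower_eq_hajek:
  "proj_lower P X m h \<alpha> x = hajek (\<lambda>z. of_bool (h z < upper_quantile (cdf law) \<alpha>)) x"
proof -
  interpret L: real_distribution law by (rule real_distribution_law)
  have "Lim (at_left c) (cdf law) = measure law {..<c}" for c
    by (rule tendsto_Lim[OF trivial_limit_at_left_real L.cdf_at_left])
  then show ?thesis
    by (simp add: proj_lower_def hajek_def kernel_section_def kernel_mean_less kernel_cdf_def Let_def)
qed

lemma proj_upper_eq_hajek:
  "proj_upper P X m h \<beta> x = hajek (\<lambda>z. of_bool (h z \<le> lower_quantile (cdf law) \<beta>)) x"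
  by (simp add: proj_upper_def hajek_def kernel_section_def kernel_mean_le kernel_cdf_def Let_def)

lemma trimmed_U_eq_smallest_sum:
  assumes "0 < \<alpha>" "\<alpha> < \<beta>" "\<beta> < 1"
  shows "trimmed_U X m h \<alpha> \<beta> n \<omega>
    = (smallest_sum (kval \<omega>) (index_tuples m n) (trim_index m \<beta> n)
        - smallest_sum (kval \<omega>) (index_tuples m n) (trim_index m \<alpha> n))
      / (real (trim_index m \<beta> n) - real (trim_index m \<alpha> n))"
proof -
  have "trim_index m \<alpha> n \<le> trim_index m \<beta> n"
    unfolding trim_index_def using assms by (intro nat_mono floor_mono mult_right_mono) auto
  moreover have "trim_index m \<beta> n \<le> card (index_tuples m n)"
    using trim_index_range(1)[of \<beta> n] assms by (simp add: card_index_tuples)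
  ultimately show ?thesis
    unfolding trimmed_U_def ordered_kernel_values_def
    using sum_ordered_values_eq_smallest_sum[of "trim_index m \<alpha> n" "trim_index m \<beta> n" "index_tuples m n" "kval \<omega>"]
    by (simp add: kval_def[abs_def])
qed

lemma trimmed_U_measurable:
  assumes "0 < \<alpha>" "\<alpha> < \<beta>" "\<beta> < 1"
  shows "trimmed_U X m h \<alpha> \<beta> n \<in> borel_measurable P"
proof -
  have "trim_index m \<gamma> n \<le> card (index_tuples m n)" if "\<gamma> \<in> {\<alpha>, \<beta>}" for \<gamma>
    using trim_index_range(1)[of \<gamma> n] that assms by (auto simp: card_index_tuples)
  then have "(\<lambda>\<omega>. smallest_sum (kval \<omega>) (index_tuples m n) (trim_index m \<gamma> n)) \<in> borel_measurable P"
    if "\<gamma> \<in> {\<alpha>, \<beta>}" for \<gamma>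
    using that by (intro measurable_smallest_sum) auto
  then show ?thesis
    unfolding trimmed_U_eq_smallest_sum[OF assms, abs_def]
    by (intro borel_measurable_divide borel_measurable_diff borel_measurable_const) auto
qed

lemma trimmed_U_eq_lower_sum:
  assumes "0 < \<alpha>" "\<alpha> < \<beta>" "\<beta> < 1" "m \<le> n"
  shows "trimmed_U X m h \<alpha> \<beta> n \<omega> = (lower_sum \<beta> n \<omega> - lower_sum \<alpha> n \<omega>) / (level \<beta> n - level \<alpha> n)"
proof -
  have "real (n choose m) > 0" using assms(4) by simp
  then show ?thesis
    unfolding trimmed_U_eq_smallest_sum[OF assms(1-3)] lower_sum_def level_def
    by (simp add: diff_divide_distrib[symmetric])
qed

text \<open>The function integrated in the centring constant arises here: it is the difference of the
two hinge functions at the inner quantiles.\<close>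

lemma lower_hinge_difference:
  fixes \<alpha> \<beta> :: real
  assumes "m \<le> n"
  defines "b \<equiv> lower_quantile (cdf law) \<beta>" and "a \<equiv> upper_quantile (cdf law) \<alpha>"
  shows "lower_hinge \<beta> b n \<omega> - lower_hinge \<alpha> a n \<omega>
    = emp (trim_fun (cdf law) \<alpha> \<beta>) n \<omega> + (level \<beta> n - \<beta>) * b - (level \<alpha> n - \<alpha>) * a"
proof -
  let ?N = "real (n choose m)" and ?I = "index_tuples m n"
  have N: "?N > 0" using assms(1) by simp
  have "(\<Sum>\<iota>\<in>?I. trim_fun (cdf law) \<alpha> \<beta> (kval \<omega> \<iota>))
      = ?N * (\<beta> * b - \<alpha> * a) - (\<Sum>\<iota>\<in>?I. max 0 (b - kval \<omega> \<iota>)) + (\<Sum>\<iota>\<in>?I. max 0 (a - kval \<omega> \<iota>))"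
    unfolding trim_fun_eq a_def[symmetric] b_def[symmetric]
    by (simp add: sum.distrib sum_subtractf card_index_tuples right_diff_distrib)
  then have "emp (trim_fun (cdf law) \<alpha> \<beta>) n \<omega>
      = \<beta> * b - \<alpha> * a - (\<Sum>\<iota>\<in>?I. max 0 (b - kval \<omega> \<iota>)) / ?N + (\<Sum>\<iota>\<in>?I. max 0 (a - kval \<omega> \<iota>)) / ?N"
    using N by (simp add: emp_eq add_divide_distrib diff_divide_distrib)
  then show ?thesis
    unfolding lower_hinge_def hinge_bound_def level_def by (simp add: diff_divide_distrib left_diff_distrib)
qed

text \<open>Without values in the gap the concave function is exactly linear on it, so its values at the
lower and the upper quantile can be exchanged.\<close>

lemma lower_hinge_gap:
  assumes \<gamma>: "0 < \<gamma>" "\<gamma> < 1" and "m \<le> n"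
  defines "l \<equiv> lower_quantile (cdf law) \<gamma>" and "u \<equiv> upper_quantile (cdf law) \<gamma>"
  shows "AE \<omega> in P. (u - l) * emp_less u n \<omega> = (u - l) * emp_le l n \<omega>
    \<and> lower_hinge \<gamma> u n \<omega> - lower_hinge \<gamma> l n \<omega> = (u - l) * (level \<gamma> n - emp_less u n \<omega>)"
proof -
  interpret L: real_distribution law by (rule real_distribution_law)
  have lu: "l \<le> u" unfolding l_def u_def by (rule L.lower_quantile_le_upper_quantile[OF \<gamma>])
  have "AE \<omega> in P. (u - l) * emp_less u n \<omega> = (u - l) * emp_le l n \<omega>"
    unfolding l_def u_def by (rule emp_quantile_gap[OF \<gamma>])
  then show ?thesis
  proof eventually_elim
    case (elim \<omega>)
    with lower_hinge_slope[OF \<open>m \<le> n\<close> lu, of \<gamma> \<omega>] show ?case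
      unfolding right_diff_distrib by (intro conjI) linarith+
  qed
qed

text \<open>The part of the trimmed sum that survives at scale \<open>1 / sqrt n\<close>. Despite its non-linear terms it
depends on the sample only through three U-statistics with bounded kernels.\<close>

definition linear_part :: "real \<Rightarrow> real \<Rightarrow> nat \<Rightarrow> 'w \<Rightarrow> real" where
  "linear_part \<alpha> \<beta> n \<omega> = emp (trim_fun (cdf law) \<alpha> \<beta>) n \<omega>
     - quantile_jump (cdf law) \<alpha> * max 0 (emp_less (upper_quantile (cdf law) \<alpha>) n \<omega> - \<alpha>)
     + quantile_jump (cdf law) \<beta> * max 0 (\<beta> - emp_le (lower_quantile (cdf law) \<beta>) n \<omega>)"

lemma linear_part_measurable [measurable]: "linear_part \<alpha> \<beta> n \<in> borel_measurable P"
proof -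
  note [measurable] = emp_measurable[OF trim_fun_measurable]
  show ?thesis unfolding linear_part_def[abs_def] by measurable
qed

lemma linear_part_bounded:
  assumes "0 < \<alpha>" "\<alpha> < \<beta>" "\<beta> < 1"
  obtains C where "\<And>n \<omega>. \<bar>linear_part \<alpha> \<beta> n \<omega>\<bar> \<le> C"
proof
  fix n \<omega>
  let ?B = "\<bar>\<beta> * lower_quantile (cdf law) \<beta> - \<alpha> * upper_quantile (cdf law) \<alpha>\<bar>
    + \<bar>lower_quantile (cdf law) \<beta> - upper_quantile (cdf law) \<alpha>\<bar>"
  have 1: "\<bar>emp (trim_fun (cdf law) \<alpha> \<beta>) n \<omega>\<bar> \<le> ?B"
    by (rule abs_ustat_le) (rule trim_fun_bounded)
  have unit: "\<bar>emp_less c n \<omega>\<bar> \<le> 1" "\<bar>emp_le c n \<omega>\<bar> \<le> 1" for c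
    by (rule abs_ustat_le; simp)+
  have "\<bar>max 0 (x - \<alpha>)\<bar> \<le> 2" "\<bar>max 0 (\<beta> - x)\<bar> \<le> 2" if "\<bar>x\<bar> \<le> 1" for x
    using that assms by (auto simp: max_def abs_le_iff)
  from this(1)[OF unit(1)] this(2)[OF unit(2)]
  have "\<bar>max 0 (emp_less c n \<omega> - \<alpha>)\<bar> \<le> 2" "\<bar>max 0 (\<beta> - emp_le c n \<omega>)\<bar> \<le> 2" for c .
  then have 2: "\<bar>quantile_jump (cdf law) \<alpha> * max 0 (emp_less c n \<omega> - \<alpha>)\<bar> \<le> \<bar>quantile_jump (cdf law) \<alpha>\<bar> * 2"
    "\<bar>quantile_jump (cdf law) \<beta> * max 0 (\<beta> - emp_le c n \<omega>)\<bar> \<le> \<bar>quantile_jump (cdf law) \<beta>\<bar> * 2" for c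
    by (auto simp only: abs_mult intro!: mult_left_mono)
  show "\<bar>linear_part \<alpha> \<beta> n \<omega>\<bar> \<le> ?B + \<bar>quantile_jump (cdf law) \<alpha>\<bar> * 2 + \<bar>quantile_jump (cdf law) \<beta>\<bar> * 2"
  proof -
    have "\<bar>x - y + z\<bar> \<le> X + Y + Z" if "\<bar>x\<bar> \<le> X" "\<bar>y\<bar> \<le> Y" "\<bar>z\<bar> \<le> Z" for x y z X Y Z :: real
      using that by linarith
    from this[OF 1 2] show ?thesis unfolding linear_part_def .
  qed
qed

text \<open>At level \<open>\<beta>\<close> the expansion of the trimmed sum at the lower quantile is used as it stands. At level \<open>\<alpha>\<close> it is moved to the upper
quantile, by linearity along the gap; since \<open>max 0 x - x = max 0 (- x)\<close>, this replaces the
positive part of \<open>\<alpha> - H\<^sub>N\<close> by that of \<open>H\<^sub>N - \<alpha>\<close>.\<close>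

lemma lower_sums_linear_part:
  assumes "0 < \<alpha>" "\<alpha> < \<beta>" "\<beta> < 1"
  shows "vanishes_in_prob (\<lambda>n \<omega>. sqrt (real n) * (lower_sum \<beta> n \<omega> - lower_sum \<alpha> n \<omega> - linear_part \<alpha> \<beta> n \<omega>))"
proof -
  have \<alpha>: "0 < \<alpha>" "\<alpha> < 1" and \<beta>: "0 < \<beta>" "\<beta> < 1" using assms by auto
  define a where "a = upper_quantile (cdf law) \<alpha>"
  define b where "b = lower_quantile (cdf law) \<beta>"
  define l where "l = lower_quantile (cdf law) \<alpha>"
  define u where "u = upper_quantile (cdf law) \<beta>"
  define R\<beta> where "R\<beta> n \<omega> = lower_sum \<beta> n \<omega> - lower_hinge \<beta> b n \<omega> - (u - b) * max 0 (\<beta> - emp_le b n \<omega>)" for n \<omega>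
  define R\<alpha> where "R\<alpha> n \<omega> = lower_sum \<alpha> n \<omega> - lower_hinge \<alpha> l n \<omega> - (a - l) * max 0 (\<alpha> - emp_le l n \<omega>)" for n \<omega>
  define e where "e n = (level \<beta> n - \<beta>) * b - (level \<alpha> n - \<alpha>) * l" for n
  note [measurable] = lower_sum_measurable[OF \<alpha>] lower_sum_measurable[OF \<beta>]
  have "vanishes_in_prob (\<lambda>n \<omega>. sqrt (real n) * R\<beta> n \<omega>)"
    using lower_sum_remainder[OF \<beta>] by (simp add: R\<beta>_def u_def b_def)
  moreover have "vanishes_in_prob (\<lambda>n \<omega>. (- 1) * (sqrt (real n) * R\<alpha> n \<omega>))"
    using lower_sum_remainder[OF \<alpha>] by (intro vanishes_in_prob_cmult) (simp add: R\<alpha>_def a_def l_def)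
  moreover have "vanishes_in_prob (\<lambda>n \<omega>. sqrt (real n) * e n)"
  proof (rule vanishes_in_prob_const, rule Lim_null_comparison)
    have "(\<lambda>n. sqrt (real n) * \<bar>level \<beta> n - \<beta>\<bar> * \<bar>b\<bar> + sqrt (real n) * \<bar>level \<alpha> n - \<alpha>\<bar> * \<bar>l\<bar>) \<longlonglongrightarrow> 0 * \<bar>b\<bar> + 0 * \<bar>l\<bar>"
      by (intro tendsto_intros sqrt_level_tendsto \<alpha> \<beta>)
    then show "(\<lambda>n. sqrt (real n) * \<bar>level \<beta> n - \<beta>\<bar> * \<bar>b\<bar> + sqrt (real n) * \<bar>level \<alpha> n - \<alpha>\<bar> * \<bar>l\<bar>) \<longlonglongrightarrow> 0"
      by simp
    have "\<bar>e n\<bar> \<le> \<bar>level \<beta> n - \<beta>\<bar> * \<bar>b\<bar> + \<bar>level \<alpha> n - \<alpha>\<bar> * \<bar>l\<bar>" for n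
      unfolding e_def abs_mult[symmetric] by (rule abs_triangle_ineq4)
    from mult_left_mono[OF this, of "sqrt (real n)" for n]
    show "\<forall>\<^sub>F n in sequentially. norm (sqrt (real n) * e n)
        \<le> sqrt (real n) * \<bar>level \<beta> n - \<beta>\<bar> * \<bar>b\<bar> + sqrt (real n) * \<bar>level \<alpha> n - \<alpha>\<bar> * \<bar>l\<bar>"
      by (intro always_eventually) (simp add: abs_mult distrib_left mult.assoc)
  qed
  ultimately have V: "vanishes_in_prob (\<lambda>n \<omega>. sqrt (real n) * R\<beta> n \<omega> + (- 1) * (sqrt (real n) * R\<alpha> n \<omega>) + sqrt (real n) * e n)"
    by (intro vanishes_in_prob_add)
  show ?thesis
  proof (rule vanishes_in_prob_bound[OF V, where c = 1])
    show "(\<lambda>\<omega>. sqrt (real n) * (lower_sum \<beta> n \<omega> - lower_sum \<alpha> n \<omega> - linear_part \<alpha> \<beta> n \<omega>)) \<in> borel_measurable P" for n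
      by measurable
    show "\<forall>\<^sub>F n in sequentially. AE \<omega> in P. \<bar>sqrt (real n) * (lower_sum \<beta> n \<omega> - lower_sum \<alpha> n \<omega> - linear_part \<alpha> \<beta> n \<omega>)\<bar>
        \<le> 1 * \<bar>sqrt (real n) * R\<beta> n \<omega> + (- 1) * (sqrt (real n) * R\<alpha> n \<omega>) + sqrt (real n) * e n\<bar>"
      using eventually_ge_at_top[of m]
    proof eventually_elim
      case (elim n)
      from lower_hinge_gap[OF \<alpha> elim] show ?case
        unfolding a_def[symmetric] l_def[symmetric]
      proof eventually_elim
        case (elim \<omega>)
        define F where "F = emp_less a n \<omega>"
        have jump: "(a - l) * max 0 (\<alpha> - emp_le l n \<omega>) = (a - l) * max 0 (\<alpha> - F)"
          using elim by (cases "a = l") (auto simp: F_def)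
        have part: "max 0 (\<alpha> - F) = \<alpha> - F + max 0 (F - \<alpha>)" by (simp add: max_def)
        have hinge: "lower_hinge \<alpha> l n \<omega> = lower_hinge \<alpha> a n \<omega> - (a - l) * (level \<alpha> n - F)"
          using elim by (simp add: F_def)
        have dif: "lower_hinge \<beta> b n \<omega> - lower_hinge \<alpha> a n \<omega>
            = emp (trim_fun (cdf law) \<alpha> \<beta>) n \<omega> + (level \<beta> n - \<beta>) * b - (level \<alpha> n - \<alpha>) * a"
          unfolding a_def b_def by (rule lower_hinge_difference[OF \<open>m \<le> n\<close>])
        have "linear_part \<alpha> \<beta> n \<omega> = emp (trim_fun (cdf law) \<alpha> \<beta>) n \<omega> - (a - l) * max 0 (F - \<alpha>)
            + (u - b) * max 0 (\<beta> - emp_le b n \<omega>)"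
          by (simp add: linear_part_def quantile_jump_def a_def b_def l_def u_def F_def)
        then have "lower_sum \<beta> n \<omega> - lower_sum \<alpha> n \<omega> - linear_part \<alpha> \<beta> n \<omega> = R\<beta> n \<omega> - R\<alpha> n \<omega> + e n"
          using dif unfolding R\<beta>_def R\<alpha>_def e_def jump part hinge by (simp add: algebra_simps)
        then have "sqrt (real n) * (lower_sum \<beta> n \<omega> - lower_sum \<alpha> n \<omega> - linear_part \<alpha> \<beta> n \<omega>)
            = sqrt (real n) * R\<beta> n \<omega> + (- 1) * (sqrt (real n) * R\<alpha> n \<omega>) + sqrt (real n) * e n"
          by (simp only: distrib_left right_diff_distrib)
        then show ?case by simp
      qed
    qed
  qed
qed

text \<open>The normalisation by the rounded number of terms instead of \<open>(\<beta> - \<alpha>) N\<close> has relative error of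
order \<open>1 / n\<close>, and it multiplies a bounded quantity.\<close>

lemma trimmed_U_linear_part:
  assumes "0 < \<alpha>" "\<alpha> < \<beta>" "\<beta> < 1"
  shows "vanishes_in_prob (\<lambda>n \<omega>. sqrt (real n) * ((\<beta> - \<alpha>) * trimmed_U X m h \<alpha> \<beta> n \<omega> - linear_part \<alpha> \<beta> n \<omega>))"
proof -
  have \<alpha>: "0 < \<alpha>" "\<alpha> < 1" and \<beta>: "0 < \<beta>" "\<beta> < 1" using assms by auto
  obtain C where C: "\<And>n \<omega>. \<bar>linear_part \<alpha> \<beta> n \<omega>\<bar> \<le> C" using linear_part_bounded[OF assms] by blast
  define D where "D n \<omega> = lower_sum \<beta> n \<omega> - lower_sum \<alpha> n \<omega> - linear_part \<alpha> \<beta> n \<omega>" for n \<omega>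
  define w where "w n = level \<beta> n - level \<alpha> n" for n
  define \<rho> where "\<rho> n = (\<beta> - \<alpha>) / w n" for n
  note [measurable] = lower_sum_measurable[OF \<alpha>] lower_sum_measurable[OF \<beta>] trimmed_U_measurable[OF assms]
  have w: "w \<longlonglongrightarrow> \<beta> - \<alpha>"
    unfolding w_def[abs_def] by (intro tendsto_diff level_tendsto \<alpha> \<beta>)
  then have "\<rho> \<longlonglongrightarrow> (\<beta> - \<alpha>) / (\<beta> - \<alpha>)"
    unfolding \<rho>_def[abs_def] using assms by (intro tendsto_divide tendsto_const) auto
  then have \<rho>: "\<rho> \<longlonglongrightarrow> 1" using assms by simp
  have wpos: "\<forall>\<^sub>F n in sequentially. 0 < w n"
    by (rule order_tendstoD(1)[OF w]) (use assms in simp)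
  have \<rho>2: "\<forall>\<^sub>F n in sequentially. \<rho> n < 2" by (rule order_tendstoD(2)[OF \<rho>]) simp
  have VD: "vanishes_in_prob (\<lambda>n \<omega>. sqrt (real n) * D n \<omega>)"
    unfolding D_def by (rule lower_sums_linear_part[OF assms])
  have "vanishes_in_prob (\<lambda>n \<omega>. \<rho> n * (sqrt (real n) * D n \<omega>))"
  proof (rule vanishes_in_prob_bound[OF VD, where c = 2])
    show "(\<lambda>\<omega>. \<rho> n * (sqrt (real n) * D n \<omega>)) \<in> borel_measurable P" for n
      unfolding D_def by measurable
    show "\<forall>\<^sub>F n in sequentially. AE \<omega> in P. \<bar>\<rho> n * (sqrt (real n) * D n \<omega>)\<bar> \<le> 2 * \<bar>sqrt (real n) * D n \<omega>\<bar>"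
      using \<rho>2 wpos
    proof eventually_elim
      case (elim n)
      then have "\<bar>\<rho> n\<bar> \<le> 2" using assms by (simp add: \<rho>_def)
      then show ?case by (intro AE_I2) (simp only: abs_mult[of "\<rho> n"], intro mult_right_mono, auto)
    qed
  qed
  moreover have "vanishes_in_prob (\<lambda>n \<omega>. sqrt (real n) * (\<rho> n - 1) * linear_part \<alpha> \<beta> n \<omega>)"
  proof (rule vanishes_in_prob_bound[OF vanishes_in_prob_const, where c = C])
    have "(\<lambda>n. (sqrt (real n) * \<bar>level \<alpha> n - \<alpha>\<bar> + sqrt (real n) * \<bar>level \<beta> n - \<beta>\<bar>) / w n) \<longlonglongrightarrow> (0 + 0) / (\<beta> - \<alpha>)"
      using assms by (intro tendsto_divide tendsto_add sqrt_level_tendsto w \<alpha> \<beta>) auto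
    then have lim: "(\<lambda>n. (sqrt (real n) * \<bar>level \<alpha> n - \<alpha>\<bar> + sqrt (real n) * \<bar>level \<beta> n - \<beta>\<bar>) / w n) \<longlonglongrightarrow> 0"
      by simp
    show "(\<lambda>n. sqrt (real n) * (\<rho> n - 1)) \<longlonglongrightarrow> 0"
    proof (rule Lim_null_comparison[OF _ lim])
      show "\<forall>\<^sub>F n in sequentially. norm (sqrt (real n) * (\<rho> n - 1))
          \<le> (sqrt (real n) * \<bar>level \<alpha> n - \<alpha>\<bar> + sqrt (real n) * \<bar>level \<beta> n - \<beta>\<bar>) / w n"
        using wpos
      proof eventually_elim
        case (elim n)
        have "\<rho> n - 1 = ((level \<alpha> n - \<alpha>) - (level \<beta> n - \<beta>)) / w n"
          using elim by (simp add: \<rho>_def w_def field_simps)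
        then have "\<bar>\<rho> n - 1\<bar> = \<bar>(level \<alpha> n - \<alpha>) - (level \<beta> n - \<beta>)\<bar> / w n"
          using elim by (simp add: abs_divide)
        also have "\<dots> \<le> (\<bar>level \<alpha> n - \<alpha>\<bar> + \<bar>level \<beta> n - \<beta>\<bar>) / w n"
          using elim by (intro divide_right_mono abs_triangle_ineq4) auto
        finally have "sqrt (real n) * \<bar>\<rho> n - 1\<bar> \<le> sqrt (real n) * ((\<bar>level \<alpha> n - \<alpha>\<bar> + \<bar>level \<beta> n - \<beta>\<bar>) / w n)"
          by (intro mult_left_mono) auto
        then show ?case by (simp add: abs_mult distrib_left)
      qed
    qed
    show "(\<lambda>\<omega>. sqrt (real n) * (\<rho> n - 1) * linear_part \<alpha> \<beta> n \<omega>) \<in> borel_measurable P" for n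
      by measurable
    show "\<forall>\<^sub>F n in sequentially. AE \<omega> in P. \<bar>sqrt (real n) * (\<rho> n - 1) * linear_part \<alpha> \<beta> n \<omega>\<bar>
        \<le> C * \<bar>sqrt (real n) * (\<rho> n - 1)\<bar>"
    proof (intro always_eventually allI AE_I2)
      fix n \<omega>
      show "\<bar>sqrt (real n) * (\<rho> n - 1) * linear_part \<alpha> \<beta> n \<omega>\<bar> \<le> C * \<bar>sqrt (real n) * (\<rho> n - 1)\<bar>"
        using mult_left_mono[OF C[of n \<omega>], of "\<bar>sqrt (real n) * (\<rho> n - 1)\<bar>"]
        by (simp add: abs_mult mult.commute)
    qed
  qed
  ultimately have V: "vanishes_in_prob (\<lambda>n \<omega>. \<rho> n * (sqrt (real n) * D n \<omega>)
      + sqrt (real n) * (\<rho> n - 1) * linear_part \<alpha> \<beta> n \<omega>)"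
    by (rule vanishes_in_prob_add)
  show ?thesis
  proof (rule vanishes_in_prob_bound[OF V, where c = 1])
    show "(\<lambda>\<omega>. sqrt (real n) * ((\<beta> - \<alpha>) * trimmed_U X m h \<alpha> \<beta> n \<omega> - linear_part \<alpha> \<beta> n \<omega>)) \<in> borel_measurable P" for n
      by measurable
    show "\<forall>\<^sub>F n in sequentially. AE \<omega> in P.
        \<bar>sqrt (real n) * ((\<beta> - \<alpha>) * trimmed_U X m h \<alpha> \<beta> n \<omega> - linear_part \<alpha> \<beta> n \<omega>)\<bar>
        \<le> 1 * \<bar>\<rho> n * (sqrt (real n) * D n \<omega>) + sqrt (real n) * (\<rho> n - 1) * linear_part \<alpha> \<beta> n \<omega>\<bar>"
      using eventually_ge_at_top[of m]
    proof eventually_elim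
      case (elim n)
      have "(\<beta> - \<alpha>) * trimmed_U X m h \<alpha> \<beta> n \<omega> = \<rho> n * (D n \<omega> + linear_part \<alpha> \<beta> n \<omega>)" for \<omega>
        unfolding trimmed_U_eq_lower_sum[OF assms elim] \<rho>_def w_def D_def by simp
      then show ?case by (simp add: algebra_simps)
    qed
  qed
qed

lemma sqrt_choose_two_tendsto: "(\<lambda>n. sqrt (real n) / sqrt (real (n choose 2))) \<longlonglongrightarrow> 0"
proof -
  have "(\<lambda>n. sqrt (2 / (real n - 1))) \<longlonglongrightarrow> sqrt 0"
  proof (intro tendsto_real_sqrt real_tendsto_divide_at_top[OF tendsto_const])
    have "filterlim (\<lambda>n. - 1 + real n) at_top sequentially"
      by (rule filterlim_tendsto_add_at_top[OF tendsto_const filterlim_real_sequentially])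
    then show "filterlim (\<lambda>n. real n - 1) at_top sequentially" by simp
  qed
  moreover have "\<forall>\<^sub>F n in sequentially. sqrt (2 / (real n - 1)) = sqrt (real n) / sqrt (real (n choose 2))"
    using eventually_ge_at_top[of 2]
  proof eventually_elim
    case (elim n)
    have "2 * (n choose 2) = n * (n - 1)"
      using times_binomial_minus1_eq[of 2 n] by (simp add: choose_one)
    from arg_cong[OF this, of real] have "real (n choose 2) = real n * (real n - 1) / 2"
      using elim by (simp add: of_nat_diff)
    then have "2 / (real n - 1) = real n / real (n choose 2)"
      using elim by (simp only:) (simp add: field_simps)
    then show ?case by (simp only: real_sqrt_divide)
  qed
  ultimately show ?thesis by (simp add: tendsto_cong)
qed

definition scaled_emp :: "(real \<Rightarrow> real) \<Rightarrow> nat \<Rightarrow> 'w \<Rightarrow> real" where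
  "scaled_emp f n \<omega> = sqrt (real n) / real m * (emp f n \<omega> - kernel_mean (\<lambda>z. f (h z)))"

definition hajek_sum :: "(real \<Rightarrow> real) \<Rightarrow> nat \<Rightarrow> 'w \<Rightarrow> real" where
  "hajek_sum f n \<omega> = (\<Sum>i=1..n. hajek (\<lambda>z. f (h z)) (X i \<omega>)) / sqrt (real n)"

lemma hajek_sum_measurable:
  assumes "f \<in> borel_measurable borel"
  shows "hajek_sum f n \<in> borel_measurable P"
  unfolding hajek_sum_def[abs_def]
  by (intro borel_measurable_divide borel_measurable_sum borel_measurable_const measurable_hajek_X
      measurable_fun_of_kernel assms)

lemma hajek_sum_approximates:
  assumes f: "f \<in> borel_measurable borel" and fB: "\<And>y. \<bar>f y\<bar> \<le> B"
  shows "vanishes_in_prob (\<lambda>n \<omega>. scaled_emp f n \<omega> - hajek_sum f n \<omega>)"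
proof (rule vanishes_in_prob_L1)
  have q: "(\<lambda>z. f (h z)) \<in> borel_measurable kernel_space" by (rule measurable_fun_of_kernel[OF f])
  have hint: "integrable P (\<lambda>\<omega>. hajek (\<lambda>z. f (h z)) (X i \<omega>))" for i
    by (rule integrable_bounded[OF measurable_hajek_X[OF q] abs_hajek_le[OF fB]])
  show "integrable P (\<lambda>\<omega>. scaled_emp f n \<omega> - hajek_sum f n \<omega>)" for n
    unfolding scaled_emp_def hajek_sum_def
    by (intro Bochner_Integration.integrable_diff integrable_mult_right integrable_emp[OF f fB] integrable_const
        integrable_divide Bochner_Integration.integrable_sum hint) 
  define K where "K = 1 / real m * (2 * (real m + 1) * B * real (m choose 2))"
  have "(\<lambda>n. K * (sqrt (real n) / sqrt (real (n choose 2)))) \<longlonglongrightarrow> 0"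
    by (rule tendsto_mult_right_zero[OF sqrt_choose_two_tendsto])
  then show "(\<lambda>n. expectation (\<lambda>\<omega>. \<bar>scaled_emp f n \<omega> - hajek_sum f n \<omega>\<bar>)) \<longlonglongrightarrow> 0"
  proof (rule Lim_null_comparison[rotated])
    show "\<forall>\<^sub>F n in sequentially. norm (expectation (\<lambda>\<omega>. \<bar>scaled_emp f n \<omega> - hajek_sum f n \<omega>\<bar>))
        \<le> K * (sqrt (real n) / sqrt (real (n choose 2)))"
      using eventually_ge_at_top[of "max m 2"]
    proof eventually_elim
      case (elim n)
      then have n: "m \<le> n" "2 \<le> n" by auto
      let ?d = "\<lambda>\<omega>. emp f n \<omega> - kernel_mean (\<lambda>z. f (h z)) - real m / real n * (\<Sum>i=1..n. hajek (\<lambda>z. f (h z)) (X i \<omega>))"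
      have "scaled_emp f n \<omega> - hajek_sum f n \<omega> = sqrt (real n) / real m * ?d \<omega>" for \<omega>
      proof -
        have "sqrt (real n) / real m * (real m / real n * s) = s / sqrt (real n)" for s
          using m_pos n by (simp add: field_simps)
        then show ?thesis by (simp add: scaled_emp_def hajek_sum_def right_diff_distrib)
      qed
      then have "expectation (\<lambda>\<omega>. \<bar>scaled_emp f n \<omega> - hajek_sum f n \<omega>\<bar>)
          = sqrt (real n) / real m * expectation (\<lambda>\<omega>. \<bar>?d \<omega>\<bar>)"
        by (simp add: abs_mult)
      also have "\<dots> \<le> sqrt (real n) / real m * (2 * (real m + 1) * B * real (m choose 2) / sqrt (real (n choose 2)))"
        by (intro mult_left_mono hajek_projection_L1[OF q fB symmetric_fun n]) simp
      finally show ?case by (simp add: K_def ac_simps)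
    qed
  qed
qed

end

section \<open>The limit law\<close>

text \<open>The map that sends the Gaussian vector to the limit variable, with \<open>c\<close> and \<open>d\<close> the jumps of the quantile
function at the two levels; the indicator terms are written as positive parts to make continuity evident.\<close>

definition limit_map :: "real \<Rightarrow> real \<Rightarrow> real ^ 3 \<Rightarrow> real" where
  "limit_map c d x = x $ 2 - c * max 0 (x $ 1) + d * max 0 (- x $ 3)"

lemma continuous_limit_map: "continuous_on UNIV (limit_map c d)"
  unfolding limit_map_def[abs_def] by (intro continuous_intros)

lemma borel_measurable_vector_3:
  assumes "f \<in> borel_measurable M" "g \<in> borel_measurable M" "k \<in> borel_measurable M"
  shows "(\<lambda>x. vector [f x, g x, k x] :: real ^ 3) \<in> borel_measurable M"
proof (rule borel_measurable_euclidean_space[THEN iffD2], intro ballI)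
  fix i :: "real ^ 3" assume "i \<in> Basis"
  then obtain j where "i = axis j 1" by (auto simp: Basis_vec_def)
  moreover have "j = 1 \<or> j = 2 \<or> j = 3" by (rule exhaust_3)
  ultimately show "(\<lambda>x. (vector [f x, g x, k x] :: real ^ 3) \<bullet> i) \<in> borel_measurable M"
    using assms by (auto simp: inner_axis)
qed

lemma limit_map_diff_le:
  "\<bar>limit_map c d (vector [x1, x2, x3]) - limit_map c d (vector [y1, y2, y3])\<bar>
    \<le> \<bar>x2 - y2\<bar> + \<bar>c\<bar> * \<bar>x1 - y1\<bar> + \<bar>d\<bar> * \<bar>x3 - y3\<bar>"
proof -
  have max: "\<bar>max 0 x - max 0 y\<bar> \<le> \<bar>x - y\<bar>" for x y :: real by (simp add: max_def)
  have "\<bar>c * (max 0 x1 - max 0 y1)\<bar> \<le> \<bar>c\<bar> * \<bar>x1 - y1\<bar>"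
    unfolding abs_mult by (intro mult_left_mono max) simp
  moreover have "\<bar>d * (max 0 (- x3) - max 0 (- y3))\<bar> \<le> \<bar>d\<bar> * \<bar>x3 - y3\<bar>"
    unfolding abs_mult using max[of "- x3" "- y3"] by (intro mult_left_mono) auto
  moreover have "limit_map c d (vector [x1, x2, x3]) - limit_map c d (vector [y1, y2, y3])
      = (x2 - y2) - c * (max 0 x1 - max 0 y1) + d * (max 0 (- x3) - max 0 (- y3))"
    unfolding limit_map_def vector_3 by (simp add: right_diff_distrib)
  moreover have "\<bar>p - q + r\<bar> \<le> \<bar>p\<bar> + Q + R" if "\<bar>q\<bar> \<le> Q" "\<bar>r\<bar> \<le> R" for p q r Q R :: real
    using that by linarith
  ultimately show ?thesis by simp
qed

context iid_kernel
begin

text \<open>Where the quantile function jumps, the level equals the mean of the corresponding indicator kernel, so its fluctuation is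
centred correctly. Where it does not jump, the term carries the factor zero.\<close>

lemma linear_part_eq_limit_map:
  assumes "0 < \<alpha>" "\<alpha> < \<beta>" "\<beta> < 1"
  shows "sqrt (real n) / real m * (linear_part \<alpha> \<beta> n \<omega> - theta P X m h \<alpha> \<beta>)
    = limit_map (quantile_jump (cdf law) \<alpha>) (quantile_jump (cdf law) \<beta>)
        (vector [scaled_emp (\<lambda>y. of_bool (y < upper_quantile (cdf law) \<alpha>)) n \<omega>,
                 scaled_emp (trim_fun (cdf law) \<alpha> \<beta>) n \<omega>,
                 scaled_emp (\<lambda>y. of_bool (y \<le> lower_quantile (cdf law) \<beta>)) n \<omega>])"
proof -
  interpret L: real_distribution law by (rule real_distribution_law)
  let ?c = "sqrt (real n) / real m"
  have scale: "?c * max 0 x = max 0 (?c * x)" for x by (simp add: max_mult_distrib_left)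
  have 1: "?c * (quantile_jump (cdf law) \<alpha> * max 0 (emp_less (upper_quantile (cdf law) \<alpha>) n \<omega> - \<alpha>))
      = quantile_jump (cdf law) \<alpha> * max 0 (scaled_emp (\<lambda>y. of_bool (y < upper_quantile (cdf law) \<alpha>)) n \<omega>)"
  proof (cases "quantile_jump (cdf law) \<alpha> = 0")
    case False
    then have "lower_quantile (cdf law) \<alpha> < upper_quantile (cdf law) \<alpha>"
      using L.lower_quantile_le_upper_quantile[of \<alpha>] assms by (simp add: quantile_jump_def)
    then have "measure law {..<upper_quantile (cdf law) \<alpha>} = \<alpha>"
      using L.quantile_gap(2)[of \<alpha>] assms by simp
    then show ?thesis
      unfolding scaled_emp_def kernel_mean_less scale[symmetric] by simp
  qed simp
  have 2: "?c * (quantile_jump (cdf law) \<beta> * max 0 (\<beta> - emp_le (lower_quantile (cdf law) \<beta>) n \<omega>))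
      = quantile_jump (cdf law) \<beta> * max 0 (- scaled_emp (\<lambda>y. of_bool (y \<le> lower_quantile (cdf law) \<beta>)) n \<omega>)"
  proof (cases "quantile_jump (cdf law) \<beta> = 0")
    case False
    then have "lower_quantile (cdf law) \<beta> < upper_quantile (cdf law) \<beta>"
      using L.lower_quantile_le_upper_quantile[of \<beta>] assms by (simp add: quantile_jump_def)
    then have "cdf law (lower_quantile (cdf law) \<beta>) = \<beta>"
      using L.quantile_gap(1)[of \<beta>] assms by simp
    then show ?thesis
      unfolding scaled_emp_def kernel_mean_le mult_minus_right[symmetric] minus_diff_eq scale[symmetric] by simp
  qed simp
  have split: "?c * (x - y + z - t) = ?c * (x - t) - ?c * y + ?c * z" for x y z t
    by (simp only: right_diff_distrib distrib_left)
  show ?thesis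
    unfolding linear_part_def limit_map_def vector_3 split 1 2
    by (simp add: scaled_emp_def kernel_mean_trim_fun)
qed

definition hajek_vector :: "real \<Rightarrow> real \<Rightarrow> nat \<Rightarrow> 'w \<Rightarrow> real ^ 3" where
  "hajek_vector \<alpha> \<beta> n \<omega> = vector
     [hajek_sum (\<lambda>y. of_bool (y < upper_quantile (cdf law) \<alpha>)) n \<omega>,
      hajek_sum (trim_fun (cdf law) \<alpha> \<beta>) n \<omega>,
      hajek_sum (\<lambda>y. of_bool (y \<le> lower_quantile (cdf law) \<beta>)) n \<omega>]"

lemma hajek_vector_measurable [measurable]: "hajek_vector \<alpha> \<beta> n \<in> borel_measurable P"
  unfolding hajek_vector_def[abs_def]
  by (intro borel_measurable_vector_3 hajek_sum_measurable trim_fun_measurable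
      measurable_of_bool_le measurable_of_bool_less)

text \<open>The statistic is a Lipschitz function of three scaled U-statistics, up to a vanishing term, and each of these is
replaced by its Hajek projection.\<close>

lemma trimmed_U_approximation:
  assumes "0 < \<alpha>" "\<alpha> < \<beta>" "\<beta> < 1"
  shows "vanishes_in_prob (\<lambda>n \<omega>.
    sqrt (real n) / real m * ((\<beta> - \<alpha>) * trimmed_U X m h \<alpha> \<beta> n \<omega> - theta P X m h \<alpha> \<beta>)
    - limit_map (quantile_jump (cdf law) \<alpha>) (quantile_jump (cdf law) \<beta>) (hajek_vector \<alpha> \<beta> n \<omega>))"
proof -
  let ?fa = "\<lambda>y::real. of_bool (y < upper_quantile (cdf law) \<alpha>) :: real"
  let ?fg = "trim_fun (cdf law) \<alpha> \<beta>"
  let ?fb = "\<lambda>y::real. of_bool (y \<le> lower_quantile (cdf law) \<beta>) :: real"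
  let ?c = "quantile_jump (cdf law) \<alpha>" and ?d = "quantile_jump (cdf law) \<beta>"
  define A where "A n \<omega> = 1 / real m * (sqrt (real n) * ((\<beta> - \<alpha>) * trimmed_U X m h \<alpha> \<beta> n \<omega> - linear_part \<alpha> \<beta> n \<omega>))" for n \<omega>
  define D where "D f n \<omega> = scaled_emp f n \<omega> - hajek_sum f n \<omega>" for f n \<omega>
  have "vanishes_in_prob (D ?fa)"
    unfolding D_def by (rule hajek_sum_approximates[OF measurable_of_bool_less, where B = 1]) simp
  moreover have "vanishes_in_prob (D ?fg)"
    unfolding D_def by (rule hajek_sum_approximates[OF trim_fun_measurable trim_fun_bounded])
  moreover have "vanishes_in_prob (D ?fb)"
    unfolding D_def by (rule hajek_sum_approximates[OF measurable_of_bool_le, where B = 1]) simp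
  moreover have "vanishes_in_prob A"
    unfolding A_def by (intro vanishes_in_prob_cmult trimmed_U_linear_part assms)
  ultimately have V: "vanishes_in_prob (\<lambda>n \<omega>. \<bar>A n \<omega>\<bar> + (\<bar>D ?fg n \<omega>\<bar> + (\<bar>?c\<bar> * \<bar>D ?fa n \<omega>\<bar> + \<bar>?d\<bar> * \<bar>D ?fb n \<omega>\<bar>)))"
    by (intro vanishes_in_prob_add vanishes_in_prob_abs vanishes_in_prob_cmult)
  show ?thesis
  proof (rule vanishes_in_prob_bound[OF V, where c = 1])
    have lm: "limit_map ?c ?d \<in> borel_measurable borel"
      by (rule borel_measurable_continuous_onI[OF continuous_limit_map])
    show "(\<lambda>\<omega>. sqrt (real n) / real m * ((\<beta> - \<alpha>) * trimmed_U X m h \<alpha> \<beta> n \<omega> - theta P X m h \<alpha> \<beta>)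
        - limit_map ?c ?d (hajek_vector \<alpha> \<beta> n \<omega>)) \<in> borel_measurable P" for n
      by (intro borel_measurable_diff borel_measurable_times borel_measurable_const
          trimmed_U_measurable[OF assms] measurable_compose[OF hajek_vector_measurable lm])
    show "\<forall>\<^sub>F n in sequentially. AE \<omega> in P.
      \<bar>sqrt (real n) / real m * ((\<beta> - \<alpha>) * trimmed_U X m h \<alpha> \<beta> n \<omega> - theta P X m h \<alpha> \<beta>)
        - limit_map ?c ?d (hajek_vector \<alpha> \<beta> n \<omega>)\<bar>
      \<le> 1 * \<bar>\<bar>A n \<omega>\<bar> + (\<bar>D ?fg n \<omega>\<bar> + (\<bar>?c\<bar> * \<bar>D ?fa n \<omega>\<bar> + \<bar>?d\<bar> * \<bar>D ?fb n \<omega>\<bar>))\<bar>"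
    proof (intro always_eventually allI AE_I2)
      fix n \<omega>
      let ?W = "vector [scaled_emp ?fa n \<omega>, scaled_emp ?fg n \<omega>, scaled_emp ?fb n \<omega>] :: real ^ 3"
      have "sqrt (real n) / real m * ((\<beta> - \<alpha>) * trimmed_U X m h \<alpha> \<beta> n \<omega> - theta P X m h \<alpha> \<beta>)
          = A n \<omega> + sqrt (real n) / real m * (linear_part \<alpha> \<beta> n \<omega> - theta P X m h \<alpha> \<beta>)"
        by (simp add: A_def diff_divide_distrib right_diff_distrib)
      also have "\<dots> = A n \<omega> + limit_map ?c ?d ?W"
        by (simp only: linear_part_eq_limit_map[OF assms])
      finally have eq: "sqrt (real n) / real m * ((\<beta> - \<alpha>) * trimmed_U X m h \<alpha> \<beta> n \<omega> - theta P X m h \<alpha> \<beta>)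
          - limit_map ?c ?d (hajek_vector \<alpha> \<beta> n \<omega>)
          = A n \<omega> + (limit_map ?c ?d ?W - limit_map ?c ?d (hajek_vector \<alpha> \<beta> n \<omega>))" by simp
      have "\<bar>limit_map ?c ?d ?W - limit_map ?c ?d (hajek_vector \<alpha> \<beta> n \<omega>)\<bar>
          \<le> \<bar>D ?fg n \<omega>\<bar> + \<bar>?c\<bar> * \<bar>D ?fa n \<omega>\<bar> + \<bar>?d\<bar> * \<bar>D ?fb n \<omega>\<bar>"
        unfolding hajek_vector_def D_def by (rule limit_map_diff_le)
      moreover have "\<bar>x + y\<bar> \<le> 1 * \<bar>\<bar>x\<bar> + (p + (q + r))\<bar>" if "\<bar>y\<bar> \<le> p + q + r" for x y p q r :: real
        using that abs_triangle_ineq[of x y] abs_ge_self[of "\<bar>x\<bar> + (p + (q + r))"] by linarith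
      ultimately show "\<bar>sqrt (real n) / real m * ((\<beta> - \<alpha>) * trimmed_U X m h \<alpha> \<beta> n \<omega> - theta P X m h \<alpha> \<beta>)
        - limit_map ?c ?d (hajek_vector \<alpha> \<beta> n \<omega>)\<bar>
      \<le> 1 * \<bar>\<bar>A n \<omega>\<bar> + (\<bar>D ?fg n \<omega>\<bar> + (\<bar>?c\<bar> * \<bar>D ?fa n \<omega>\<bar> + \<bar>?d\<bar> * \<bar>D ?fb n \<omega>\<bar>))\<bar>"
        unfolding eq by blast
    qed
  qed
qed

definition proj_vector :: "real \<Rightarrow> real \<Rightarrow> 'a \<Rightarrow> real ^ 3" where
  "proj_vector \<alpha> \<beta> x = vector [proj_lower P X m h \<alpha> x, proj_g P X m h \<alpha> \<beta> x, proj_upper P X m h \<beta> x]"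

lemma proj_bounded_measurable_centered:
  shows "proj_lower P X m h \<alpha> \<in> borel_measurable S" "\<bar>proj_lower P X m h \<alpha> x\<bar> \<le> 2"
    "expectation (\<lambda>\<omega>. proj_lower P X m h \<alpha> (X i \<omega>)) = 0"
    and "proj_upper P X m h \<beta> \<in> borel_measurable S" "\<bar>proj_upper P X m h \<beta> x\<bar> \<le> 2"
    "expectation (\<lambda>\<omega>. proj_upper P X m h \<beta> (X i \<omega>)) = 0"
    and "proj_g P X m h \<alpha> \<beta> \<in> borel_measurable S"
    "\<bar>proj_g P X m h \<alpha> \<beta> x\<bar> \<le> 2 * (\<bar>\<beta> * lower_quantile (cdf law) \<beta> - \<alpha> * upper_quantile (cdf law) \<alpha>\<bar>
        + \<bar>lower_quantile (cdf law) \<beta> - upper_quantile (cdf law) \<alpha>\<bar>)"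
    "expectation (\<lambda>\<omega>. proj_g P X m h \<alpha> \<beta> (X i \<omega>)) = 0"
proof -
  note qa = measurable_fun_of_kernel[OF measurable_of_bool_less]
  note qb = measurable_fun_of_kernel[OF measurable_of_bool_le]
  note qg = measurable_fun_of_kernel[OF trim_fun_measurable]
  show "proj_lower P X m h \<alpha> \<in> borel_measurable S"
    unfolding proj_lower_eq_hajek[abs_def] by (rule measurable_hajek[OF qa])
  show "proj_upper P X m h \<beta> \<in> borel_measurable S"
    unfolding proj_upper_eq_hajek[abs_def] by (rule measurable_hajek[OF qb])
  show "proj_g P X m h \<alpha> \<beta> \<in> borel_measurable S"
    unfolding proj_g_eq_hajek[abs_def] by (rule measurable_hajek[OF qg])
  show "\<bar>proj_lower P X m h \<alpha> x\<bar> \<le> 2"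
    unfolding proj_lower_eq_hajek by (rule abs_hajek_le[where B = 1, simplified]) simp
  show "\<bar>proj_upper P X m h \<beta> x\<bar> \<le> 2"
    unfolding proj_upper_eq_hajek by (rule abs_hajek_le[where B = 1, simplified]) simp
  show "\<bar>proj_g P X m h \<alpha> \<beta> x\<bar> \<le> 2 * (\<bar>\<beta> * lower_quantile (cdf law) \<beta> - \<alpha> * upper_quantile (cdf law) \<alpha>\<bar>
        + \<bar>lower_quantile (cdf law) \<beta> - upper_quantile (cdf law) \<alpha>\<bar>)"
    unfolding proj_g_eq_hajek by (rule abs_hajek_le) (rule trim_fun_bounded)
  show "expectation (\<lambda>\<omega>. proj_lower P X m h \<alpha> (X i \<omega>)) = 0"
    unfolding proj_lower_eq_hajek by (rule expectation_hajek[OF qa, where B = 1]) simp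
  show "expectation (\<lambda>\<omega>. proj_upper P X m h \<beta> (X i \<omega>)) = 0"
    unfolding proj_upper_eq_hajek by (rule expectation_hajek[OF qb, where B = 1]) simp
  show "expectation (\<lambda>\<omega>. proj_g P X m h \<alpha> \<beta> (X i \<omega>)) = 0"
    unfolding proj_g_eq_hajek by (rule expectation_hajek[OF qg]) (rule trim_fun_bounded)
qed

lemma hajek_vector_eq: "t \<bullet> hajek_vector \<alpha> \<beta> n \<omega> = (\<Sum>i=1..n. t \<bullet> proj_vector \<alpha> \<beta> (X i \<omega>)) / sqrt (real n)"
  unfolding hajek_vector_def proj_vector_def hajek_sum_def inner_vec_def sum_3 vector_3
    proj_lower_eq_hajek proj_g_eq_hajek proj_upper_eq_hajek
  by (simp add: sum.distrib sum_distrib_left[symmetric] add_divide_distrib)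

lemma hajek_vector_char_tendsto:
  "(\<lambda>n. CLINT \<omega>|P. iexp (t \<bullet> hajek_vector \<alpha> \<beta> n \<omega>))
    \<longlonglongrightarrow> complex_of_real (exp (- expectation (\<lambda>\<omega>. (t \<bullet> proj_vector \<alpha> \<beta> (X 0 \<omega>))\<^sup>2) / 2))"
proof -
  note pb = proj_bounded_measurable_centered
  let ?G = "\<lambda>x. t \<bullet> proj_vector \<alpha> \<beta> x"
  have G: "?G x = t $ 1 * proj_lower P X m h \<alpha> x + t $ 2 * proj_g P X m h \<alpha> \<beta> x + t $ 3 * proj_upper P X m h \<beta> x" for x
    unfolding proj_vector_def inner_vec_def sum_3 vector_3 by simp
  have Gm: "?G \<in> borel_measurable S"
    unfolding G[abs_def] by (intro borel_measurable_add borel_measurable_times borel_measurable_const pb)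
  have comp_int: "integrable P (\<lambda>\<omega>. f (X i \<omega>))" if "f \<in> borel_measurable S" "\<And>x. \<bar>f x\<bar> \<le> B" for f :: "'a \<Rightarrow> real" and B i
    by (rule integrable_bounded[OF measurable_compose[OF X_measurable that(1)] that(2)])
  let ?B = "2 * (\<bar>\<beta> * lower_quantile (cdf law) \<beta> - \<alpha> * upper_quantile (cdf law) \<alpha>\<bar>
        + \<bar>lower_quantile (cdf law) \<beta> - upper_quantile (cdf law) \<alpha>\<bar>)"
  define C where "C = \<bar>t $ 1\<bar> * 2 + \<bar>t $ 2\<bar> * ?B + \<bar>t $ 3\<bar> * 2"
  have GC: "\<bar>?G x\<bar> \<le> C" for x
  proof -
    have "\<bar>?G x\<bar> \<le> \<bar>t $ 1\<bar> * \<bar>proj_lower P X m h \<alpha> x\<bar> + \<bar>t $ 2\<bar> * \<bar>proj_g P X m h \<alpha> \<beta> x\<bar> + \<bar>t $ 3\<bar> * \<bar>proj_upper P X m h \<beta> x\<bar>"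
      unfolding G abs_mult[symmetric] by linarith
    also have "\<dots> \<le> C"
      unfolding C_def by (intro add_mono mult_left_mono pb abs_ge_zero)
    finally show ?thesis .
  qed
  have "expectation (\<lambda>\<omega>. ?G (X i \<omega>)) = 0" for i
    unfolding G using comp_int[OF pb(1,2)] comp_int[OF pb(4,5)] comp_int[OF pb(7,8)]
    by (simp add: pb(3,6,9))
  moreover have "integrable P (\<lambda>\<omega>. (?G (X i \<omega>))\<^sup>2)" for i
  proof -
    have "0 \<le> C" using GC[THEN order_trans[OF abs_ge_zero]] .
    then have "\<bar>(?G x)\<^sup>2\<bar> \<le> C\<^sup>2" for x using GC[of x] by (simp add: abs_le_square_iff[symmetric])
    then show ?thesis by (rule comp_int[OF borel_measurable_power[OF Gm]])
  qed
  moreover have "distr P borel (\<lambda>\<omega>. ?G (X i \<omega>)) = distr F borel ?G" for i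
    unfolding distr_X[of i, symmetric] by (subst distr_distr[OF Gm X_measurable]) (simp add: comp_def)
  moreover have "indep_vars (\<lambda>_. borel) (\<lambda>i \<omega>. ?G (X i \<omega>)) UNIV"
    by (rule indep_vars_compose2[OF indep Gm])
  ultimately show ?thesis
    unfolding hajek_vector_eq by (intro iid_sum_char_tendsto)
qed

lemma expectation_proj_vector_square:
  "expectation (\<lambda>\<omega>. (t \<bullet> proj_vector \<alpha> \<beta> (X 0 \<omega>))\<^sup>2)
    = (\<Sum>i\<in>UNIV. \<Sum>j\<in>UNIV. t $ i * t $ j
        * expectation (\<lambda>\<omega>. proj_vector \<alpha> \<beta> (X 0 \<omega>) $ i * proj_vector \<alpha> \<beta> (X 0 \<omega>) $ j))"
proof -
  note pb = proj_bounded_measurable_centered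
  have coord: "(\<lambda>x. proj_vector \<alpha> \<beta> x $ i) \<in> borel_measurable S \<and> (\<exists>B. \<forall>x. \<bar>proj_vector \<alpha> \<beta> x $ i\<bar> \<le> B)" for i
  proof -
    consider "i = 1" | "i = 2" | "i = 3" using exhaust_3[of i] by blast
    then show ?thesis
    proof cases
      case 1
      then show ?thesis unfolding proj_vector_def using pb(1,2)[of \<alpha>] by (simp only: vector_3) blast
    next
      case 2
      then show ?thesis unfolding proj_vector_def using pb(7,8)[of \<alpha> \<beta>] by (simp only: vector_3) blast
    next
      case 3
      then show ?thesis unfolding proj_vector_def using pb(4,5)[of \<beta>] by (simp only: vector_3) blast
    qed
  qed
  have int: "integrable P (\<lambda>\<omega>. proj_vector \<alpha> \<beta> (X 0 \<omega>) $ i * proj_vector \<alpha> \<beta> (X 0 \<omega>) $ j)" for i j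
  proof -
    from coord[of i] obtain B where mi: "(\<lambda>x. proj_vector \<alpha> \<beta> x $ i) \<in> borel_measurable S"
      and B: "\<And>x. \<bar>proj_vector \<alpha> \<beta> x $ i\<bar> \<le> B" by blast
    from coord[of j] obtain C where mj: "(\<lambda>x. proj_vector \<alpha> \<beta> x $ j) \<in> borel_measurable S"
      and C: "\<And>x. \<bar>proj_vector \<alpha> \<beta> x $ j\<bar> \<le> C" by blast
    show ?thesis
    proof (rule integrable_bounded[OF measurable_compose[OF X_measurable borel_measurable_times[OF mi mj]]])
      show "\<bar>proj_vector \<alpha> \<beta> (X 0 \<omega>) $ i * proj_vector \<alpha> \<beta> (X 0 \<omega>) $ j\<bar> \<le> B * C" for \<omega>
        unfolding abs_mult
        by (rule mult_mono[OF B C order_trans[OF abs_ge_zero B] abs_ge_zero])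
    qed
  qed
  have "expectation (\<lambda>\<omega>. (t \<bullet> proj_vector \<alpha> \<beta> (X 0 \<omega>))\<^sup>2)
      = expectation (\<lambda>\<omega>. \<Sum>i\<in>UNIV. \<Sum>j\<in>UNIV. t $ i * t $ j * (proj_vector \<alpha> \<beta> (X 0 \<omega>) $ i * proj_vector \<alpha> \<beta> (X 0 \<omega>) $ j))"
    by (intro Bochner_Integration.integral_cong refl)
       (simp add: inner_vec_def power2_eq_square sum_product ac_simps)
  also have "\<dots> = (\<Sum>i\<in>UNIV. \<Sum>j\<in>UNIV. t $ i * t $ j
        * expectation (\<lambda>\<omega>. proj_vector \<alpha> \<beta> (X 0 \<omega>) $ i * proj_vector \<alpha> \<beta> (X 0 \<omega>) $ j))"
    by (simp add: int)
  finally show ?thesis .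
qed

end

text \<open>The covariance matrix of the statement is that of the three Hajek projections, so the limit of the characteristic functions
of the projection sums is the characteristic function of the given Gaussian vector.\<close>

theorem theorem1p1:
  fixes P :: "'w measure" and S F :: "'a measure" and X :: "nat \<Rightarrow> 'w \<Rightarrow> 'a"
    and m :: nat and h :: "(nat \<Rightarrow> 'a) \<Rightarrow> real" and \<alpha> \<beta> :: real
    and Q :: "'q measure" and \<tau>\<^sub>\<alpha> \<tau>\<^sub>g \<tau>\<^sub>\<beta> :: "'q \<Rightarrow> real"
  defines "H \<equiv> kernel_cdf P X m h"
    and "g \<equiv> proj_g P X m h \<alpha> \<beta>"
    and "g\<^sub>\<alpha> \<equiv> proj_lower P X m h \<alpha>"
    and "g\<^sub>\<beta> \<equiv> proj_upper P X m h \<beta>"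
  defines "E \<equiv> (\<lambda>f. \<integral>\<omega>. f (X 0 \<omega>) \<partial>P)"
  assumes "prob_space P"
    and "prob_space.indep_vars P (\<lambda>_. S) X UNIV"
    and "\<And>i. distr P S (X i) = F"
    and "m \<ge> 1"
    and "h \<in> borel_measurable (PiM {1..m} (\<lambda>_. S))"
    and "symmetric_kernel S m h"
    and "0 < \<alpha>" and "\<alpha> < \<beta>" and "\<beta> < 1"
    and "E (\<lambda>x. (g x)\<^sup>2) > 0"
    and "prob_space Q"
    and "gaussian_vector Q (\<lambda>\<omega>. vector [\<tau>\<^sub>\<alpha> \<omega>, \<tau>\<^sub>g \<omega>, \<tau>\<^sub>\<beta> \<omega>] :: real ^ 3) 0
           (vector
             [vector [E (\<lambda>x. (g\<^sub>\<alpha> x)\<^sup>2),    E (\<lambda>x. g x * g\<^sub>\<alpha> x), E (\<lambda>x. g\<^sub>\<alpha> x * g\<^sub>\<beta> x)],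
              vector [E (\<lambda>x. g x * g\<^sub>\<alpha> x),  E (\<lambda>x. (g x)\<^sup>2),    E (\<lambda>x. g x * g\<^sub>\<beta> x)],
              vector [E (\<lambda>x. g\<^sub>\<alpha> x * g\<^sub>\<beta> x), E (\<lambda>x. g x * g\<^sub>\<beta> x), E (\<lambda>x. (g\<^sub>\<beta> x)\<^sup>2)]])"
  shows "weak_conv_m
    (\<lambda>n. distr P borel
      (\<lambda>\<omega>. sqrt (real n) / real m
             * ((\<beta> - \<alpha>) * trimmed_U X m h \<alpha> \<beta> n \<omega> - theta P X m h \<alpha> \<beta>)))
    (distr Q borel
      (\<lambda>\<omega>. \<tau>\<^sub>g \<omega>
             - quantile_jump H \<alpha> * of_bool (\<tau>\<^sub>\<alpha> \<omega> > 0) * \<tau>\<^sub>\<alpha> \<omega>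
             - quantile_jump H \<beta> * of_bool (\<tau>\<^sub>\<beta> \<omega> < 0) * \<tau>\<^sub>\<beta> \<omega>))"
proof -
  note P = \<open>prob_space P\<close> and Q = \<open>prob_space Q\<close>
  note levels = \<open>0 < \<alpha>\<close> \<open>\<alpha> < \<beta>\<close> \<open>\<beta> < 1\<close>
  interpret P: prob_space P by (rule P)
  interpret iid_kernel P S F X m h
    by unfold_locales (use assms(7-11) in auto)
  define Z where "Z \<omega> = (vector [\<tau>\<^sub>\<alpha> \<omega>, \<tau>\<^sub>g \<omega>, \<tau>\<^sub>\<beta> \<omega>] :: real ^ 3)" for \<omega>
  define \<psi> where "\<psi> = limit_map (quantile_jump H \<alpha>) (quantile_jump H \<beta>)"
  have H: "H = cdf law" by (simp add: H_def kernel_cdf_def)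
  define \<Sigma> :: "real ^ 3 ^ 3" where "\<Sigma> = (\<chi> i j. E (\<lambda>x. proj_vector \<alpha> \<beta> x $ i * proj_vector \<alpha> \<beta> x $ j))"
  have "gaussian_vector Q Z 0 \<Sigma>"
  proof -
    have "vector
             [vector [E (\<lambda>x. (g\<^sub>\<alpha> x)\<^sup>2),    E (\<lambda>x. g x * g\<^sub>\<alpha> x), E (\<lambda>x. g\<^sub>\<alpha> x * g\<^sub>\<beta> x)],
              vector [E (\<lambda>x. g x * g\<^sub>\<alpha> x),  E (\<lambda>x. (g x)\<^sup>2),    E (\<lambda>x. g x * g\<^sub>\<beta> x)],
              vector [E (\<lambda>x. g\<^sub>\<alpha> x * g\<^sub>\<beta> x), E (\<lambda>x. g x * g\<^sub>\<beta> x), E (\<lambda>x. (g\<^sub>\<beta> x)\<^sup>2)]] = \<Sigma>"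
      unfolding vec_eq_iff forall_3 vector_3 \<Sigma>_def vec_lambda_beta proj_vector_def
        g_def[symmetric] g\<^sub>\<alpha>_def[symmetric] g\<^sub>\<beta>_def[symmetric]
      by (simp add: power2_eq_square mult.commute)
    with assms(17) show ?thesis by (simp add: Z_def[abs_def])
  qed
  then have Zm: "Z \<in> borel_measurable Q" by (simp add: gaussian_vector_def)
  have Zchar: "(CLINT \<omega>|Q. iexp (t \<bullet> Z \<omega>))
      = complex_of_real (exp (- P.expectation (\<lambda>\<omega>. (t \<bullet> proj_vector \<alpha> \<beta> (X 0 \<omega>))\<^sup>2) / 2))" for t
    using gaussian_vector_char[OF Q \<open>gaussian_vector Q Z 0 \<Sigma>\<close>, of t]
    by (simp add: expectation_proj_vector_square \<Sigma>_def E_def)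
  have \<psi>m: "\<psi> \<in> borel_measurable borel"
    unfolding \<psi>_def by (rule borel_measurable_continuous_onI[OF continuous_limit_map])
  let ?T = "\<lambda>n \<omega>. sqrt (real n) / real m * ((\<beta> - \<alpha>) * trimmed_U X m h \<alpha> \<beta> n \<omega> - theta P X m h \<alpha> \<beta>)"
  have Tm: "?T n \<in> borel_measurable P" for n
    by (intro borel_measurable_times borel_measurable_diff borel_measurable_const trimmed_U_measurable[OF levels])
  have "weak_conv_m (\<lambda>n. distr P borel (?T n)) (distr Q borel (\<lambda>\<omega>. \<psi> (Z \<omega>)))"
  proof (rule weak_conv_of_char_tendsto[OF P Q Tm measurable_compose[OF Zm \<psi>m]])
    fix s :: real
    have lim: "(\<lambda>n. CLINT \<omega>|P. iexp (s * \<psi> (hajek_vector \<alpha> \<beta> n \<omega>))) \<longlonglongrightarrow> (CLINT \<omega>|Q. iexp (s * \<psi> (Z \<omega>)))"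
    proof (rule char_tendsto_continuous_image[OF P Q hajek_vector_measurable Zm])
      show "(\<lambda>n. CLINT \<omega>|P. iexp (t \<bullet> hajek_vector \<alpha> \<beta> n \<omega>)) \<longlonglongrightarrow> (CLINT \<omega>|Q. iexp (t \<bullet> Z \<omega>))" for t
        unfolding Zchar by (rule hajek_vector_char_tendsto)
      show "continuous_on UNIV (\<lambda>x. s * \<psi> x)"
        unfolding \<psi>_def by (intro continuous_on_mult_left continuous_limit_map)
    qed
    have "P.vanishes_in_prob (\<lambda>n \<omega>. ?T n \<omega> - \<psi> (hajek_vector \<alpha> \<beta> n \<omega>))"
      unfolding \<psi>_def H by (rule trimmed_U_approximation[OF levels])
    from P.char_tendsto_perturb[OF this Tm measurable_compose[OF hajek_vector_measurable \<psi>m] lim]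
    show "(\<lambda>n. CLINT \<omega>|P. iexp (s * ?T n \<omega>)) \<longlonglongrightarrow> (CLINT \<omega>|Q. iexp (s * \<psi> (Z \<omega>)))" .
  qed
  moreover have "(\<lambda>\<omega>. \<psi> (Z \<omega>)) = (\<lambda>\<omega>. \<tau>\<^sub>g \<omega>
             - quantile_jump H \<alpha> * of_bool (\<tau>\<^sub>\<alpha> \<omega> > 0) * \<tau>\<^sub>\<alpha> \<omega>
             - quantile_jump H \<beta> * of_bool (\<tau>\<^sub>\<beta> \<omega> < 0) * \<tau>\<^sub>\<beta> \<omega>)"
    unfolding \<psi>_def Z_def limit_map_def vector_3 by (auto simp: fun_eq_iff max_def)
  ultimately show ?thesis by simp
qed

end
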